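(* Let $n$ be a positive integer and let $A$ be an antipodal $5$-splitting of $Q_2^n$. Then the collection $\beta(A)$ of $5$-subsets of $\{1,\dots,n\}$ is equivalent either to $E=\{\{1,2,3,5,6\}, \{1,2,4,5,6\}, \{1,3,4,5,6\}, \{2,3,4,5,6\}, \{1,2,3,5,7\}, \{1,2,4,5,7\}, \{1,3,4,5,7\}, \{2,3,4,5,7\}, \{1,2,3,6,7\}, \{1,2,4,6,7\}, \{1,3,4,6,7\}, \{2,3,4,6,8\},\{2,3,4,7,8\},\{2,3,6,7,8\},\{2,4,6,7,8\},\{3,4,6,7,8\}\}$ or to $F=\{\{1,2,3,5,7\}, \{1,2,4,5,7\}, \{1,3,4,5,7\}, \{2,3,4,5,7\}, \{1,2,3,6,7\}, \{1,2,4,6,7\}, \{1,3,4,6,7\}, \{2,3,4,6,7\}, \{1,2,3,6,8\}, \{1,2,4,6,8\}, \{1,3,4,6,8\}, \{2,3,4,6,8\}, \{1,2,3,5,8\}, \{1,2,4,5,8\}, \{1,3,4,5,8\}, \{2,3,4,5,8\}\}$.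
   Context: $Q_2^n=\{0,1\}^n$ is the Boolean hypercube. For $0\le m\le n$, an $m$-face of $Q_2^n$ is given by a tuple $a=(a_1,\dots,a_n)\in\{0,1,*\}^n$ with exactly $m$ entries equal to $*$; it denotes the set $\{x\in Q_2^n : x_i=a_i \text{ whenever } a_i\in\{0,1\}\}$. The direction of a face is the set of positions of its asterisks; two faces are parallel if they have the same direction, and two parallel faces $a,b$ are antipodal if $b_i=1-a_i$ at every non-asterisk position $i$. For positive integers $k< n$, an antipodal $k$-splitting of $Q_2^n$ is a collection of exactly $2^k$ $(n-k)$-faces whose union is $Q_2^n$ and which contains no pair of parallel non-antipodal faces. For a face $a$ let $\beta(a)=\{i : a_i\in\{0,1\}\}$, and for a collection $A$ of faces let $\beta(A)=\{\beta(a): a\in A\}$ (a set of subsets). Two collections $U_1$ of subsets of a set $V_1$ and $U_2$ of subsets of a set $V_2$ are equivalent if there is an injection $f:V_1\to V_2$ with $U_2=\{f(u): u\in U_1\}$. *)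

theory Defs
  imports Main
begin

text \<open>Coordinates are indexed by 1..n. A point of Q_2^n is a function nat => bool that is
False outside 1..n. A face is a function nat => bool option (None = asterisk) that is None
outside 1..n.\<close>

definition cube :: "nat \<Rightarrow> (nat \<Rightarrow> bool) set" where
  "cube n = {x. \<forall>i. i \<notin> {1..n} \<longrightarrow> x i = False}"

definition is_face :: "nat \<Rightarrow> nat \<Rightarrow> (nat \<Rightarrow> bool option) \<Rightarrow> bool" where
  "is_face n m a \<longleftrightarrow> (\<forall>i. i \<notin> {1..n} \<longrightarrow> a i = None) \<and> card {i\<in>{1..n}. a i = None} = m"

definition face_pts :: "nat \<Rightarrow> (nat \<Rightarrow> bool option) \<Rightarrow> (nat \<Rightarrow> bool) set" where
  "face_pts n a = {x \<in> cube n. \<forall>i\<in>{1..n}. \<forall>v. a i = Some v \<longrightarrow> x i = v}"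

definition direction :: "nat \<Rightarrow> (nat \<Rightarrow> bool option) \<Rightarrow> nat set" where
  "direction n a = {i\<in>{1..n}. a i = None}"

definition parallel :: "nat \<Rightarrow> (nat \<Rightarrow> bool option) \<Rightarrow> (nat \<Rightarrow> bool option) \<Rightarrow> bool" where
  "parallel n a b \<longleftrightarrow> direction n a = direction n b"

definition antipodal :: "nat \<Rightarrow> (nat \<Rightarrow> bool option) \<Rightarrow> (nat \<Rightarrow> bool option) \<Rightarrow> bool" where
  "antipodal n a b \<longleftrightarrow> parallel n a b \<and>
     (\<forall>i\<in>{1..n}. \<forall>v. a i = Some v \<longrightarrow> b i = Some (\<not> v))"

definition antipodal_splitting :: "nat \<Rightarrow> nat \<Rightarrow> (nat \<Rightarrow> bool option) set \<Rightarrow> bool" where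
  "antipodal_splitting n k A \<longleftrightarrow> 0 < k \<and> k < n \<and>
     (\<forall>a\<in>A. is_face n (n - k) a) \<and> finite A \<and> card A = 2 ^ k \<and>
     (\<Union>a\<in>A. face_pts n a) = cube n \<and>
     (\<forall>a\<in>A. \<forall>b\<in>A. a \<noteq> b \<and> parallel n a b \<longrightarrow> antipodal n a b)"

definition beta :: "nat \<Rightarrow> (nat \<Rightarrow> bool option) \<Rightarrow> nat set" where
  "beta n a = {i\<in>{1..n}. a i \<noteq> None}"

definition equivalent :: "'a set \<Rightarrow> 'a set set \<Rightarrow> 'b set \<Rightarrow> 'b set set \<Rightarrow> bool" where
  "equivalent V1 U1 V2 U2 \<longleftrightarrow>
     (\<exists>f. inj_on f V1 \<and> f ` V1 \<subseteq> V2 \<and> U2 = (\<lambda>u. f ` u) ` U1)"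

definition E_coll :: "nat set set" where
  "E_coll = {{1,2,3,5,6}, {1,2,4,5,6}, {1,3,4,5,6}, {2,3,4,5,6}, {1,2,3,5,7}, {1,2,4,5,7},
    {1,3,4,5,7}, {2,3,4,5,7}, {1,2,3,6,7}, {1,2,4,6,7}, {1,3,4,6,7}, {2,3,4,6,8},
    {2,3,4,7,8}, {2,3,6,7,8}, {2,4,6,7,8}, {3,4,6,7,8}}"

definition F_coll :: "nat set set" where
  "F_coll = {{1,2,3,5,7}, {1,2,4,5,7}, {1,3,4,5,7}, {2,3,4,5,7}, {1,2,3,6,7}, {1,2,4,6,7},
    {1,3,4,6,7}, {2,3,4,6,7}, {1,2,3,6,8}, {1,2,4,6,8}, {1,3,4,6,8}, {2,3,4,6,8},
    {1,2,3,5,8}, {1,2,4,5,8}, {1,3,4,5,8}, {2,3,4,5,8}}"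

end

theory Submission
  imports Defs
begin

text \<open>Counting points shows that the 32 faces are pairwise disjoint, and comparing Walsh
  coefficients of the sum of their indicator functions with those of the constant function 1
  shows two things. For the coefficient at a set of five coordinates: the splitting is closed under
  taking opposite faces. For the coefficient at a set of four coordinates: the faces fixing these
  coordinates are balanced, i.e. half of them differ from a given one in an even number of these
  coordinates, half in an odd number. So a face and four of its fixed coordinates always force
  another face that fixes them and, up to taking opposites, differs in exactly one of them.
  Moreover two faces that are neither equal nor opposite must both agree somewhere and
  differ somewhere, and their sets of fixed coordinates are different.

  Starting from a single face, a finite case analysis of these forced extensions leads to the two
  families. It is organised by patterns (finite sets of faces up to injective renaming and switching
  of coordinates): a pattern is settled if every extension at some four coordinates contains a
  pattern that is already settled. About two hundred patterns suffice.\<close>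

section \<open>Walsh coefficients of a splitting\<close>

text \<open>At a set of odd size the weights of a face and its opposite cancel, so once a splitting
  is closed under taking opposites these coefficients say nothing more. Among the sets of even size,
  those with four elements leave just one fixed coordinate of a forced face unknown. That coordinate
  is old or new, and all new ones are alike. Hence the branching is finite although \<open>n\<close>
  is arbitrary, and no pattern listed has more than nine coordinates.

  A forced step needs an imbalance. Some families of faces are balanced at every set of four
  coordinates without being the whole splitting; nothing is forced then, and a count of the
  remaining faces takes over. All other branches end when every extension is impossible or when
  sixteen faces, one of each opposite pair, are known.

  Recording only a pattern contained in an extension lets one refutation serve many branches. The
  embeddings are stored as certificates, so checking a case is pure evaluation without
  search.\<close>

definition opposite :: "(nat \<Rightarrow> bool option) \<Rightarrow> nat \<Rightarrow> bool option" where
  "opposite a = (\<lambda>i. map_option Not (a i))"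

lemma dom_opposite [simp]: "dom (opposite a) = dom a"
  by (auto simp: opposite_def dom_def)

lemma opposite_opposite [simp]: "opposite (opposite a) = a"
  by (auto simp: opposite_def option.map_comp comp_def option.map_ident)

text \<open>Up to sign and a power of 2, the Walsh coefficient of (the indicator function of) \<open>a\<close> at the
  set \<open>dom t\<close>. The values of \<open>t\<close> only normalise the sign.\<close>

definition weight :: "(nat \<Rightarrow> bool option) \<Rightarrow> (nat \<Rightarrow> bool option) \<Rightarrow> int" where
  "weight t a = (\<Prod>i\<in>dom t. case a i of None \<Rightarrow> 0 | Some v \<Rightarrow> if t i = Some v then 1 else - 1)"

lemma weight_cases: "weight t a = 0 \<or> weight t a = 1 \<or> weight t a = - 1"
proof (cases "finite (dom t)")
  case True
  then show ?thesis
    unfolding weight_def by (induction rule: finite_induct) (auto simp del: prod_zero_iff split: option.splits)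
qed (simp add: weight_def)

lemma weight_eq_0_iff:
  assumes "finite (dom t)"
  shows "weight t a = 0 \<longleftrightarrow> \<not> dom t \<subseteq> dom a"
  using assms by (auto simp: weight_def prod_zero_iff dom_def split: option.splits if_splits)

text \<open>All factors change sign, and an even number of changes cancels. A set of four
  coordinates thus cannot tell a face from its opposite, so a pattern needs only one face of each
  opposite pair.\<close>

lemma weight_opposite:
  assumes "even (card (dom t))"
  shows "weight t (opposite a) = weight t a"
proof -
  have "weight t (opposite a) =
      (\<Prod>i\<in>dom t. - (case a i of None \<Rightarrow> 0 | Some v \<Rightarrow> if t i = Some v then 1 else - 1))"
    unfolding weight_def
    by (intro prod.cong) (auto simp: opposite_def split: option.splits)
  also have "\<dots> = (- 1) ^ card (dom t) * weight t a"
    by (simp add: weight_def prod_uminus)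
  finally show ?thesis using assms by simp
qed

lemma weight_self [simp]: "weight a a = 1"
  by (auto simp: weight_def intro!: prod.neutral split: option.splits)

lemma weight_eq_power:
  assumes "dom t \<subseteq> dom a" "finite (dom t)"
  shows "weight t a = (- 1) ^ card {i \<in> dom t. a i \<noteq> t i}"
proof -
  have "weight t a = (\<Prod>i\<in>dom t. if a i \<noteq> t i then - 1 else 1)"
    unfolding weight_def using assms(1) by (intro prod.cong refl) (auto simp: dom_def)
  also have "\<dots> = (- 1) ^ card {i \<in> dom t. a i \<noteq> t i}"
    using assms(2) by (subst prod.If_cases) (auto simp: Int_def)
  finally show ?thesis .
qed

text \<open>An odd number of differences at four coordinates is one or three. If it is three, the
  opposite face differs only at the fourth. A forced face can therefore always be described by a
  single sign change.\<close>

lemma single_difference: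
  assumes "weight t a = - 1" "card (dom t) = 4"
  obtains b y where "b = a \<or> b = opposite a" "y \<in> dom t" "b y = map_option Not (t y)"
    "\<And>x. x \<in> dom t \<Longrightarrow> x \<noteq> y \<Longrightarrow> b x = t x"
proof -
  define D where "D = {i \<in> dom t. a i \<noteq> t i}"
  have fin: "finite (dom t)" using assms(2) card.infinite by fastforce
  then have sub: "dom t \<subseteq> dom a" using weight_eq_0_iff[of t a] assms(1) by auto
  have D: "D \<subseteq> dom t" "finite D" using fin by (auto simp: D_def)
  have odd: "odd (card D)"
    using weight_eq_power[OF sub fin] assms(1) by (auto simp: D_def minus_one_power_iff split: if_splits)
  have flip: "a x = map_option Not (t x)" if "x \<in> D" for x
    using that sub by (auto simp: D_def dom_def)
  have "card D \<le> 4" using D fin assms(2) card_mono by metis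
  with odd have "card D = 1 \<or> card D = 3" by presburger
  then show ?thesis
  proof
    assume "card D = 1"
    then obtain y where "D = {y}" using card_1_singletonE by blast
    then show ?thesis using that[of a y] flip[of y] by (auto simp: D_def)
  next
    assume "card D = 3"
    then have "card (dom t - D) = 1" using D fin assms(2) by (simp add: card_Diff_subset)
    then obtain y where y: "dom t - D = {y}" using card_1_singletonE by blast
    have "opposite a x = t x" if "x \<in> dom t" "x \<noteq> y" for x
    proof -
      have "x \<in> D" using y that by blast
      then show ?thesis using flip[of x] by (cases "t x") (simp_all add: opposite_def)
    qed
    moreover have "y \<in> dom t" "a y = t y" using y unfolding D_def by blast+
    then have "opposite a y = map_option Not (t y)" "y \<in> dom t"
      by (simp_all add: opposite_def)
    ultimately show ?thesis using that[of "opposite a" y] by blast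
  qed
qed

text \<open>Signs relative to \<open>s\<close> and relative to \<open>t\<close> differ by the
  constant sign \<open>weight s t\<close>, so whether a sum of weights vanishes depends only on the
  domain.\<close>

lemma weight_same_dom:
  assumes "dom s = dom t"
  shows "weight s a = weight s t * weight t a"
  unfolding weight_def assms prod.distrib[symmetric]
proof (intro prod.cong refl)
  fix i assume "i \<in> dom t"
  then obtain u v where "t i = Some u" "s i = Some v" using assms by (metis domD)
  then show "(case a i of None \<Rightarrow> 0 | Some v \<Rightarrow> if s i = Some v then 1 else - 1) =
      (case t i of None \<Rightarrow> 0 | Some v \<Rightarrow> if s i = Some v then 1 else - 1) *
      (case a i of None \<Rightarrow> 0 | Some v \<Rightarrow> if t i = Some v then 1 else (- 1 :: int))"
    by (auto split: option.splits)
qed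

lemma opposite_neq:
  assumes "dom a \<noteq> {}" shows "opposite a \<noteq> a"
proof
  assume "opposite a = a"
  then have "map_option Not (a i) = a i" for i by (simp add: opposite_def fun_eq_iff)
  then have "a i = None" for i by (metis (full_types) option.exhaust option.inject option.map(2))
  then show False using assms by auto
qed

section \<open>Points of a face and sums of signs over them\<close>

lemma face_pts_Map_empty [simp]: "face_pts n Map.empty = cube n"
  by (auto simp: face_pts_def)

text \<open>A point of the face is determined by the set of free coordinates at which it is True;
  \<open>?F\<close> and \<open>?G\<close> below translate between the two.\<close>

lemma
  assumes a: "dom a \<subseteq> {1..n}"
  shows card_face_pts: "card (face_pts n a) = 2 ^ (n - card (dom a))"
    and finite_face_pts: "finite (face_pts n a)"
proof -
  let ?F = "\<lambda>x. {i \<in> {1..n} - dom a. x i}"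
  let ?G = "\<lambda>Y i. case a i of None \<Rightarrow> i \<in> Y | Some v \<Rightarrow> v"
  have bij: "bij_betw ?F (face_pts n a) (Pow ({1..n} - dom a))"
  proof (rule bij_betw_byWitness[where f' = ?G])
    show "\<forall>x\<in>face_pts n a. ?G (?F x) = x"
    proof
      fix x assume x: "x \<in> face_pts n a"
      show "?G (?F x) = x"
      proof
        fix i
        show "?G (?F x) i = x i"
          using x a by (cases "a i"; cases "i \<in> {1..n}") (auto simp: face_pts_def cube_def dom_def)
      qed
    qed
    show "\<forall>Y\<in>Pow ({1..n} - dom a). ?F (?G Y) = Y"
      by (auto simp: dom_def subset_iff split: option.splits)
    show "?F ` face_pts n a \<subseteq> Pow ({1..n} - dom a)" by auto
    show "?G ` Pow ({1..n} - dom a) \<subseteq> face_pts n a"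
      using a by (auto simp: face_pts_def cube_def dom_def split: option.splits)
  qed
  have fin: "finite (dom a)" using a finite_subset by blast
  have "card (face_pts n a) = card (Pow ({1..n} - dom a))" using bij bij_betw_same_card by blast
  also have "\<dots> = 2 ^ (n - card (dom a))"
    using a fin by (simp add: card_Pow card_Diff_subset)
  finally show "card (face_pts n a) = 2 ^ (n - card (dom a))" .
  show "finite (face_pts n a)" using bij bij_betw_finite by fastforce
qed

text \<open>Flipping the free coordinate \<open>j\<close> permutes the points of the face and
  negates their weights. With \<open>Map.empty\<close> for \<open>a\<close> this is the vanishing of
  a nontrivial coefficient of the constant function on the cube.\<close>

lemma sum_weight_face_pts_eq_0:
  assumes "j \<in> dom t" "j \<notin> dom a" "dom t \<subseteq> {1..n}"
  shows "(\<Sum>x\<in>face_pts n a. weight t (Some \<circ> x)) = 0"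
proof -
  let ?h = "\<lambda>x::nat \<Rightarrow> bool. x(j := \<not> x j)"
  have fin: "finite (dom t)" using assms(3) finite_subset by blast
  have inv: "?h (?h x) = x" for x by auto
  have mem: "?h x \<in> face_pts n a" if "x \<in> face_pts n a" for x
    using that assms by (auto simp: face_pts_def cube_def dom_def)
  have bij: "bij_betw ?h (face_pts n a) (face_pts n a)"
    by (rule bij_betw_byWitness[where f' = ?h]) (use mem in auto)
  have flip: "weight t (Some \<circ> ?h x) = - weight t (Some \<circ> x)" for x
  proof -
    have "weight t (Some \<circ> ?h x) = (if t j = Some (\<not> x j) then 1 else - 1) *
        (\<Prod>i\<in>dom t - {j}. if t i = Some (x i) then 1 else - 1)"
      unfolding weight_def using fin assms(1) by (subst prod.remove[of _ j]) (auto intro!: prod.cong)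
    moreover have "weight t (Some \<circ> x) = (if t j = Some (x j) then 1 else - 1) *
        (\<Prod>i\<in>dom t - {j}. if t i = Some (x i) then 1 else - 1)"
      unfolding weight_def using fin assms(1) by (subst prod.remove[of _ j]) (auto intro!: prod.cong)
    ultimately show ?thesis using assms(1) by auto
  qed
  have "(\<Sum>x\<in>face_pts n a. weight t (Some \<circ> x)) = (\<Sum>x\<in>face_pts n a. weight t (Some \<circ> ?h x))"
    using sum.reindex_bij_betw[OF bij, of "\<lambda>x. weight t (Some \<circ> x)"] by simp
  also have "\<dots> = - (\<Sum>x\<in>face_pts n a. weight t (Some \<circ> x))"
    by (simp add: flip sum_negf)
  finally show ?thesis by simp
qed

text \<open>If \<open>a\<close> fixes all coordinates of \<open>t\<close>, the weight is constant on
  the face; otherwise a free coordinate makes the sum cancel.\<close>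

lemma sum_weight_face_pts:
  assumes "dom t \<subseteq> {1..n}" "dom a \<subseteq> {1..n}"
  shows "(\<Sum>x\<in>face_pts n a. weight t (Some \<circ> x)) = 2 ^ (n - card (dom a)) * weight t a"
proof (cases "dom t \<subseteq> dom a")
  case True
  have "weight t (Some \<circ> x) = weight t a" if "x \<in> face_pts n a" for x
    unfolding weight_def using that True assms
    by (intro prod.cong) (auto simp: face_pts_def dom_def subset_iff split: option.splits)
  then show ?thesis by (simp add: card_face_pts[OF assms(2)])
next
  case False
  then obtain j where "j \<in> dom t" "j \<notin> dom a" by blast
  moreover have "weight t a = 0"
    using False assms weight_eq_0_iff finite_subset by blast
  ultimately show ?thesis using sum_weight_face_pts_eq_0 assms by simp
qed

text \<open>A common point could be removed from \<open>X a\<close> without shrinking the union,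
  which would then be smaller than the sum of the sizes.\<close>

lemma disjoint_if_card_UN_eq_sum:
  assumes "finite A" "\<And>a. a \<in> A \<Longrightarrow> finite (X a)" "card (\<Union>a\<in>A. X a) = (\<Sum>a\<in>A. card (X a))"
    and "a \<in> A" "b \<in> A" "a \<noteq> b"
  shows "X a \<inter> X b = {}"
proof (rule ccontr)
  assume "X a \<inter> X b \<noteq> {}"
  then obtain x where x: "x \<in> X a" "x \<in> X b" by blast
  have "(\<Union>a\<in>A. X a) = (\<Union>c\<in>A - {a}. X c) \<union> (X a - {x})"
    using x assms(4-6) by blast
  then have "card (\<Union>a\<in>A. X a) \<le> card (\<Union>c\<in>A - {a}. X c) + card (X a - {x})"
    by (metis card_Un_le)
  also have "\<dots> \<le> (\<Sum>c\<in>A - {a}. card (X c)) + card (X a - {x})"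
    using assms(1) by (intro add_right_mono card_UN_le) auto
  also have "\<dots> < (\<Sum>c\<in>A - {a}. card (X c)) + card (X a)"
    using x assms(2)[OF assms(4)] by (meson add_strict_left_mono card_Diff1_less)
  also have "\<dots> = (\<Sum>a\<in>A. card (X a))"
    using assms(1,4) by (simp add: sum.remove add.commute)
  finally show False using assms(3) by simp
qed

section \<open>Disjointness, vanishing sums and opposite faces in a splitting\<close>

locale splitting =
  fixes n :: nat and A :: "(nat \<Rightarrow> bool option) set"
  assumes splitting: "antipodal_splitting n 5 A"
begin

lemma finite_A [simp]: "finite A" and card_A: "card A = 32"
  using splitting by (auto simp: antipodal_splitting_def)

lemma dom_subset: "a \<in> A \<Longrightarrow> dom a \<subseteq> {1..n}"
  using splitting by (force simp: antipodal_splitting_def is_face_def)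

lemma finite_dom: "a \<in> A \<Longrightarrow> finite (dom a)"
  using dom_subset finite_subset by blast

lemma card_dom: assumes "a \<in> A" shows "card (dom a) = 5"
proof -
  \<comment> \<open>Since \<open>5 < n\<close>, the difference \<open>n - 5\<close> of natural
    numbers is not truncated, and the number of fixed coordinates can be recovered from it.\<close>
  have "5 < n" "card {i\<in>{1..n}. a i = None} = n - 5"
    using splitting assms by (auto simp: antipodal_splitting_def is_face_def)
  moreover have "{i\<in>{1..n}. a i = None} = {1..n} - dom a" by auto
  ultimately show ?thesis
    using card_Diff_subset[OF finite_dom[OF assms] dom_subset[OF assms]]
      card_mono[OF _ dom_subset[OF assms]] by simp
qed

lemma beta_eq_dom: "a \<in> A \<Longrightarrow> beta n a = dom a"
  using dom_subset[of a] by (auto simp: beta_def)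

lemma n_gt: "5 < n"
  using splitting by (auto simp: antipodal_splitting_def)

lemma cube_eq: "cube n = (\<Union>a\<in>A. face_pts n a)"
  using splitting by (auto simp: antipodal_splitting_def)

lemma face_pts_disjoint:
  assumes "a \<in> A" "b \<in> A" "a \<noteq> b"
  shows "face_pts n a \<inter> face_pts n b = {}"
proof (rule disjoint_if_card_UN_eq_sum[OF finite_A _ _ assms])
  show "finite (face_pts n c)" if "c \<in> A" for c
    using that dom_subset finite_face_pts by blast
  have "card (\<Union>a\<in>A. face_pts n a) = 2 ^ n"
    using card_face_pts[of Map.empty n] by (simp add: cube_eq)
  also have "\<dots> = card A * 2 ^ (n - 5)"
    using n_gt power_add[of "2::nat" 5 "n - 5"] by (simp add: card_A)
  also have "\<dots> = (\<Sum>a\<in>A. card (face_pts n a))"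
    using card_face_pts[OF dom_subset] card_dom by simp
  finally show "card (\<Union>a\<in>A. face_pts n a) = (\<Sum>a\<in>A. card (face_pts n a))" .
qed

text \<open>Faces without a conflict share the point that takes its values from \<open>a\<close>,
  then from \<open>b\<close>, and is False elsewhere, whereas distinct faces are disjoint. Used with
  the opposite of a face, this shows that two faces must also agree somewhere.\<close>

lemma eq_if_compatible:
  assumes "a \<in> A" "b \<in> A" and compat: "\<And>i v w. a i = Some v \<Longrightarrow> b i = Some w \<Longrightarrow> v = w"
  shows "a = b"
proof (rule ccontr)
  assume "a \<noteq> b"
  define x where "x i = (case a i of Some v \<Rightarrow> v | None \<Rightarrow> b i = Some True)" for i
  have "x i = False" if "i \<notin> {1..n}" for i
    using that dom_subset[OF assms(1)] dom_subset[OF assms(2)]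
    by (auto simp: x_def dom_def subset_iff split: option.splits)
  then have "x \<in> face_pts n a \<inter> face_pts n b"
    by (auto simp: face_pts_def cube_def x_def split: option.splits dest: compat)
  then show False using face_pts_disjoint[OF assms(1,2) \<open>a \<noteq> b\<close>] by blast
qed

text \<open>The coefficient of the whole cube vanishes and, by disjointness, splits over the faces.
  They all have 2^(n-5) points, and this common factor drops out.\<close>

lemma sum_weight_eq_0:
  assumes "dom t \<subseteq> {1..n}" "dom t \<noteq> {}"
  shows "(\<Sum>a\<in>A. weight t a) = 0"
proof -
  obtain j where j: "j \<in> dom t" using assms by blast
  have "0 = (\<Sum>x\<in>cube n. weight t (Some \<circ> x))"
    using sum_weight_face_pts_eq_0[OF j _ assms(1), of Map.empty] by simp
  also have "\<dots> = (\<Sum>a\<in>A. \<Sum>x\<in>face_pts n a. weight t (Some \<circ> x))"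
    unfolding cube_eq
    using dom_subset finite_face_pts face_pts_disjoint by (intro sum.UNION_disjoint) auto
  also have "\<dots> = (\<Sum>a\<in>A. 2 ^ (n - 5) * weight t a)"
    using sum_weight_face_pts[OF assms(1) dom_subset] card_dom by (intro sum.cong refl) auto
  also have "\<dots> = 2 ^ (n - 5) * (\<Sum>a\<in>A. weight t a)" by (simp add: sum_distrib_left)
  finally show ?thesis by simp
qed

lemma eq_or_opposite:
  assumes "a \<in> A" "b \<in> A" "dom a = dom b"
  shows "b = a \<or> b = opposite a"
proof (cases "b = a")
  case False
  have None_iff: "a i = None \<longleftrightarrow> b i = None" for i
    using assms(3) by (metis domIff)
  then have "direction n a = direction n b"
    by (simp add: direction_def)
  then have "antipodal n a b"
    using splitting assms False by (auto simp: antipodal_splitting_def parallel_def)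
  then have "b i = opposite a i" for i
    using None_iff[of i] dom_subset[OF assms(1)]
    by (cases "a i") (auto simp: antipodal_def opposite_def dom_def)
  then show ?thesis by blast
qed simp

text \<open>In the coefficient at \<open>dom a\<close> only faces that fix the same five coordinates
  contribute, and \<open>a\<close> contributes 1. Some other face has to cancel it, and the
  condition on parallel faces leaves only the opposite.\<close>

lemma opposite_mem:
  assumes "a \<in> A" shows "opposite a \<in> A"
proof -
  have "(\<Sum>b\<in>A. weight a b) = 0"
    using dom_subset[OF assms] card_dom[OF assms] by (intro sum_weight_eq_0) auto
  then have "(\<Sum>b\<in>A - {a}. weight a b) = - 1"
    using assms by (simp add: sum.remove)
  then obtain b where b: "b \<in> A - {a}" "weight a b \<noteq> 0"
    by (metis sum.neutral zero_neq_neg_one)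
  then have "dom a = dom b"
    using weight_eq_0_iff[OF finite_dom[OF assms], of b] assms
    by (metis DiffD1 card_dom card_subset_eq finite_dom)
  then show ?thesis using b assms eq_or_opposite by blast
qed

lemma opposite_mem_iff [simp]: "opposite a \<in> A \<longleftrightarrow> a \<in> A"
  using opposite_mem[of a] opposite_mem[of "opposite a"] by auto

end

section \<open>Patterns\<close>

datatype sign = Free | Pos | Neg

fun opp :: "sign \<Rightarrow> sign" where
  "opp Free = Free"
| "opp Pos = Neg"
| "opp Neg = Pos"

lemma opp_opp [simp]: "opp (opp s) = s"
  by (cases s) auto

lemma opp_eq_Free_iff [simp]: "opp s = Free \<longleftrightarrow> s = Free"
  by (cases s) auto

fun val :: "sign \<Rightarrow> bool \<Rightarrow> bool option" where
  "val Free b = None"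
| "val Pos b = Some b"
| "val Neg b = Some (\<not> b)"

lemma val_eq_None_iff [simp]: "val s b = None \<longleftrightarrow> s = Free"
  by (cases s) auto

lemma val_eq_iff [simp]: "val s b = val s' b \<longleftrightarrow> s = s'"
  by (cases s; cases s') auto

lemma val_opp: "val (opp s) b = map_option Not (val s b)"
  by (cases s) auto

lemma val_opp_not: "val (opp s) (\<not> b) = val s b"
  by (cases s) auto

definition supp :: "sign list \<Rightarrow> nat set" where
  "supp c = {i. i < length c \<and> c ! i \<noteq> Free}"

definition degree :: "sign list \<Rightarrow> nat" where
  "degree c = length (filter (\<lambda>s. s \<noteq> Free) c)"

lemma finite_supp [simp]: "finite (supp c)"
  by (simp add: supp_def)

lemma supp_subset: "supp c \<subseteq> {..<length c}"
  by (auto simp: supp_def)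

lemma card_supp: "card (supp c) = degree c"
  by (simp add: supp_def degree_def length_filter_conv_card)

text \<open>A sign list is a face whose coordinates are still anonymous: position \<open>i\<close> stands for the
  coordinate \<open>f i\<close>, and \<open>g i\<close> is the value that \<^const>\<open>Pos\<close> has there.\<close>

definition inst :: "(nat \<Rightarrow> nat) \<Rightarrow> (nat \<Rightarrow> bool) \<Rightarrow> sign list \<Rightarrow> nat \<Rightarrow> bool option" where
  "inst f g c x =
    (if x \<in> f ` {..<length c}
     then let i = inv_into {..<length c} f x in val (c ! i) (g i)
     else None)"

lemma inst_at:
  "inj_on f {..<length c} \<Longrightarrow> i < length c \<Longrightarrow> inst f g c (f i) = val (c ! i) (g i)"
  by (simp add: inst_def Let_def)

lemma inst_outside: "x \<notin> f ` {..<length c} \<Longrightarrow> inst f g c x = None"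
  by (simp add: inst_def)

lemma inst_eqI:
  assumes "inj_on f {..<length c}" "\<And>i. i < length c \<Longrightarrow> a (f i) = val (c ! i) (g i)"
    and "dom a \<subseteq> f ` {..<length c}"
  shows "a = inst f g c"
proof
  fix x
  show "a x = inst f g c x"
  proof (cases "x \<in> f ` {..<length c}")
    case True
    then show ?thesis using assms(1,2) by (auto simp: inst_at)
  next
    case False
    then show ?thesis using assms(3) by (auto simp: inst_outside)
  qed
qed

lemma dom_inst: "inj_on f {..<length c} \<Longrightarrow> dom (inst f g c) = f ` supp c"
proof -
  assume f: "inj_on f {..<length c}"
  have "inst f g c x \<noteq> None \<longleftrightarrow> x \<in> f ` supp c" for x
  proof (cases "x \<in> f ` {..<length c}")
    case True
    then obtain i where "i < length c" "x = f i" by auto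
    then show ?thesis
      using f supp_subset[of c] by (auto simp: inst_at supp_def inj_on_def)
  next
    case False
    then show ?thesis using supp_subset[of c] by (auto simp: inst_outside)
  qed
  then show ?thesis by (auto simp: dom_def)
qed

lemma card_dom_inst: "inj_on f {..<length c} \<Longrightarrow> card (dom (inst f g c)) = degree c"
  by (metis card_image card_supp dom_inst inj_on_subset supp_subset)

lemma inst_inject:
  assumes "inj_on f {..<length c}" "length d = length c" "inst f g c = inst f g d"
  shows "c = d"
proof (rule nth_equalityI)
  show "c ! i = d ! i" if "i < length c" for i
    using inst_at[of f c i g] inst_at[of f d i g] that assms by simp
qed (use assms in simp)

lemma inst_opp:
  assumes "inj_on f {..<length c}"
  shows "inst f g (map opp c) = opposite (inst f g c)"
proof (rule sym, rule inst_eqI)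
  show "dom (opposite (inst f g c)) \<subseteq> f ` {..<length (map opp c)}"
    using supp_subset[of c] by (simp add: dom_inst[OF assms] image_mono)
qed (use assms in \<open>auto simp: inst_at val_opp opposite_def\<close>)

text \<open>Position \<open>m\<close> lies beyond the clause. Together with
  \<open>inst_append_Free\<close> this allows one more coordinate to be introduced without
  disturbing the faces already known.\<close>

lemma inst_fun_upd:
  assumes "inj_on f {..<length c}" "length c \<le> m"
  shows "inst (f(m := v)) (g(m := b)) c = inst f g c"
proof (rule sym, rule inst_eqI)
  show "dom (inst f g c) \<subseteq> f(m := v) ` {..<length c}"
    using assms supp_subset[of c] by (auto simp: dom_inst[OF assms(1)] image_iff)
  show "inj_on (f(m := v)) {..<length c}"
    using assms by (auto simp: inj_on_def)
qed (use assms in \<open>auto simp: inst_at\<close>)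

lemma inst_append_Free:
  assumes "inj_on f {..<Suc (length c)}"
  shows "inst f g (c @ [Free]) = inst f g c"
proof (rule sym, rule inst_eqI)
  have inj: "inj_on f {..<length c}" using assms by (rule inj_on_subset) auto
  show "dom (inst f g c) \<subseteq> f ` {..<length (c @ [Free])}"
    using supp_subset[of c] by (auto simp: dom_inst[OF inj])
  show "inst f g c (f i) = val ((c @ [Free]) ! i) (g i)" if "i < length (c @ [Free])" for i
  proof (cases "i < length c")
    case True
    then show ?thesis using inj by (simp add: inst_at nth_append)
  next
    case False
    then have "f i \<notin> f ` {..<length c}"
      using that inj_on_image_mem_iff[OF assms, of i "{..<length c}"] by auto
    then show ?thesis using False that by (simp add: inst_outside nth_append)
  qed
qed (use assms in simp)

lemma degree_opp [simp]: "degree (map opp c) = degree c"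
  by (simp add: degree_def filter_map comp_def)

lemma supp_opp [simp]: "supp (map opp c) = supp c"
  by (auto simp: supp_def)

lemma opp_comp_opp [simp]: "opp \<circ> opp = id"
  by auto

lemma supp_list_update_Free: "supp (c[i := Free]) = supp c - {i}"
  by (cases "i < length c") (auto simp: supp_def nth_list_update split: if_splits)

section \<open>Executable weights, candidates, clashes and embeddings\<close>

definition clause_weight :: "sign list \<Rightarrow> sign list \<Rightarrow> int" where
  "clause_weight t c = prod_list (map2 (\<lambda>x y.
     if x = Free then 1 else if y = Free then 0 else if x = y then 1 else - 1) t c)"

text \<open>Both signs at a position refer to the same value of \<open>g\<close>, which cancels.
  Positions where \<open>t\<close> is \<open>Free\<close> give the factor 1, so the product may run
  over all positions.\<close>

lemma weight_inst:
  assumes "inj_on f {..<length t}" "length c = length t"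
  shows "weight (inst f g t) (inst f g c) = clause_weight t c"
proof -
  let ?w = "\<lambda>i. if t ! i = Free then 1 else if c ! i = Free then 0 else if t ! i = c ! i then 1 else (- 1 :: int)"
  have inj: "inj_on f (supp t)" using assms(1) supp_subset inj_on_subset by blast
  have inst: "inst f g c (f i) = val (c ! i) (g i)" "inst f g t (f i) = val (t ! i) (g i)" if "i \<in> supp t" for i
    using that assms by (auto simp: supp_def inst_at)
  have "(case val y b of None \<Rightarrow> 0 | Some v \<Rightarrow> if val x b = Some v then 1 else - 1) =
      (if x = Free then 1 else if y = Free then 0 else if x = y then 1 else (- 1 :: int))"
    if "x \<noteq> Free" for x y b
    using that by (cases x; cases y) auto
  then have "weight (inst f g t) (inst f g c) = (\<Prod>i\<in>supp t. ?w i)"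
    unfolding weight_def dom_inst[OF assms(1)] prod.reindex[OF inj] comp_def
    by (intro prod.cong refl) (simp only: inst, simp add: supp_def)
  also have "\<dots> = (\<Prod>i<length t. ?w i)"
    by (rule prod.mono_neutral_left) (auto simp: supp_def)
  also have "\<dots> = clause_weight t c"
    using assms(2) by (simp add: clause_weight_def prod.list_conv_set_nth atLeast0LessThan)
  finally show ?thesis .
qed

text \<open>Single sign changes suffice: three changes at four positions amount to one change for
  the opposite face.\<close>

fun flips :: "sign list \<Rightarrow> sign list list" where
  "flips [] = []"
| "flips (x # xs) = (if x = Free then [] else [opp x # xs]) @ map ((#) x) (flips xs)"

text \<open>The last position stands for a coordinate that no clause uses so far. Its two signs are
  interchangeable, so only one of them is listed.\<close>

fun fills :: "sign list \<Rightarrow> sign list list" where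
  "fills [] = [[Pos]]"
| "fills (x # xs) =
    (if x = Free then [Pos # xs @ [Free], Neg # xs @ [Free]] else []) @ map ((#) x) (fills xs)"

definition candidates :: "sign list \<Rightarrow> sign list list" where
  "candidates t = concat (map fills (flips t))"

lemma mem_flips: "i < length t \<Longrightarrow> t ! i \<noteq> Free \<Longrightarrow> t[i := opp (t ! i)] \<in> set (flips t)"
proof (induction t arbitrary: i)
  case (Cons x xs)
  then show ?case by (cases i) auto
qed simp

lemma mem_fills: "i < length t \<Longrightarrow> t ! i = Free \<Longrightarrow> s \<noteq> Free \<Longrightarrow> t[i := s] @ [Free] \<in> set (fills t)"
proof (induction t arbitrary: i)
  case (Cons x xs)
  then show ?case by (cases i; cases s) auto
qed simp

lemma mem_fills_new: "t @ [Pos] \<in> set (fills t)"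
  by (induction t) auto

text \<open>The disjuncts say that the clauses agree nowhere, conflict nowhere, or have equal
  supports. In a splitting each of them makes two faces equal or opposite, so a new face may not
  clash with a known one.\<close>

definition clash :: "sign list \<Rightarrow> sign list \<Rightarrow> bool" where
  "clash c d \<longleftrightarrow>
     \<not> list_ex (\<lambda>(x, y). x \<noteq> Free \<and> y = x) (zip c d) \<or>
     \<not> list_ex (\<lambda>(x, y). x \<noteq> Free \<and> y = opp x) (zip c d) \<or>
     list_all2 (\<lambda>x y. x = Free \<longleftrightarrow> y = Free) c d"

text \<open>The Boolean marks a coordinate that is switched, which exchanges \<open>Pos\<close> and
  \<open>Neg\<close> there.\<close>

fun lookup :: "sign list \<Rightarrow> nat \<times> bool \<Rightarrow> sign" where
  "lookup c (i, b) = (if b then opp (c ! i) else c ! i)"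

text \<open>Opposites are included in the distinctness condition so that a pattern accounts for
  exactly twice as many faces as it has clauses.\<close>

definition clauses_ok :: "nat \<Rightarrow> sign list list \<Rightarrow> bool" where
  "clauses_ok m P \<longleftrightarrow> list_all (\<lambda>c. length c = m \<and> degree c = 5) P \<and> distinct (P @ map (map opp) P)"

text \<open>The map \<open>p\<close> goes from positions of \<open>P\<close> to signed positions of
  \<open>Q\<close>, and clauses of \<open>Q\<close> are read through it. Positions of
  \<open>Q\<close> outside its range are dropped. No fixed position gets lost in this way if the
  clause read off has degree five like the original one.\<close>

definition embeds :: "nat \<Rightarrow> sign list list \<Rightarrow> (nat \<times> bool) list \<Rightarrow> sign list list \<Rightarrow> bool" where
  "embeds m Q p P \<longleftrightarrow> distinct (map fst p) \<and> list_all (\<lambda>(i, b). i < m) p \<and>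
     list_all (\<lambda>c. list_ex (\<lambda>q. let c' = map (lookup q) p in c' = c \<or> c' = map opp c) Q) P"

text \<open>Here \<open>t\<close> selects four coordinates at which the clauses of \<open>P\<close> are not balanced, so that a further
  clause is forced. \<open>H\<close> lists, for each candidate that is compatible with \<open>P\<close>, a pattern contained
  in the extension by this candidate, and its embedding.\<close>

definition step_ok ::
  "sign list list \<Rightarrow> sign list \<Rightarrow> (sign list list \<times> (nat \<times> bool) list) list \<Rightarrow> bool" where
  "step_ok P t H \<longleftrightarrow> clauses_ok (length t) P \<and> degree t = 4 \<and>
     0 < sum_list (map (clause_weight t) P) \<and>
     (let P' = map (\<lambda>c. c @ [Free]) P in
      list_all2 (\<lambda>c (G, p). embeds (Suc (length t)) (c # P') p G)
        (filter (\<lambda>c. \<not> list_ex (clash c) P') (candidates t)) H)"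

text \<open>Only sets of four positions inside the support of some clause are tested; at all others
  every weight is 0.\<close>

definition balanced :: "nat \<Rightarrow> sign list list \<Rightarrow> bool" where
  "balanced m P \<longleftrightarrow> clauses_ok m P \<and> 
     list_all (\<lambda>c. list_all (\<lambda>i. c ! i = Free \<or> sum_list (map (clause_weight (c[i := Free])) P) = 0) [0..<m]) P"

lemma length_candidates: "c \<in> set (candidates t) \<Longrightarrow> length c = Suc (length t)"
proof -
  have "length c = Suc (length t)" if "c \<in> set (fills t)" for c t
    using that by (induction t arbitrary: c) (auto split: if_splits)
  moreover have "length c = length t" if "c \<in> set (flips t)" for c
    using that by (induction t arbitrary: c) (auto split: if_splits)
  ultimately show "c \<in> set (candidates t) \<Longrightarrow> length c = Suc (length t)"
    by (auto simp: candidates_def)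
qed

lemma list_all2_memD:
  assumes "list_all2 R xs ys" "x \<in> set xs" shows "\<exists>y\<in>set ys. R x y"
  using assms by (induction rule: list_all2_induct) auto

lemma clause_weight_opp:
  assumes "length c = length t" "even (degree t)"
  shows "clause_weight t (map opp c) = clause_weight t c"
  \<comment> \<open>The identity instance carries the fact over from faces to clauses.\<close>
  using weight_opposite[of "inst id (\<lambda>_. True) t" "inst id (\<lambda>_. True) c"] assms
  by (simp add: weight_inst card_dom_inst flip: inst_opp)

section \<open>Settling patterns\<close>

context splitting
begin

section \<open>Occurrences of patterns and their transport along embeddings\<close>

definition conclusion :: bool where
  "conclusion \<longleftrightarrow> equivalent {1..8} E_coll {1..n} (beta n ` A) \<or>
                  equivalent {1..8} F_coll {1..n} (beta n ` A)"

definition occurs :: "nat \<Rightarrow> (nat \<Rightarrow> nat) \<Rightarrow> (nat \<Rightarrow> bool) \<Rightarrow> sign list list \<Rightarrow> bool" where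
  "occurs m f g P \<longleftrightarrow> inj_on f {..<m} \<and> (\<forall>c\<in>set P. length c = m \<and> degree c = 5 \<and> inst f g c \<in> A)"

text \<open>Failure and success are treated alike: a pattern that cannot occur is settled vacuously.
  The condition on the degree is carried along because transport along an embedding relies on
  it.\<close>

definition settled :: "sign list list \<Rightarrow> bool" where
  "settled P \<longleftrightarrow> (\<forall>c\<in>set P. degree c = 5) \<and> (\<forall>m f g. occurs m f g P \<longrightarrow> conclusion)"

text \<open>Composing the coordinates with \<open>p\<close>, and switching values where
  \<open>p\<close> says so, turns the occurrence of \<open>Q\<close> into an occurrence of
  \<open>G\<close>; a clause that is matched only up to \<open>opp\<close> is recovered from closure
  under opposites.\<close>

lemma conclusion_if_embeds:
  assumes emb: "embeds m Q p G" and "settled G" and f: "inj_on f {..<m}"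
    and Q: "\<And>q. q \<in> set Q \<Longrightarrow> length q = m \<and> inst f g q \<in> A"
  shows conclusion
proof -
  define f' where "f' i = f (fst (p ! i))" for i
  \<comment> \<open>A switched reference value compensates the \<open>opp\<close> introduced by
    \<open>lookup\<close>.\<close>
  define g' where "g' i = (g (fst (p ! i)) \<noteq> snd (p ! i))" for i
  have p: "fst (p ! i) < m" if "i < length p" for i
    using emb that by (auto simp: embeds_def list_all_length case_prod_beta)
  have inj: "inj_on f' {..<length p}"
  proof (rule inj_onI)
    fix i j assume ij: "i \<in> {..<length p}" "j \<in> {..<length p}" "f' i = f' j"
    then have "fst (p ! i) = fst (p ! j)"
      using f p by (auto simp: f'_def inj_on_def)
    then show "i = j"
      using ij emb nth_eq_iff_index_eq[of "map fst p" i j] by (auto simp: embeds_def)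
  qed
  have pull: "inst f' g' (map (lookup q) p) = inst f g q"
    if q: "q \<in> set Q" "degree (map (lookup q) p) = 5" for q
  proof -
    let ?c = "map (lookup q) p"
    have "inst f' g' ?c (f' i) = inst f g q (f' i)" if "i < length p" for i
    proof -
      obtain j b where jb: "p ! i = (j, b)" by fastforce
      have "inst f' g' ?c (f' i) = val (lookup q (p ! i)) (g' i)"
        using inj that by (simp add: inst_at)
      also have "\<dots> = val (q ! j) (g j)"
        by (cases b) (auto simp: jb g'_def val_opp_not)
      also have "\<dots> = inst f g q (f j)"
        using f Q[OF q(1)] p[OF that] by (simp add: inst_at jb)
      finally show ?thesis by (simp add: f'_def jb)
    qed
    \<comment> \<open>This compares the faces only on the range of \<open>f'\<close>. Both fix
      exactly five coordinates, so no fixed coordinate lies outside that range.\<close>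
    then have le: "inst f' g' ?c \<subseteq>\<^sub>m inst f g q"
      using supp_subset[of ?c] inj by (auto simp: map_le_def dom_inst)
    moreover have "card (dom (inst f' g' ?c)) = card (dom (inst f g q))"
      using inj q Q card_dom by (simp add: card_dom_inst)
    ultimately have "dom (inst f' g' ?c) = dom (inst f g q)"
      using Q[OF q(1)] finite_dom by (intro card_subset_eq map_le_implies_dom_le) auto
    then show ?thesis using le map_le_antisym by (metis map_le_def)
  qed
  have "length c = length p \<and> degree c = 5 \<and> inst f' g' c \<in> A" if c: "c \<in> set G" for c
  proof -
    obtain q where q: "q \<in> set Q" "map (lookup q) p = c \<or> map (lookup q) p = map opp c"
      using emb c by (auto simp: embeds_def list_all_iff list_ex_iff Let_def)
    have deg: "degree c = 5" using \<open>settled G\<close> c by (simp add: settled_def)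
    from q(2) show ?thesis
    proof
      assume "map (lookup q) p = c"
      then show ?thesis using pull[OF q(1)] Q[OF q(1)] deg by auto
    next
      assume eq: "map (lookup q) p = map opp c"
      then have len: "length c = length p" by (metis length_map)
      have "inst f' g' (map opp c) = inst f g q" using pull[OF q(1)] deg eq by simp
      then have "opposite (inst f' g' c) = inst f g q" using len inj by (simp add: inst_opp)
      then have "inst f' g' c \<in> A" using Q[OF q(1)] opposite_mem_iff by metis
      then show ?thesis using deg len by simp
    qed
  qed
  then have "occurs (length p) f' g' G" using inj by (simp add: occurs_def)
  then show ?thesis using \<open>settled G\<close> by (auto simp: settled_def)
qed

text \<open>Clauses that agree nowhere become compatible when one is replaced by its opposite. Those
  that conflict nowhere are compatible themselves, and equal supports are the case of parallel
  faces.\<close>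

lemma eq_or_opposite_if_clash:
  assumes "clash c d" "inj_on f {..<length c}" "length d = length c"
    and A: "inst f g c \<in> A" "inst f g d \<in> A"
  shows "inst f g c = inst f g d \<or> inst f g c = opposite (inst f g d)"
proof -
  have at: "inst f g c (f i) = val (c ! i) (g i)" "inst f g d (f i) = val (d ! i) (g i)"
    if "i < length c" for i
    using that assms by (auto simp: inst_at)
  have dom: "\<exists>i<length c. x = f i" if "inst f g c x \<noteq> None" for x
    using that by (auto simp: inst_def split: if_splits)
  consider "\<And>i. i < length c \<Longrightarrow> c ! i \<noteq> Free \<Longrightarrow> d ! i \<noteq> c ! i"
    | "\<And>i. i < length c \<Longrightarrow> c ! i \<noteq> Free \<Longrightarrow> d ! i \<noteq> opp (c ! i)"
    | "\<And>i. i < length c \<Longrightarrow> c ! i = Free \<longleftrightarrow> d ! i = Free"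
    using assms(1,3) unfolding clash_def list_ex_length list_all2_conv_all_nth by fastforce
  then show ?thesis
  proof cases
    case 1
    have "inst f g c = opposite (inst f g d)"
    proof (rule eq_if_compatible)
      show "opposite (inst f g d) \<in> A" using A by simp
      fix x v w assume x: "inst f g c x = Some v" "opposite (inst f g d) x = Some w"
      then obtain i where i: "i < length c" "x = f i" using dom by force
      show "v = w"
        using x i 1[of i] at[of i] by (cases "c ! i"; cases "d ! i") (auto simp: opposite_def)
    qed (use A in simp)
    then show ?thesis by simp
  next
    case 2
    have "inst f g c = inst f g d"
    proof (rule eq_if_compatible)
      fix x v w assume x: "inst f g c x = Some v" "inst f g d x = Some w"
      then obtain i where i: "i < length c" "x = f i" using dom by force
      show "v = w"
        using x i 2[of i] at[of i] by (cases "c ! i"; cases "d ! i") auto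
    qed (use A in simp_all)
    then show ?thesis by simp
  next
    case 3
    then have "supp c = supp d" using assms(3) by (auto simp: supp_def)
    then have "dom (inst f g d) = dom (inst f g c)" using assms by (simp add: dom_inst)
    then show ?thesis using eq_or_opposite A by blast
  qed
qed

section \<open>Faces accounted for by a pattern, and the weight of the others\<close>

definition covered :: "(nat \<Rightarrow> nat) \<Rightarrow> (nat \<Rightarrow> bool) \<Rightarrow> sign list list \<Rightarrow> (nat \<Rightarrow> bool option) set" where
  "covered f g P = inst f g ` set (P @ map (map opp) P)"

lemma covered_subset:
  assumes "occurs m f g P" shows "covered f g P \<subseteq> A"
  using assms by (auto simp: occurs_def covered_def inst_opp)

lemma opposite_covered:
  assumes "occurs m f g P" "a \<in> covered f g P"
  shows "opposite a \<in> covered f g P"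
proof -
  from assms(2) obtain c where c: "c \<in> set (P @ map (map opp) P)" "a = inst f g c"
    by (auto simp: covered_def)
  then have "length c = m" using assms(1) by (auto simp: occurs_def)
  then have "opposite a = inst f g (map opp c)"
    using c assms(1) by (simp add: inst_opp occurs_def)
  moreover have "map opp c \<in> set (P @ map (map opp) P)" using c by auto
  ultimately show ?thesis by (auto simp: covered_def)
qed

lemma inj_on_inst:
  assumes "occurs m f g P"
  shows "inj_on (inst f g) (set (P @ map (map opp) P))"
proof (rule inj_onI)
  fix c d assume "c \<in> set (P @ map (map opp) P)" "d \<in> set (P @ map (map opp) P)"
    "inst f g c = inst f g d"
  moreover from this have "length c = m" "length d = m"
    using assms by (auto simp: occurs_def)
  ultimately show "c = d" using assms inst_inject by (auto simp: occurs_def)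
qed

lemma card_covered:
  assumes "occurs m f g P" "clauses_ok m P"
  shows "card (covered f g P) = 2 * length P"
proof -
  have "card (covered f g P) = card (set (P @ map (map opp) P))"
    unfolding covered_def by (rule card_image[OF inj_on_inst[OF assms(1)]])
  also have "\<dots> = 2 * length P"
    using assms(2) by (subst distinct_card) (auto simp: clauses_ok_def)
  finally show ?thesis .
qed

text \<open>The factor 2 counts the opposites, which have the same weights because
  \<open>degree t\<close> is even.\<close>

lemma sum_weight_covered:
  assumes occ: "occurs m f g P" and ok: "clauses_ok m P" and t: "length t = m" "even (degree t)"
  shows "(\<Sum>a\<in>covered f g P. weight (inst f g t) a) = 2 * sum_list (map (clause_weight t) P)"
proof -
  have "(\<Sum>a\<in>covered f g P. weight (inst f g t) a) =
      (\<Sum>c\<in>set (P @ map (map opp) P). weight (inst f g t) (inst f g c))"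
    unfolding covered_def by (simp only: sum.reindex[OF inj_on_inst[OF occ]] comp_def)
  also have "\<dots> = (\<Sum>c\<in>set (P @ map (map opp) P). clause_weight t c)"
    using occ t by (intro sum.cong refl weight_inst) (auto simp: occurs_def)
  also have "\<dots> = sum_list (map (clause_weight t) (P @ map (map opp) P))"
    using ok by (intro sum_list_distinct_conv_sum_set[symmetric]) (simp add: clauses_ok_def)
  also have "\<dots> = sum_list (map (clause_weight t) P) + sum_list (map (\<lambda>c. clause_weight t (map opp c)) P)"
    by (simp add: comp_def)
  also have "map (\<lambda>c. clause_weight t (map opp c)) P = map (clause_weight t) P"
    using occ t by (intro map_cong refl clause_weight_opp) (auto simp: occurs_def)
  finally show ?thesis by simp
qed

text \<open>The sum over the whole splitting vanishes, so the uncovered faces compensate the covered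
  ones.\<close>

lemma sum_weight_rest:
  assumes occ: "occurs m f g P" and ok: "clauses_ok m P" and t: "length t = m" "even (degree t)"
    and "dom (inst f g t) \<subseteq> {1..n}" "degree t \<noteq> 0"
  shows "(\<Sum>a\<in>A - covered f g P. weight (inst f g t) a) = - 2 * sum_list (map (clause_weight t) P)"
proof -
  have "dom (inst f g t) \<noteq> {}"
    using card_dom_inst[of f t g] occ t assms(6) by (auto simp: occurs_def)
  then have "(\<Sum>a\<in>A. weight (inst f g t) a) = 0" using assms(5) sum_weight_eq_0 by blast
  then show ?thesis
    using sum_weight_covered[OF occ ok t] sum.subset_diff[OF covered_subset[OF occ] finite_A, of "weight (inst f g t)"]
    by simp
qed

text \<open>The covered faces have positive total weight at \<open>t\<close>, so some uncovered face
  has weight -1 there. Up to its opposite it is an instance of a candidate, and it clashes with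
  nothing known; hence the extension by it contains one of the settled patterns in
  \<open>H\<close>.\<close>

lemma settled_step:
  assumes ok: "step_ok P t H" and H: "list_all (\<lambda>(G, p). settled G) H"
  shows "settled P"
proof -
  define m where "m = length t"
  have cok: "clauses_ok m P" and deg: "degree t = 4" and pos: "0 < sum_list (map (clause_weight t) P)"
    using ok by (auto simp: step_ok_def m_def)
  have conclusion if "occurs m' f g P" for m' f g
  proof -
    have "P \<noteq> []" using pos by auto
    then have [simp]: "m' = m" using that cok by (cases P) (auto simp: occurs_def clauses_ok_def)
    have occ: "occurs m f g P" using that by simp
    then have f: "inj_on f {..<m}" by (simp add: occurs_def)
    define B where "B = covered f g P"
    define \<tau> where "\<tau> = inst f g t"
    have dom\<tau>: "dom \<tau> = f ` supp t"
      using f by (simp add: \<tau>_def m_def dom_inst)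
    have card\<tau>: "card (dom \<tau>) = 4"
      using f deg by (simp add: \<tau>_def m_def card_dom_inst)
    then have fin: "finite (dom \<tau>)" using card.infinite by fastforce
    have "\<exists>c\<in>set P. clause_weight t c \<noteq> 0"
      using pos by (metis map_eq_conv map_replicate_const not_less_iff_gr_or_eq sum_list_0)
    then obtain c where c: "c \<in> set P" "clause_weight t c \<noteq> 0" by blast
    then have inA: "inst f g c \<in> A" and "weight \<tau> (inst f g c) \<noteq> 0"
      using occ by (auto simp: \<tau>_def m_def occurs_def weight_inst)
    then have "dom \<tau> \<subseteq> {1..n}"
      using weight_eq_0_iff[OF fin] dom_subset[OF inA] by blast
    then have "(\<Sum>a\<in>A - B. weight \<tau> a) < 0"
      using sum_weight_rest[OF occ cok, of t] deg pos by (simp add: \<tau>_def m_def B_def)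
    then obtain a0 where a0: "a0 \<in> A - B" "weight \<tau> a0 < 0"
      by (meson not_le sum_nonneg)
    then have "weight \<tau> a0 = - 1" using weight_cases[of \<tau> a0] by auto
    then obtain a y where a: "a = a0 \<or> a = opposite a0" and y: "y \<in> dom \<tau>" "a y = map_option Not (\<tau> y)"
      and rest: "\<And>x. x \<in> dom \<tau> \<Longrightarrow> x \<noteq> y \<Longrightarrow> a x = \<tau> x"
      by (rule single_difference[OF _ card\<tau>]) blast
    have aA: "a \<in> A" using a a0 by auto
    have aB: "a \<notin> B" using a a0 opposite_covered[OF occ, of "opposite a0"] by (auto simp: B_def)
    obtain i where i: "i < m" "t ! i \<noteq> Free" "y = f i" using y dom\<tau> by (auto simp: supp_def m_def)
    define t' where "t' = t[i := opp (t ! i)]"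
    have t': "length t' = m" "t' \<in> set (flips t)" "supp t' = supp t"
      using i mem_flips[of i t] by (auto simp: t'_def m_def supp_def nth_list_update)
    have at': "a (f k) = val (t' ! k) (g k)" if "k \<in> supp t" for k
    proof (cases "k = i")
      case True
      then show ?thesis using y i f by (simp add: t'_def m_def \<tau>_def inst_at val_opp)
    next
      case False
      then have "f k \<noteq> y" using that i f by (auto simp: inj_on_def supp_def m_def)
      then show ?thesis using rest[of "f k"] that False dom\<tau> f
        by (simp add: t'_def \<tau>_def inst_at supp_def m_def)
    qed
    have "dom \<tau> \<subseteq> dom a"
    proof
      fix x assume "x \<in> dom \<tau>"
      then show "x \<in> dom a" using y rest[of x] by (cases "x = y") auto
    qed
    moreover from this have "card (dom a - dom \<tau>) = 1"
      using card_dom[OF aA] card\<tau> fin by (simp add: card_Diff_subset)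
    ultimately obtain v where v: "dom a = insert v (dom \<tau>)" "v \<notin> dom \<tau>"
      by (metis Diff_partition card_1_singletonE DiffD2 Un_insert_right singletonI sup_bot_right)
    \<comment> \<open>\<open>v\<close> is the fifth fixed coordinate of \<open>a\<close>. If it is
      new, it takes the appended position; if not, an arbitrary fresh number serves as a placeholder
      there.\<close>
    obtain w where w: "w \<notin> f ` {..<m}" "v \<notin> f ` {..<m} \<Longrightarrow> w = v"
      using ex_new_if_finite[OF infinite_UNIV_nat, of "f ` {..<m}"] by (cases "v \<in> f ` {..<m}") auto
    define f' where "f' = f(m := w)"
    \<comment> \<open>With this reference value a new coordinate always reads \<open>Pos\<close>.
      For a mere placeholder the value is irrelevant, because all clauses are \<open>Free\<close>
      there.\<close>
    define g' where "g' = g(m := (a w = Some True))"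
    have f': "inj_on f' {..<Suc m}"
      using f w by (auto simp: f'_def inj_on_def less_Suc_eq)
    have pad: "inst f' g' (d @ [Free]) = inst f g d" if "length d = m" for d
      using that f f' by (simp add: inst_append_Free f'_def g'_def inst_fun_upd)
    have "\<exists>c\<in>set (candidates t). a = inst f' g' c"
    proof (cases "v \<in> f ` {..<m}")
      case True
      then obtain j where j: "j < m" "v = f j" by auto
      then have j': "j \<notin> supp t" using v dom\<tau> by auto
      then have free: "t' ! j = Free" using j t' by (auto simp: supp_def m_def)
      define s where "s = (if a v = Some (g j) then Pos else Neg)"
      have "v \<in> dom a" using v(1) by simp
      then have s: "a v = val s (g j)" "s \<noteq> Free"
        by (auto simp: s_def)
      have "a = inst f g (t'[j := s])"
      proof (rule inst_eqI)
        show "a (f k) = val (t'[j := s] ! k) (g k)" if "k < length (t'[j := s])" for k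
        proof (cases "k = j \<or> k \<in> supp t")
          case True
          then show ?thesis using that at'[of k] s j j' by (cases "k = j") auto
        next
          case False
          then have "f k \<notin> f ` insert j (supp t)"
            using j that t'(1) inj_on_image_mem_iff[OF f, of k "insert j (supp t)"] supp_subset[of t]
            by (auto simp: m_def)
          then have "f k \<notin> dom a"
            using v(1) j dom\<tau> by simp
          moreover have "t' ! k = Free" using False that t' by (auto simp: supp_def m_def)
          ultimately show ?thesis using False by (auto simp: dom_def)
        qed
        show "dom a \<subseteq> f ` {..<length (t'[j := s])}"
          using v j t' dom\<tau> supp_subset[of t] by (auto simp: m_def)
      qed (use f t' in simp)
      then have "a = inst f' g' (t'[j := s] @ [Free])" using pad t' by simp
      moreover have "t'[j := s] @ [Free] \<in> set (candidates t)"
        using t' mem_fills[of j t' s] j free s by (auto simp: candidates_def)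
      ultimately show ?thesis by blast
    next
      case False
      then have [simp]: "w = v" using w by simp
      have "a = inst f' g' (t' @ [Pos])"
      proof (rule inst_eqI)
        show "a (f' k) = val ((t' @ [Pos]) ! k) (g' k)" if k: "k < length (t' @ [Pos])" for k
        proof -
          consider "k = m" | "k < m" "k \<in> supp t" | "k < m" "k \<notin> supp t"
            using k t'(1) by (auto simp: less_Suc_eq)
          then show ?thesis
          proof cases
            case 1
            have "v \<in> dom a" using v(1) by simp
            then show ?thesis using 1 t'(1) by (auto simp: f'_def g'_def nth_append)
          next
            case 2
            then show ?thesis using at' t' by (simp add: f'_def g'_def nth_append)
          next
            case 3
            then have "f k \<notin> f ` supp t"
              using inj_on_image_mem_iff[OF f, of k "supp t"] supp_subset[of t] by (auto simp: m_def)
            then have "f k \<notin> dom a"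
              using False v(1) 3 dom\<tau> by auto
            moreover have "t' ! k = Free" using 3 t' by (auto simp: supp_def m_def)
            ultimately show ?thesis using 3 t' by (auto simp: f'_def nth_append dom_def)
          qed
        qed
        have "f' m = v" by (simp add: f'_def)
        have "f' ` supp t = f ` supp t"
          using supp_subset[of t] by (intro image_cong) (auto simp: f'_def m_def)
        then have "dom a = f' ` insert m (supp t)"
          using v(1) dom\<tau> \<open>f' m = v\<close> by simp
        also have "\<dots> \<subseteq> f' ` {..<length (t' @ [Pos])}"
          using t'(1) supp_subset[of t] by (intro image_mono) (auto simp: m_def)
        finally show "dom a \<subseteq> f' ` {..<length (t' @ [Pos])}" .
      qed (use f' t' in simp)
      moreover have "t' @ [Pos] \<in> set (candidates t)"
        using t' mem_fills_new[of t'] by (auto simp: candidates_def)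
      ultimately show ?thesis by blast
    qed
    then obtain c where c: "c \<in> set (candidates t)" "a = inst f' g' c" by blast
    have lenc: "length c = Suc m" using length_candidates[OF c(1)] by (simp add: m_def)
    define P' where "P' = map (\<lambda>c. c @ [Free]) P"
    have P': "length d = Suc m \<and> inst f' g' d \<in> B" if "d \<in> set P'" for d
      using that occ pad by (auto simp: P'_def B_def covered_def occurs_def)
    have BA: "B \<subseteq> A" using covered_subset[OF occ] by (simp add: B_def)
    \<comment> \<open>A clash would make \<open>a\<close> equal or opposite to a known face, and
      then \<open>a\<close> would be covered.\<close>
    have "\<not> list_ex (clash c) P'"
    proof
      assume "list_ex (clash c) P'"
      then obtain d where d: "d \<in> set P'" "clash c d" by (auto simp: list_ex_iff)
      then have "inst f' g' c = inst f' g' d \<or> inst f' g' c = opposite (inst f' g' d)"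
        using eq_or_opposite_if_clash[of c d f' g'] P'[OF d(1)] f' lenc c(2) aA BA by auto
      then show False
        using P'[OF d(1)] aB c(2) opposite_covered[OF occ] by (auto simp: B_def)
    qed
    then have "c \<in> set (filter (\<lambda>c. \<not> list_ex (clash c) P') (candidates t))" using c by simp
    moreover have "list_all2 (\<lambda>c (G, p). embeds (Suc m) (c # P') p G)
        (filter (\<lambda>c. \<not> list_ex (clash c) P') (candidates t)) H"
      using ok by (simp add: step_ok_def m_def P'_def Let_def)
    ultimately have "\<exists>(G, p)\<in>set H. embeds (Suc m) (c # P') p G"
      by (rule list_all2_memD[rotated])
    then obtain G p where Gp: "(G, p) \<in> set H" "embeds (Suc m) (c # P') p G" by blast
    have "settled G" using H Gp(1) by (auto simp: list_all_iff)
    then show conclusion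
      using conclusion_if_embeds[OF Gp(2) _ f', of g'] P' lenc c(2) aA BA by auto
  qed
  then show ?thesis using cok by (auto simp: settled_def clauses_ok_def list_all_iff)
qed

section \<open>Balanced patterns and the faces they leave over\<close>

lemma sum_weight_covered_eq_0:
  assumes occ: "occurs m f g P" and bal: "balanced m P" and t: "card (dom t) = 4"
  shows "(\<Sum>b\<in>covered f g P. weight t b) = 0"
proof (cases "\<exists>b\<in>covered f g P. dom t \<subseteq> dom b")
  case True
  have ok: "clauses_ok m P" using bal by (simp add: balanced_def)
  have f: "inj_on f {..<m}" using occ by (simp add: occurs_def)
  obtain c where c: "c \<in> set P" "dom t \<subseteq> dom (inst f g c)"
    using True occ by (auto simp: covered_def occurs_def inst_opp)
  have len: "length c = m" "degree c = 5" using c occ by (auto simp: occurs_def)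
  then have sub: "dom t \<subseteq> f ` supp c" using c f by (simp add: dom_inst)
  have inj: "inj_on f (supp c)" using f len supp_subset inj_on_subset by blast
  have fin: "finite (dom t)" using t card.infinite by fastforce
  have "card (f ` supp c - dom t) = 1"
    using sub t len fin by (simp add: card_Diff_subset card_image[OF inj] card_supp)
  then obtain x where x: "f ` supp c - dom t = {x}" using card_1_singletonE by blast
  then obtain i where i: "i \<in> supp c" "x = f i" by blast
  define s where "s = c[i := Free]"
  have s: "length s = m" "supp s = supp c - {i}" by (simp_all add: s_def len supp_list_update_Free)
  have "f ` supp s = f ` supp c - {f i}"
    using s i inj by (simp add: inj_on_image_set_diff)
  then have dom: "dom t = dom (inst f g s)"
    using x i sub f s by (auto simp: dom_inst)
  have "degree s = 4" using s i len by (simp flip: card_supp) 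
  moreover have "sum_list (map (clause_weight s) P) = 0"
    using bal c i len by (fastforce simp: balanced_def list_all_iff s_def supp_def)
  ultimately have 0: "(\<Sum>b\<in>covered f g P. weight (inst f g s) b) = 0"
    using sum_weight_covered[OF occ ok s(1)] by simp
  \<comment> \<open>The signs of \<open>t\<close> may differ from those of \<open>s\<close>, for
    which the sum was tested; all weights then change by one common sign.\<close>
  have "(\<Sum>b\<in>covered f g P. weight t b) =
      (\<Sum>b\<in>covered f g P. weight t (inst f g s) * weight (inst f g s) b)"
    by (intro sum.cong refl weight_same_dom dom)
  then show ?thesis using 0 by (simp flip: sum_distrib_left)
next
  case False
  have "finite (dom t)" using t card.infinite by fastforce
  then show ?thesis using False weight_eq_0_iff by (intro sum.neutral) blast
qed

text \<open>At the four coordinates other than \<open>x\<close> the uncovered faces are balanced and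
  \<open>a\<close> contributes 1, so another one contributes -1. If it fixed \<open>x\<close> as
  well, it would be \<open>a\<close> or its opposite, and both have weight 1 at a set of even
  size.\<close>

lemma neighbour_in_rest:
  assumes occ: "occurs m f g P" and bal: "balanced m P" and a: "a \<in> A - covered f g P" "x \<in> dom a"
  obtains b where "b \<in> A - covered f g P" "dom a - {x} \<subseteq> dom b" "x \<notin> dom b"
proof -
  define t where "t = a |` (dom a - {x})"
  have dom: "dom t = dom a - {x}" by (auto simp: t_def)
  have card: "card (dom t) = 4" using a card_dom[of a] dom by simp
  have fin: "finite (dom t)" using card card.infinite by fastforce
  have "weight t a = weight t t"
    unfolding weight_def by (intro prod.cong refl) (auto simp: t_def dom)
  then have self: "weight t a = 1" by simp
  have "(\<Sum>b\<in>A. weight t b) = 0"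
    using dom card dom_subset[of a] a(1) by (intro sum_weight_eq_0) (blast, force)
  then have "(\<Sum>b\<in>A - covered f g P. weight t b) = 0"
    using sum_weight_covered_eq_0[OF occ bal card]
      sum.subset_diff[OF covered_subset[OF occ] finite_A, of "weight t"] by simp
  then have "(\<Sum>b\<in>A - covered f g P - {a}. weight t b) = - 1"
    using a self by (simp add: sum.remove)
  then have "\<exists>b\<in>A - covered f g P - {a}. weight t b < 0"
    using sum_nonneg[of "A - covered f g P - {a}" "weight t"] by force
  then obtain b where b: "b \<in> A - covered f g P" "weight t b < 0" by blast
  have sub: "dom t \<subseteq> dom b" using weight_eq_0_iff[OF fin, of b] b(2) by auto
  have "x \<notin> dom b"
  proof
    assume "x \<in> dom b"
    then have "dom a \<subseteq> dom b" using sub dom by blast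
    then have "dom a = dom b"
      using a(1) b(1) card_dom finite_dom by (intro card_subset_eq) auto
    then have "b = a \<or> b = opposite a" using eq_or_opposite a b by blast
    then show False using b(2) self weight_opposite[of t a] card by auto
  qed
  then show ?thesis using that[of b] b sub dom by blast
qed

text \<open>The faces not covered by a balanced pattern are balanced themselves. A nonempty balanced
  family closed under taking opposites contains, along with a face, ten further ones that arise by
  exchanging one of its five fixed coordinates; a pattern with 12 clauses leaves only 8 faces.\<close>

lemma settled_balanced:
  assumes bal: "balanced m P" and len: "length P = 12"
  shows "settled P"
proof -
  have ok: "clauses_ok m P" using bal by (simp add: balanced_def)
  have False if occ': "occurs m' f g P" for m' f g
  proof -
    have "m' = m" using occ' ok len by (cases P) (auto simp: occurs_def clauses_ok_def)
    with occ' have occ: "occurs m f g P" by simp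
    let ?R = "A - covered f g P"
    have R: "card ?R = 8"
      using card_covered[OF occ ok] len covered_subset[OF occ] card_A
      by (simp add: card_Diff_subset finite_subset[OF _ finite_A])
    then obtain a where a: "a \<in> ?R" by (metis card.empty equals0I zero_neq_numeral)
    have "\<forall>x\<in>dom a. \<exists>b\<in>?R. dom a - {x} \<subseteq> dom b \<and> x \<notin> dom b"
      using neighbour_in_rest[OF occ bal a] by metis
    then obtain b where b: "\<And>x. x \<in> dom a \<Longrightarrow> b x \<in> ?R \<and> dom a - {x} \<subseteq> dom (b x) \<and> x \<notin> dom (b x)"
      by metis
    \<comment> \<open>The neighbour chosen for \<open>x\<close> leaves \<open>x\<close> free,
      whereas the neighbour for any other coordinate of \<open>a\<close> fixes it.\<close>
    have eq: "x = y" if "x \<in> dom a" "y \<in> dom a" "dom (b x) = dom (b y)" for x y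
      using b[OF that(1)] b[OF that(2)] that by blast
    let ?X = "b ` dom a"
    have "card ?X = 5"
      using eq card_dom[of a] a by (subst card_image) (metis inj_onI, simp)
    moreover have "card (opposite ` ?X) = card ?X"
      by (intro card_image inj_onI) (metis opposite_opposite)
    moreover have "?X \<inter> opposite ` ?X = {}"
    proof (rule ccontr)
      assume "?X \<inter> opposite ` ?X \<noteq> {}"
      then obtain x y where xy: "x \<in> dom a" "y \<in> dom a" "b x = opposite (b y)" by auto
      then have "x = y" using eq[of x y] by simp
      then have "opposite (b y) = b y" using xy by simp
      moreover have "dom (b y) \<noteq> {}" using card_dom[of "b y"] b[OF xy(2)] by auto
      ultimately show False using opposite_neq[of "b y"] by simp
    qed
    moreover have "finite ?X" using a finite_dom by blast
    ultimately have "card (?X \<union> opposite ` ?X) = 10" by (subst card_Un_disjoint) auto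
    moreover have "?X \<union> opposite ` ?X \<subseteq> ?R"
    proof -
      have "opposite c \<in> ?R" if "c \<in> ?R" for c
        using that opposite_covered[OF occ, of "opposite c"] by auto
      then show ?thesis using b by blast
    qed
    ultimately have "10 \<le> card ?R" by (metis card_mono finite_A finite_Diff)
    then show False using R by simp
  qed
  then show ?thesis using ok by (auto simp: settled_def clauses_ok_def list_all_iff)
qed

section \<open>Patterns that describe the whole splitting\<close>

lemma equivalent_if_complete:
  assumes ok: "clauses_ok 8 P" and len: "length P = 16" and U: "(\<lambda>c. Suc ` supp c) ` set P = U"
    and cover: "\<Union> U = {1..8}" and occ: "occurs m f g P"
  shows "equivalent {1..8} U {1..n} (beta n ` A)"
proof -
  have m: "m = 8" using occ ok len by (cases P) (auto simp: occurs_def clauses_ok_def)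
  have f: "inj_on f {..<8}" using occ m by (simp add: occurs_def)
  \<comment> \<open>Sixteen clauses and their opposites are 32 distinct faces, which leaves none
    over.\<close>
  have "covered f g P = A"
    using card_covered[OF occ] ok len covered_subset[OF occ] card_A m by (intro card_subset_eq) auto
  have dom: "dom (inst f g c) = f ` supp c" if "c \<in> set P" for c
    using that occ m by (intro dom_inst) (auto simp: occurs_def)
  have "beta n ` A = dom ` A" using beta_eq_dom by simp
  also have "\<dots> = dom ` covered f g P" by (simp add: \<open>covered f g P = A\<close>)
  also have "\<dots> = (\<lambda>c. dom (inst f g c)) ` set P"
    using occ m by (force simp: covered_def inst_opp occurs_def image_Un image_image)
  also have "\<dots> = (\<lambda>c. f ` supp c) ` set P" using dom by simp
  \<comment> \<open>Positions count from 0 and the points of \<open>U\<close> from 1, hence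
    \<open>Suc\<close> in the hypothesis and \<open>x - 1\<close> here.\<close>
  also have "\<dots> = (\<lambda>u. (\<lambda>x. f (x - 1)) ` u) ` U"
    by (simp add: image_image flip: U)
  finally have 1: "beta n ` A = (\<lambda>u. (\<lambda>x. f (x - 1)) ` u) ` U" .
  have 2: "inj_on (\<lambda>x. f (x - 1)) {1..8}"
    using f by (intro inj_onI) (fastforce dest: inj_onD)
  \<comment> \<open>Since \<open>U\<close> covers \<open>{1..8}\<close>, each of the eight
    coordinates is fixed by some face, so it belongs to \<open>{1..n}\<close>.\<close>
  have "(\<lambda>x. f (x - 1)) ` {1..8} = \<Union> (beta n ` A)"
    unfolding 1 cover[symmetric] by blast
  also have "\<dots> \<subseteq> {1..n}" by (auto simp: beta_def)
  finally show ?thesis using 1 2 unfolding equivalent_def by blast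
qed

end

section \<open>The case analysis\<close>

text \<open>This replaces the comprehension by a computable list, so that the supports can be
  compared with \<open>E_coll\<close> and \<open>F_coll\<close> by evaluation.\<close>

lemma supp_code [code]: "supp c = set (filter (\<lambda>i. c ! i \<noteq> Free) [0..<length c])"
  by (auto simp: supp_def)

text \<open>Clauses are written as lists of literals: \<open>i\<close> means \<^const>\<open>Pos\<close> and \<open>-i\<close> means \<^const>\<open>Neg\<close> at
  the \<open>i\<close>-th position, counted from 1. The \<open>k\<close>-th entry of an embedding is the literal to which
  the \<open>k\<close>-th positive literal is mapped.\<close>

definition clause :: "nat \<Rightarrow> int list \<Rightarrow> sign list" where
  "clause m ls = map (\<lambda>i. if i \<in> set ls then Pos else if - i \<in> set ls then Neg else Free) [1..int m]"

definition pattern :: "nat \<Rightarrow> int list list \<Rightarrow> sign list list" where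
  "pattern m = map (clause m)"

definition perm :: "int list \<Rightarrow> (nat \<times> bool) list" where
  "perm = map (\<lambda>l. (nat (\<bar>l\<bar> - 1), l < 0))"

context splitting
begin

lemma settled_complete:
  assumes "clauses_ok 8 P" "length P = 16" "(\<lambda>c. Suc ` supp c) ` set P = U" "\<Union> U = {1..8}"
    and "equivalent {1..8} U {1..n} (beta n ` A) \<Longrightarrow> conclusion"
  shows "settled P"
  using equivalent_if_complete[OF assms(1-4)] assms(1,5)
  unfolding settled_def clauses_ok_def list_all_iff by blast

lemma settled_complete_E:
  assumes "clauses_ok 8 P" "length P = 16" "(\<lambda>c. Suc ` supp c) ` set P = E_coll"
  shows "settled P"
proof (rule settled_complete[OF assms])
  show "\<Union> E_coll = {1..8}" by code_simp
qed (simp add: conclusion_def)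

lemma settled_complete_F:
  assumes "clauses_ok 8 P" "length P = 16" "(\<lambda>c. Suc ` supp c) ` set P = F_coll"
  shows "settled P"
proof (rule settled_complete[OF assms])
  show "\<Union> F_coll = {1..8}" by code_simp
qed (simp add: conclusion_def)

end

text \<open>The patterns and embeddings were found by a computer search that keeps, of every extension it
  has refuted, only the clauses needed for the refutation.\<close>

definition "pat0 = pattern 7 [
  [1,2,3,4,5], [2,-3,4,5,6], [1,-3,-4,5,6], [1,3,-4,5,7], [2,-3,-4,-5,-7], [1,2,-4,-5,7]]"

definition "pat1 = pattern 8 [
  [1,2,3,4,5], [2,-3,4,5,6], [1,-3,-4,5,6], [1,3,-4,5,7], [1,3,4,-5,8], [1,-2,-3,4,8],
  [1,-2,3,5,-7], [2,-3,-4,-5,-7]]"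

definition "pat2 = pattern 8 [
  [1,2,3,4,5], [2,-3,4,5,6], [1,-3,-4,5,6], [1,3,-4,5,7], [1,3,4,-5,8], [1,-2,-3,4,8],
  [1,-2,3,5,-7]]"

definition "pat3 = pattern 8 [
  [1,2,3,4,5], [2,-3,4,5,6], [1,-3,-4,5,6], [1,3,-4,5,7], [1,3,4,-5,8], [1,-2,-3,4,8],
  [1,-2,-3,-4,-6], [1,2,-4,-5,7]]"

definition "pat4 = pattern 8 [
  [1,2,3,4,5], [2,-3,4,5,6], [1,-3,-4,5,6], [1,3,-4,5,7], [1,3,4,-5,8], [1,-2,-3,4,8],
  [1,2,-3,-5,-7], [1,-2,-4,-5,6], [1,-2,-3,-4,-6]]"

definition "pat5 = pattern 8 [
  [1,2,3,4,5], [2,-3,4,5,6], [1,-3,-4,5,6], [1,3,-4,5,7], [1,3,4,-5,8], [1,-2,-3,4,8],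
  [1,2,-3,-5,-7], [1,-2,-4,-5,6]]"

definition "pat6 = pattern 8 [
  [1,2,3,4,5], [2,-3,4,5,6], [1,-3,-4,5,6], [1,3,-4,5,7], [1,3,4,-5,8], [1,-2,-3,4,8],
  [1,2,-3,-5,-7]]"

definition "pat7 = pattern 8 [
  [1,2,3,4,5], [2,-3,4,5,6], [1,-3,-4,5,6], [1,3,-4,5,7], [1,3,4,-5,8], [1,-2,-3,4,8],
  [1,-3,-5,-7,-8], [2,-3,4,-6,7]]"

definition "pat8 = pattern 8 [
  [1,2,3,4,5], [2,-3,4,5,6], [1,-3,-4,5,6], [1,3,-4,5,7], [1,3,4,-5,8], [1,-2,-3,4,8],
  [1,-3,-5,-7,-8]]"

definition "pat9 = pattern 8 [
  [1,2,3,4,5], [2,-3,4,5,6], [1,-3,-4,5,6], [1,3,-4,5,7], [1,3,4,-5,8], [1,-2,-3,4,8]]"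

definition "pat10 = pattern 8 [
  [1,2,3,4,5], [2,-3,4,5,6], [1,-3,-4,5,6], [1,3,-4,5,7], [1,3,4,-5,8], [1,-2,3,4,-8],
  [1,-2,4,5,8], [2,3,-4,-5,8]]"

definition "pat11 = pattern 8 [
  [1,2,3,4,5], [2,-3,4,5,6], [1,-3,-4,5,6], [1,3,-4,5,7], [1,3,4,-5,8], [1,-2,3,4,-8],
  [1,-2,4,5,8]]"

definition "pat12 = pattern 7 [
  [1,2,3,4,5], [1,-3,-4,5,6], [1,3,4,-5,7], [1,-2,3,4,-7], [1,2,-4,-5,7], [1,-2,-4,-5,6]]"

definition "pat13 = pattern 8 [
  [1,2,3,4,5], [2,-3,4,5,6], [1,-3,-4,5,6], [1,3,-4,5,7], [1,3,4,-5,8], [1,-2,3,4,-8],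
  [1,2,-4,-5,8]]"

definition "pat14 = pattern 8 [
  [1,2,3,4,5], [2,-3,4,5,6], [1,-3,-4,5,6], [1,3,-4,5,7], [1,-2,3,4,-8], [1,2,4,-5,-8],
  [1,-4,5,-6,-7]]"

definition "pat15 = pattern 8 [
  [1,2,3,4,5], [2,-3,4,5,6], [1,-3,-4,5,6], [1,3,-4,5,7], [1,-2,3,4,-8], [1,2,4,-5,-8],
  [1,2,-3,-5,8]]"

definition "pat16 = pattern 8 [
  [1,2,3,4,5], [2,-3,4,5,6], [1,-3,-4,5,6], [1,3,-4,5,7], [1,3,4,-5,8], [1,2,4,-5,-8],
  [1,-2,-3,-5,-8]]"

definition "pat17 = pattern 8 [
  [1,2,3,4,5], [2,-3,4,5,6], [1,-3,-4,5,6], [1,3,-4,5,7], [1,3,4,-5,8], [1,-2,3,4,-8],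
  [1,2,4,-5,-8]]"

definition "pat18 = pattern 8 [
  [1,2,3,4,5], [2,-3,4,5,6], [1,-3,-4,5,6], [1,3,-4,5,7], [1,3,4,-5,8], [1,-2,3,4,-8]]"

definition "pat19 = pattern 8 [
  [1,2,3,4,5], [2,-3,4,5,6], [1,-3,-4,5,6], [1,3,-4,5,7], [1,3,4,-5,8], [1,-3,4,-6,8],
  [1,3,-4,6,-7], [1,-3,-5,6,8]]"

definition "pat20 = pattern 8 [
  [1,2,3,4,5], [2,-3,4,5,6], [1,-3,-4,5,6], [1,3,-4,5,7], [1,3,4,-5,8], [1,-3,4,-6,8],
  [1,-2,-3,-4,-6], [1,3,-4,6,-7]]"

definition "pat21 = pattern 8 [
  [1,2,3,4,5], [2,-3,4,5,6], [1,-3,-4,5,6], [1,3,-4,5,7], [1,3,4,-5,8], [1,-3,4,-6,8],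
  [1,-2,-3,-4,-6]]"

definition "pat22 = pattern 8 [
  [1,2,3,4,5], [2,-3,4,5,6], [1,-3,-4,5,6], [1,3,-4,5,7], [1,3,4,-5,8], [1,2,3,-4,-7],
  [1,-2,-3,4,6]]"

definition "pat23 = pattern 8 [
  [1,2,3,4,5], [2,-3,4,5,6], [1,-3,-4,5,6], [1,3,-4,5,7], [1,3,4,-5,8], [1,-3,4,-6,8],
  [1,2,3,-4,-7]]"

definition "pat24 = pattern 8 [
  [1,2,3,4,5], [2,-3,4,5,6], [1,-3,-4,5,6], [1,3,-4,5,7], [1,3,4,-5,8], [1,-3,4,-6,8]]"

definition "pat25 = pattern 8 [
  [1,2,3,4,5], [2,-3,4,5,6], [1,-3,-4,5,6], [1,3,4,-5,8], [1,-3,-4,-6,-8], [1,2,-3,4,-6],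
  [1,3,-4,6,-7]]"

definition "pat26 = pattern 8 [
  [1,2,3,4,5], [2,-3,4,5,6], [1,-3,-4,5,6], [1,3,-4,5,7], [1,3,4,-5,8], [1,-3,-4,-6,-8],
  [1,2,-3,4,-6]]"

definition "pat27 = pattern 8 [
  [1,2,3,4,5], [2,-3,4,5,6], [1,-3,-4,5,6], [1,3,-4,5,7], [1,3,4,-5,8], [1,-3,-4,-6,-8],
  [1,2,3,-4,-7], [2,-3,4,-6,7]]"

definition "pat28 = pattern 8 [
  [1,2,3,4,5], [2,-3,4,5,6], [1,-3,-4,5,6], [1,3,-4,5,7], [1,3,4,-5,8], [1,-3,-4,-6,-8],
  [1,2,3,-4,-7]]"

definition "pat29 = pattern 8 [
  [1,2,3,4,5], [2,-3,4,5,6], [1,-3,-4,5,6], [1,3,-4,5,7], [1,3,4,-5,8], [1,-3,-4,-6,-8]]"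

definition "pat30 = pattern 8 [
  [1,2,3,4,5], [2,-3,4,5,6], [1,-3,-4,5,6], [1,3,-4,5,7], [1,3,4,-5,8]]"

definition "pat31 = pattern 7 [
  [1,2,3,4,5], [2,-3,4,5,6], [1,-3,-4,5,6], [1,3,-4,5,7]]"

definition "pat32 = pattern 8 [
  [1,2,3,4,5], [2,-3,4,5,6], [1,-3,-4,5,6], [1,3,4,-5,7], [1,-2,4,5,6], [1,4,-5,-7,8]]"

definition "pat33 = pattern 8 [
  [1,2,3,4,5], [2,-3,4,5,6], [1,-3,-4,5,6], [1,3,4,-5,7], [1,-3,-4,-5,8], [1,-2,4,5,6],
  [1,2,3,-4,7]]"

definition "pat34 = pattern 8 [
  [1,2,3,4,5], [2,-3,4,5,6], [1,-3,-4,5,6], [1,3,4,-5,7], [1,-3,-4,-5,8], [1,-2,4,5,6],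
  [1,3,-4,6,7], [3,-4,5,-7,-8]]"

definition "pat35 = pattern 8 [
  [1,2,3,4,5], [2,-3,4,5,6], [1,-3,-4,5,6], [1,3,4,-5,7], [1,-3,-4,-5,8], [1,-2,4,5,6],
  [1,3,-4,6,7]]"

definition "pat36 = pattern 8 [
  [1,2,3,4,5], [1,-3,-4,5,6], [1,3,4,-5,7], [1,-3,-4,-5,8], [1,-3,4,-6,7], [3,-4,5,7,-8]]"

definition "pat37 = pattern 8 [
  [1,2,3,4,5], [2,-3,4,5,6], [1,-3,-4,5,6], [1,3,4,-5,7], [1,-3,-4,-5,8], [1,-2,4,5,6],
  [1,-3,4,-6,7]]"

definition "pat38 = pattern 8 [
  [1,2,3,4,5], [2,-3,4,5,6], [1,-3,-4,5,6], [1,3,4,-5,7], [1,-3,-4,-5,8], [1,-2,4,5,6]]"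

definition "pat39 = pattern 8 [
  [1,2,3,4,5], [2,-3,4,5,6], [1,-3,-4,5,6], [1,3,4,-5,7], [1,-3,-4,-5,8], [1,-2,-4,5,-6],
  [1,-2,3,5,6]]"

definition "pat40 = pattern 8 [
  [1,2,3,4,5], [2,-3,4,5,6], [1,-3,-4,5,6], [1,3,4,-5,7], [1,-3,-4,-5,8], [1,-2,-4,5,-6]]"

definition "pat41 = pattern 8 [
  [1,2,3,4,5], [2,-3,4,5,6], [1,3,4,-5,7], [1,-3,-4,-5,8], [2,-3,5,-6,7], [1,-3,5,-6,-7],
  [1,2,3,-4,8]]"

definition "pat42 = pattern 8 [
  [1,2,3,4,5], [2,-3,4,5,6], [1,-3,-4,5,6], [1,3,4,-5,7], [1,-3,-4,-5,8], [2,-3,5,-6,7],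
  [1,-3,5,-6,-7]]"

definition "pat43 = pattern 8 [
  [1,2,3,4,5], [2,-3,4,5,6], [1,-3,-4,5,6], [1,3,4,-5,7], [2,4,-5,6,-7], [1,-3,-5,7,-8]]"

definition "pat44 = pattern 8 [
  [1,2,3,4,5], [2,-3,4,5,6], [1,-3,-4,5,6], [1,3,4,-5,7], [1,-3,-4,-5,8], [2,4,-5,6,-7],
  [2,-3,5,-6,7]]"

definition "pat45 = pattern 8 [
  [1,2,3,4,5], [2,-3,4,5,6], [1,-3,-4,5,6], [1,3,4,-5,7], [1,-3,-4,-5,8], [2,4,-5,6,-7]]"

definition "pat46 = pattern 8 [
  [1,2,3,4,5], [2,-3,4,5,6], [1,-3,-4,5,6], [1,3,4,-5,7], [1,-3,-4,-5,8], [2,-4,-5,-6,-8],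
  [2,-3,5,-6,7]]"

definition "pat47 = pattern 8 [
  [1,2,3,4,5], [2,-3,4,5,6], [1,-3,-4,5,6], [1,3,4,-5,7], [1,-3,-4,-5,8], [2,-4,-5,-6,-8]]"

definition "pat48 = pattern 8 [
  [1,2,3,4,5], [2,-3,4,5,6], [1,-3,-4,5,6], [1,3,4,-5,7], [1,-3,-4,-5,8]]"

definition "pat49 = pattern 7 [
  [1,2,3,4,5], [2,-3,4,5,6], [1,-3,-4,5,6], [1,3,4,-5,7]]"

definition "pat50 = pattern 6 [
  [1,2,3,4,5], [2,-3,4,5,6], [1,-3,-4,5,6]]"

definition "pat51 = pattern 8 [
  [1,2,3,4,5], [2,-3,4,5,6], [1,3,-4,-5,6], [1,3,-4,5,7], [1,3,4,-5,8], [2,-3,-5,6,7],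
  [2,3,-4,-6,-7]]"

definition "pat52 = pattern 8 [
  [1,2,3,4,5], [2,-3,4,5,6], [1,3,-4,-5,6], [1,3,-4,5,7], [1,3,4,-5,8], [2,-3,-5,6,7]]"

definition "pat53 = pattern 8 [
  [1,2,3,4,5], [2,-3,4,5,6], [1,3,-4,-5,6], [1,3,-4,5,7], [1,3,4,-5,8], [2,3,-5,-6,-8]]"

definition "pat54 = pattern 8 [
  [1,2,3,4,5], [2,-3,4,5,6], [1,3,-4,-5,6], [1,3,-4,5,7], [1,3,4,-5,8]]"

definition "pat55 = pattern 8 [
  [1,2,3,4,5], [2,-3,4,5,6], [1,3,-4,-5,6], [1,3,-4,5,7], [1,-3,-4,-5,8], [2,3,-4,-6,-7],
  [2,3,-5,-6,7]]"

definition "pat56 = pattern 8 [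
  [1,2,3,4,5], [2,-3,4,5,6], [1,3,-4,-5,6], [1,3,-4,5,7], [1,-3,-4,-5,8], [2,3,-4,-6,-7]]"

definition "pat57 = pattern 8 [
  [1,2,3,4,5], [2,-3,4,5,6], [1,3,-4,-5,6], [1,3,-4,5,7], [1,-3,-4,-5,8], [2,-3,-4,6,-8],
  [1,-3,4,-6,-7]]"

definition "pat58 = pattern 8 [
  [1,2,3,4,5], [2,-3,4,5,6], [1,3,-4,-5,6], [1,3,-4,5,7], [1,-3,-4,-5,8], [2,-3,-4,6,-8]]"

definition "pat59 = pattern 8 [
  [1,2,3,4,5], [2,-3,4,5,6], [1,3,-4,-5,6], [1,3,-4,5,7], [1,-3,-4,-5,8]]"

definition "pat60 = pattern 7 [
  [1,2,3,4,5], [2,-3,4,5,6], [1,3,-4,-5,6], [1,3,-4,5,7]]"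

definition "pat61 = pattern 7 [
  [1,2,3,4,5], [2,-3,4,5,6], [1,3,-4,-5,6], [1,-3,-4,-5,7]]"

definition "pat62 = pattern 6 [
  [1,2,3,4,5], [2,-3,4,5,6], [1,3,-4,-5,6]]"

definition "pat63 = pattern 8 [
  [2,-3,4,5,6], [1,-3,4,5,-6], [1,-2,3,5,-6], [1,-2,-3,-4,-6], [1,2,-4,5,7], [1,2,-4,-6,-7],
  [4,-5,-6,7,-8], [1,3,4,-5,-7]]"

definition "pat64 = pattern 9 [
  [1,2,3,4,5], [2,-3,4,5,6], [1,-3,4,5,-6], [1,-2,3,5,-6], [1,2,-4,5,7], [2,-4,-5,-6,7],
  [1,-4,-5,6,8], [4,-5,-6,7,-8], [1,-5,6,7,-8], [1,4,-5,7,8], [1,4,-5,-7,9]]"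

definition "pat65 = pattern 8 [
  [1,2,3,4,5], [2,-3,4,5,6], [1,-3,4,5,-6], [1,-2,3,5,-6], [1,-2,-3,-4,-6], [1,2,-4,5,7],
  [2,-4,-5,-6,7], [1,2,-4,-6,-7], [1,-4,-5,6,8], [4,-5,-6,7,-8], [1,-4,6,-7,-8], [1,-5,6,7,-8],
  [1,4,-5,7,8]]"

definition "pat66 = pattern 8 [
  [1,2,3,4,5], [2,-3,4,5,6], [1,-3,4,5,-6], [1,-2,3,5,-6], [1,-2,-3,-4,-6], [1,2,-4,5,7],
  [2,-4,-5,-6,7], [1,2,-4,-6,-7], [1,-4,-5,6,8], [4,-5,-6,7,-8], [1,-4,6,-7,-8], [1,-5,6,7,-8]]"

definition "pat67 = pattern 8 [
  [1,2,3,4,5], [2,-3,4,5,6], [1,-3,4,5,-6], [1,-2,3,5,-6], [1,-2,-3,-4,-6], [1,2,-4,5,7],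
  [2,-4,-5,-6,7], [1,2,-4,-6,-7], [1,-4,-5,6,8], [4,-5,-6,7,-8], [1,-4,6,-7,-8]]"

definition "pat68 = pattern 8 [
  [1,2,3,4,5], [2,-3,4,5,6], [1,-3,4,5,-6], [1,-2,3,5,-6], [1,-2,-3,-4,-6], [1,2,-4,5,7],
  [2,-4,-5,-6,7], [1,2,-4,-6,-7], [1,-2,5,6,7], [1,-4,-5,6,8], [4,-5,-6,7,-8]]"

definition "pat69 = pattern 8 [
  [1,2,3,4,5], [2,-3,4,5,6], [1,-3,4,5,-6], [1,-2,3,5,-6], [1,-2,-3,-4,-6], [1,2,-4,5,7],
  [2,-4,-5,-6,7], [1,2,-4,-6,-7], [1,-2,5,6,7], [1,-4,-5,6,8]]"

definition "pat70 = pattern 7 [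
  [1,2,3,4,5], [2,-3,4,5,6], [1,-3,4,5,-6], [1,-2,3,5,-6], [1,-2,-3,-4,-6], [1,2,-4,5,7],
  [2,-4,-5,-6,7], [1,2,-4,-6,-7], [1,-2,5,6,7]]"

definition "pat71 = pattern 7 [
  [1,2,3,4,5], [2,-3,4,5,6], [1,-3,4,5,-6], [1,-2,3,5,-6], [1,-2,-3,-4,-6], [1,2,-4,5,7],
  [2,-4,-5,-6,7], [1,2,-4,-6,-7]]"

text \<open>Positions are numbered so that the supports are literally the members of
  \<open>E_coll\<close>; the derivation reaches this pattern through a renaming and switching of
  coordinates.\<close>

definition "pat72 = pattern 8 [
  [2,3,6,7,8], [3,4,6,7,-8], [2,3,-4,7,-8], [2,-4,-6,7,8], [2,-3,-4,-6,-8], [1,2,-3,6,7],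
  [1,-3,-4,6,-7], [2,-3,4,5,-6], [1,2,4,6,-7], [1,2,4,-5,-6], [1,3,4,5,-6], [1,-2,3,-5,-6],
  [2,3,-4,-5,-7], [1,3,-4,5,-7], [1,-2,-3,-5,7], [1,-2,-4,5,7]]"

definition "pat73 = pattern 8 [
  [1,2,3,4,5], [2,-3,4,5,6], [1,-3,4,5,-6], [1,-2,3,5,-6], [1,-2,-3,-4,-6], [1,2,-4,5,7],
  [2,-4,-5,-6,7], [1,-2,-4,6,8], [1,2,-5,6,7], [1,-2,6,7,-8], [2,-4,-6,-7,-8], [1,2,-4,-7,8],
  [1,4,-5,-6,-8], [4,-5,-6,7,8], [1,4,-5,-7,8]]"

definition "pat74 = pattern 8 [
  [1,2,3,4,5], [2,-3,4,5,6], [1,-3,4,5,-6], [1,-2,3,5,-6], [1,-2,-3,-4,-6], [1,2,-4,5,7],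
  [2,-4,-5,-6,7], [1,-2,-4,6,8], [1,2,-5,6,7], [1,-2,6,7,-8], [2,-4,-6,-7,-8], [1,2,-4,-7,8],
  [1,4,-5,-6,-8], [4,-5,-6,7,8]]"

definition "pat75 = pattern 8 [
  [1,2,3,4,5], [2,-3,4,5,6], [1,-3,4,5,-6], [1,-2,3,5,-6], [1,-2,-3,-4,-6], [1,2,-4,5,7],
  [2,-4,-5,-6,7], [1,-2,-4,6,8], [1,2,-5,6,7], [1,-2,6,7,-8], [2,-4,-6,-7,-8], [1,2,-4,-7,8],
  [1,4,-5,-6,-8]]"

definition "pat76 = pattern 8 [
  [1,2,3,4,5], [2,-3,4,5,6], [1,-3,4,5,-6], [1,-2,3,5,-6], [1,-2,-3,-4,-6], [1,2,-4,5,7],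
  [2,-4,-5,-6,7], [1,-2,-4,6,8], [1,2,-5,6,7], [1,-2,6,7,-8], [2,-4,-6,-7,-8], [1,2,-4,-7,8]]"

definition "pat77 = pattern 8 [
  [1,2,3,4,5], [2,-3,4,5,6], [1,-3,4,5,-6], [1,-2,3,5,-6], [1,-2,-3,-4,-6], [1,2,-4,5,7],
  [2,-4,-5,-6,7], [1,-2,-4,6,8], [1,2,-5,6,7], [1,-2,6,7,-8], [2,-4,-6,-7,-8]]"

definition "pat78 = pattern 8 [
  [1,2,3,4,5], [2,-3,4,5,6], [1,-3,4,5,-6], [1,-2,3,5,-6], [1,-2,-3,-4,-6], [1,2,-4,5,7],
  [2,-4,-5,-6,7], [1,-2,-4,6,8], [1,2,-5,6,7], [1,-2,6,7,-8]]"

definition "pat79 = pattern 8 [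
  [1,2,3,4,5], [2,-3,4,5,6], [1,-3,4,5,-6], [1,-2,3,5,-6], [1,-2,-3,-4,-6], [1,2,-4,5,7],
  [2,-4,-5,-6,7], [1,-2,-4,6,8], [1,2,-5,6,7]]"

definition "pat80 = pattern 8 [
  [1,2,3,4,5], [2,-3,4,5,6], [1,-3,4,5,-6], [1,-2,3,5,-6], [1,-2,-3,-4,-6], [1,2,-4,5,7],
  [2,-4,-5,-6,7], [1,-2,-4,6,8]]"

definition "pat81 = pattern 7 [
  [1,2,3,4,5], [2,-3,4,5,6], [1,-3,4,5,-6], [1,-2,3,5,-6], [1,-2,-3,-4,-6], [1,2,-4,5,7],
  [2,-4,-5,-6,7]]"

definition "pat82 = pattern 7 [
  [1,2,3,4,5], [2,-3,4,5,6], [1,-3,4,5,-6], [1,-2,3,5,-6], [1,-2,-3,-4,-6], [1,2,-4,5,7],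
  [2,-4,5,6,-7]]"

definition "pat83 = pattern 7 [
  [1,2,3,4,5], [2,-3,4,5,6], [1,-3,4,5,-6], [1,-2,3,5,-6], [1,2,-4,5,7], [2,-4,-5,-6,-7]]"

definition "pat84 = pattern 8 [
  [1,2,3,4,5], [2,-3,4,5,6], [1,-3,4,5,-6], [1,-2,3,5,-6], [1,2,-4,5,7], [2,-4,-5,-6,8],
  [1,-2,4,6,8], [1,2,-5,6,7]]"

definition "pat85 = pattern 8 [
  [1,2,3,4,5], [2,-3,4,5,6], [1,-3,4,5,-6], [1,-2,3,5,-6], [1,-2,-3,-4,-6], [1,2,-4,5,7],
  [1,-2,4,6,8], [1,2,-5,7,-8], [1,2,-5,6,8]]"

definition "pat86 = pattern 8 [
  [1,2,3,4,5], [2,-3,4,5,6], [1,-3,4,5,-6], [1,-2,3,5,-6], [1,-2,-3,-4,-6], [1,2,-4,5,7],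
  [2,-4,-5,-6,8], [1,-2,4,6,8], [1,2,-5,7,-8], [2,-4,5,-7,8]]"

definition "pat87 = pattern 8 [
  [1,2,3,4,5], [2,-3,4,5,6], [1,-3,4,5,-6], [1,-2,3,5,-6], [1,-2,-3,-4,-6], [1,2,-4,5,7],
  [2,-4,-5,-6,8], [1,-2,4,6,8], [1,2,-5,7,-8]]"

definition "pat88 = pattern 8 [
  [1,2,3,4,5], [2,-3,4,5,6], [1,-3,4,5,-6], [1,-2,3,5,-6], [1,-2,-3,-4,-6], [1,2,-4,5,7],
  [2,-4,-5,-6,8], [1,-2,4,6,8]]"

definition "pat89 = pattern 8 [
  [1,2,3,4,5], [2,-3,4,5,6], [1,-3,4,5,-6], [1,-2,3,5,-6], [1,-2,-3,-4,-6], [1,2,-4,5,7],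
  [2,-4,-5,-6,8], [2,-4,-6,-7,-8], [1,-2,-4,6,7], [1,-2,6,-7,8], [1,4,-5,-6,8]]"

definition "pat90 = pattern 8 [
  [1,2,3,4,5], [2,-3,4,5,6], [1,-3,4,5,-6], [1,-2,3,5,-6], [1,-2,-3,-4,-6], [1,2,-4,5,7],
  [2,-4,-5,-6,8], [2,-4,-6,-7,-8], [2,-4,5,-7,8], [1,-2,-4,6,7], [1,-4,6,-7,-8], [1,-2,6,-7,8]]"

definition "pat91 = pattern 8 [
  [1,2,3,4,5], [2,-3,4,5,6], [1,-3,4,5,-6], [1,-2,3,5,-6], [1,-2,-3,-4,-6], [1,2,-4,5,7],
  [2,-4,-5,-6,8], [2,-4,-6,-7,-8], [2,-4,5,-7,8], [1,-2,-4,6,7], [1,-4,6,-7,-8]]"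

definition "pat92 = pattern 8 [
  [1,2,3,4,5], [2,-3,4,5,6], [1,-3,4,5,-6], [1,-2,3,5,-6], [1,-2,-3,-4,-6], [1,2,-4,5,7],
  [2,-4,-5,-6,8], [2,-4,-6,-7,-8], [2,-4,5,-7,8], [1,-2,-4,6,7]]"

definition "pat93 = pattern 8 [
  [1,2,3,4,5], [2,-3,4,5,6], [1,-3,4,5,-6], [1,-2,3,5,-6], [1,-2,-3,-4,-6], [1,2,-4,5,7],
  [2,-4,-5,-6,8], [2,-4,-6,-7,-8], [2,-4,5,-7,8]]"

definition "pat94 = pattern 8 [
  [1,2,3,4,5], [2,-3,4,5,6], [1,-3,4,5,-6], [1,-2,3,5,-6], [1,-2,-3,-4,-6], [1,2,-4,5,7],
  [2,-4,-5,-6,8], [2,-4,-6,-7,-8]]"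

definition "pat95 = pattern 8 [
  [1,2,3,4,5], [2,-3,4,5,6], [1,-3,4,5,-6], [1,-2,3,5,-6], [1,-2,-3,-4,-6], [1,2,-4,5,7],
  [2,-4,-5,-6,8]]"

definition "pat96 = pattern 7 [
  [1,2,3,4,5], [2,-3,4,5,6], [1,-3,4,5,-6], [1,-2,3,5,-6], [1,-2,-3,-4,-6], [1,2,-4,5,7]]"

definition "pat97 = pattern 6 [
  [1,2,3,4,5], [2,-3,4,5,6], [1,-3,4,5,-6], [1,-2,3,5,-6], [1,-2,-3,-4,-6]]"

definition "pat98 = pattern 8 [
  [1,2,3,4,5], [2,-3,4,5,6], [1,-3,4,5,-6], [1,-2,3,5,-6], [1,-2,3,6,7], [2,-3,-4,-6,7],
  [2,3,-4,-6,8]]"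

definition "pat99 = pattern 7 [
  [1,2,3,4,5], [2,-3,4,5,6], [1,-3,4,5,-6], [1,-2,3,5,-6], [1,-2,3,6,7], [2,-3,-4,-6,7]]"

definition "pat100 = pattern 8 [
  [1,2,3,4,5], [1,-3,4,5,-6], [1,-2,3,5,-6], [1,-2,3,6,7], [2,3,-4,-6,-7], [1,-3,-4,6,7],
  [1,-3,-4,-6,8]]"

definition "pat101 = pattern 7 [
  [1,2,3,4,5], [2,-3,4,5,6], [1,-3,4,5,-6], [1,-2,3,5,-6], [1,-2,3,6,7], [2,3,-4,-6,-7],
  [1,-3,-4,6,7]]"

definition "pat102 = pattern 7 [
  [1,2,3,4,5], [2,-3,4,5,6], [1,-3,4,5,-6], [1,-2,3,5,-6], [1,-2,3,6,7], [2,3,-4,-6,-7],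
  [1,3,-4,6,-7], [1,2,-5,6,7]]"

definition "pat103 = pattern 7 [
  [1,2,3,4,5], [2,-3,4,5,6], [1,-3,4,5,-6], [1,-2,3,5,-6], [1,-2,3,6,7], [2,3,-4,-6,-7],
  [1,3,-4,6,-7]]"

definition "pat104 = pattern 8 [
  [1,2,3,4,5], [2,-3,4,5,6], [1,-2,3,5,-6], [1,2,-4,5,7], [1,-4,6,-7,8], [4,-5,-6,7,8],
  [1,4,-5,-6,-8], [1,-5,6,-7,-8]]"

definition "pat105 = pattern 8 [
  [1,2,3,4,5], [2,-3,4,5,6], [1,-2,3,5,-6], [1,-2,3,6,7], [1,2,-4,5,7], [1,-4,6,-7,8],
  [4,-5,-6,7,8], [1,4,-5,-6,-8]]"

definition "pat106 = pattern 8 [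
  [1,2,3,4,5], [2,-3,4,5,6], [1,-3,4,5,-6], [1,-2,3,5,-6], [1,-2,3,6,7], [1,2,-4,5,7],
  [1,-4,6,-7,8], [4,-5,-6,7,8]]"

definition "pat107 = pattern 8 [
  [1,2,3,4,5], [2,-3,4,5,6], [1,-3,4,5,-6], [1,-2,3,5,-6], [1,-2,3,6,7], [1,2,-4,5,7],
  [1,-4,6,-7,8]]"

definition "pat108 = pattern 7 [
  [1,2,3,4,5], [2,-3,4,5,6], [1,-3,4,5,-6], [1,-2,3,5,-6], [1,-2,3,6,7], [2,3,-4,-6,-7],
  [1,-3,-4,-6,-7], [1,-2,-3,-4,7], [1,2,-5,6,7], [1,2,-4,5,7], [2,-4,-5,-6,7]]"

definition "pat109 = pattern 7 [
  [1,2,3,4,5], [2,-3,4,5,6], [1,-3,4,5,-6], [1,-2,3,5,-6], [1,-2,3,6,7], [2,3,-4,-6,-7],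
  [1,-3,-4,-6,-7], [1,-2,-3,-4,7], [1,2,-5,6,7], [1,2,-4,5,7]]"

definition "pat110 = pattern 7 [
  [1,2,3,4,5], [2,-3,4,5,6], [1,-3,4,5,-6], [1,-2,3,5,-6], [1,-2,3,6,7], [2,3,-4,-6,-7],
  [1,-3,-4,-6,-7], [1,-2,-3,-4,7], [1,2,-5,6,7], [1,2,4,-5,-7]]"

definition "pat111 = pattern 7 [
  [1,2,3,4,5], [2,-3,4,5,6], [1,-3,4,5,-6], [1,-2,3,5,-6], [1,-2,3,6,7], [2,3,-4,-6,-7],
  [1,-3,-4,-6,-7], [1,-2,-3,-4,7], [1,2,-5,6,7]]"

definition "pat112 = pattern 7 [
  [1,2,3,4,5], [2,-3,4,5,6], [1,-3,4,5,-6], [1,-2,3,5,-6], [1,-2,3,6,7], [2,3,-4,-6,-7],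
  [1,-3,-4,-6,-7], [1,-2,-3,-4,7], [1,-2,5,6,-7]]"

definition "pat113 = pattern 8 [
  [1,2,3,5,7], [2,3,4,-5,7], [1,3,-4,-5,7], [1,-2,-4,5,7], [1,-2,4,5,8], [2,-3,-4,5,-8],
  [1,-3,-4,-5,-8], [1,-2,-3,-5,8], [1,2,4,6,-7], [1,2,-3,-6,8], [1,-2,4,6,-8], [1,-3,4,-6,-8],
  [2,-3,-4,6,8], [1,3,-4,6,-7], [1,2,3,-6,-7], [2,-3,4,6,7]]"

definition "pat114 = pattern 8 [
  [1,2,3,4,5], [2,-3,4,5,6], [1,-3,4,5,-6], [1,-2,3,5,-6], [1,-2,3,6,7], [2,3,-4,-6,-7],
  [1,-3,-4,-6,-7], [1,-2,-3,-4,7], [1,2,-5,6,8], [1,2,-4,7,-8], [1,-2,6,-7,8], [1,-4,6,-7,-8],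
  [2,-4,-6,7,8], [1,4,-5,-6,8], [1,2,4,-5,-8]]"

definition "pat115 = pattern 8 [
  [1,2,3,4,5], [2,-3,4,5,6], [1,-3,4,5,-6], [1,-2,3,5,-6], [1,-2,3,6,7], [2,3,-4,-6,-7],
  [1,-3,-4,-6,-7], [1,-2,-3,-4,7], [1,2,-5,6,8], [1,2,-4,7,-8], [1,-2,6,-7,8], [1,-4,6,-7,-8],
  [2,-4,-6,7,8], [1,4,-5,-6,8]]"

definition "pat116 = pattern 8 [
  [1,2,3,4,5], [2,-3,4,5,6], [1,-3,4,5,-6], [1,-2,3,5,-6], [1,-2,3,6,7], [2,3,-4,-6,-7],
  [1,-3,-4,-6,-7], [1,-2,-3,-4,7], [1,2,-5,6,8], [1,2,-4,7,-8], [1,-2,6,-7,8], [1,-4,6,-7,-8],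
  [2,-4,-6,7,8]]"

definition "pat117 = pattern 8 [
  [1,2,3,4,5], [2,-3,4,5,6], [1,-3,4,5,-6], [1,-2,3,5,-6], [1,-2,3,6,7], [2,3,-4,-6,-7],
  [1,-3,-4,-6,-7], [1,-2,-3,-4,7], [1,2,-5,6,8], [1,2,-4,7,-8], [1,-2,6,-7,8], [1,-4,6,-7,-8]]"

definition "pat118 = pattern 8 [
  [1,2,3,4,5], [2,-3,4,5,6], [1,-3,4,5,-6], [1,-2,3,5,-6], [1,-2,3,6,7], [2,3,-4,-6,-7],
  [1,-3,-4,-6,-7], [1,-2,-3,-4,7], [1,2,-5,6,8], [1,2,-4,7,-8], [1,-2,6,-7,8]]"

definition "pat119 = pattern 8 [
  [1,2,3,4,5], [2,-3,4,5,6], [1,-3,4,5,-6], [1,-2,3,5,-6], [1,-2,3,6,7], [2,3,-4,-6,-7],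
  [1,-3,-4,-6,-7], [1,-2,-3,-4,7], [1,2,-5,6,8], [1,2,-4,7,-8]]"

definition "pat120 = pattern 8 [
  [1,2,3,4,5], [2,-3,4,5,6], [1,-3,4,5,-6], [1,-2,3,5,-6], [1,-2,3,6,7], [2,3,-4,-6,-7],
  [1,-3,-4,-6,-7], [1,-2,-3,-4,7], [1,2,-5,6,8]]"

definition "pat121 = pattern 7 [
  [1,2,3,4,5], [2,-3,4,5,6], [1,-3,4,5,-6], [1,-2,3,5,-6], [1,-2,3,6,7], [2,3,-4,-6,-7],
  [1,-3,-4,-6,-7], [1,-2,-3,-4,7]]"

definition "pat122 = pattern 7 [
  [1,2,3,4,5], [2,-3,4,5,6], [1,-3,4,5,-6], [1,-2,3,5,-6], [1,-2,3,6,7], [2,3,-4,-6,-7],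
  [1,-3,-4,-6,-7]]"

definition "pat123 = pattern 7 [
  [1,2,3,4,5], [2,-3,4,5,6], [1,-3,4,5,-6], [1,-2,3,5,-6], [1,-2,3,6,7], [2,3,-4,-6,-7]]"

definition "pat124 = pattern 7 [
  [1,2,3,4,5], [1,-3,4,5,-6], [1,-2,3,5,-6], [1,-2,3,6,7], [2,-3,-5,-6,7], [1,-3,-4,-6,-7],
  [1,2,-5,6,7]]"

definition "pat125 = pattern 7 [
  [1,2,3,4,5], [2,-3,4,5,6], [1,-3,4,5,-6], [1,-2,3,5,-6], [1,-2,3,6,7], [2,-3,-5,-6,7],
  [1,-3,-4,-6,-7]]"

definition "pat126 = pattern 7 [
  [1,2,3,4,5], [2,-3,4,5,6], [1,-3,4,5,-6], [1,-2,3,5,-6], [1,-2,3,6,7], [2,-3,-5,-6,7]]"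

definition "pat127 = pattern 7 [
  [1,2,3,4,5], [2,-3,4,5,6], [1,-3,4,5,-6], [1,-2,3,5,-6], [1,-2,3,6,7]]"

definition "pat128 = pattern 6 [
  [1,2,3,4,5], [2,-3,4,5,6], [1,-3,4,5,-6], [1,-2,3,5,-6]]"

definition "pat129 = pattern 8 [
  [1,2,3,4,5], [2,-3,4,5,6], [1,-3,4,5,-6], [1,3,-5,6,7], [1,3,-4,6,-7], [1,-2,4,6,-7],
  [1,2,-4,-6,8], [1,2,-5,-6,-8]]"

definition "pat130 = pattern 8 [
  [1,2,3,4,5], [2,-3,4,5,6], [1,-3,4,5,-6], [1,3,-5,6,7], [1,3,-4,6,-7], [1,-2,4,6,-7],
  [1,2,-4,-6,8]]"

definition "pat131 = pattern 7 [
  [1,2,3,4,5], [2,-3,4,5,6], [1,-3,4,5,-6], [1,3,-5,6,7], [1,3,-4,6,-7], [1,-2,4,6,-7]]"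

definition "pat132 = pattern 7 [
  [1,2,3,4,5], [2,-3,4,5,6], [1,-3,4,5,-6], [1,3,-5,6,7], [1,3,-4,6,-7], [1,2,-4,-6,-7],
  [1,2,-5,-6,7], [1,-2,-3,-5,7], [1,-2,4,5,6], [1,-2,-3,-4,-7], [2,-3,-4,6,-7], [2,-3,-5,6,7]]"

definition "pat133 = pattern 7 [
  [1,2,3,4,5], [2,-3,4,5,6], [1,-3,4,5,-6], [1,3,-5,6,7], [1,3,-4,6,-7], [1,2,-4,-6,-7],
  [1,2,-5,-6,7], [1,-2,-3,-5,7], [1,-2,4,5,6], [1,-2,-3,-4,-7], [2,-3,-4,6,-7]]"

definition "pat134 = pattern 7 [
  [2,-3,4,5,6], [1,3,-5,6,7], [1,3,-4,6,-7], [1,-2,4,5,6], [2,-4,5,-6,7]]"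

definition "pat135 = pattern 7 [
  [1,2,3,4,5], [2,-3,4,5,6], [1,-3,4,5,-6], [1,3,-5,6,7], [1,3,-4,6,-7], [1,2,-4,-6,-7],
  [1,2,-5,-6,7], [1,-2,-3,-5,7], [1,-2,4,5,6], [1,-2,-3,-4,-7]]"

definition "pat136 = pattern 7 [
  [1,2,3,4,5], [2,-3,4,5,6], [1,-3,4,5,-6], [1,3,-5,6,7], [1,3,-4,6,-7], [1,2,-4,-6,-7],
  [1,2,-5,-6,7], [1,-2,-3,-5,7], [1,-2,4,5,6]]"

definition "pat137 = pattern 7 [
  [1,2,3,4,5], [2,-3,4,5,6], [1,-3,4,5,-6], [1,3,-5,6,7], [1,3,-4,6,-7], [1,2,-4,-6,-7],
  [1,2,-5,-6,7], [1,-2,-3,-5,7]]"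

definition "pat138 = pattern 7 [
  [1,2,3,4,5], [2,-3,4,5,6], [1,-3,4,5,-6], [1,3,-5,6,7], [1,3,-4,6,-7], [1,2,-4,-6,-7],
  [1,2,-5,-6,7]]"

definition "pat139 = pattern 7 [
  [1,2,3,4,5], [2,-3,4,5,6], [1,-3,4,5,-6], [1,3,-5,6,7], [1,3,-4,6,-7], [1,2,-4,-6,-7]]"

definition "pat140 = pattern 7 [
  [1,2,3,4,5], [2,-3,4,5,6], [1,-3,4,5,-6], [1,3,-5,6,7], [1,3,-4,6,-7]]"

definition "pat141 = pattern 7 [
  [1,2,3,4,5], [2,-3,4,5,6], [1,3,-5,6,7], [1,2,-5,-6,7], [2,3,-4,5,7]]"

definition "pat142 = pattern 7 [
  [1,2,3,4,5], [2,-3,4,5,6], [1,3,-5,6,7], [1,2,-5,-6,7], [2,3,4,-5,-7]]"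

definition "pat143 = pattern 7 [
  [1,2,3,4,5], [2,-3,4,5,6], [1,-3,4,5,-6], [1,3,-5,6,7], [1,-3,-4,-6,-7], [1,-2,4,5,6],
  [1,-2,-3,-5,7], [1,2,-5,-6,7]]"

definition "pat144 = pattern 7 [
  [1,2,3,4,5], [1,-3,4,5,-6], [1,3,-5,6,7], [1,-3,-4,-6,-7], [1,-2,4,5,6], [1,-2,-3,-5,7],
  [1,2,3,-4,-7], [1,-2,-5,6,-7]]"

definition "pat145 = pattern 7 [
  [1,2,3,4,5], [2,-3,4,5,6], [1,-3,4,5,-6], [1,3,-5,6,7], [1,-3,-4,-6,-7], [1,-2,4,5,6],
  [1,-2,-3,-5,7], [1,2,3,-4,-7]]"

definition "pat146 = pattern 7 [
  [1,2,3,4,5], [2,-3,4,5,6], [1,-3,4,5,-6], [1,3,-5,6,7], [1,-3,-4,-6,-7], [1,-2,4,5,6],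
  [1,-2,-3,-5,7]]"

definition "pat147 = pattern 7 [
  [1,2,3,4,5], [2,-3,4,5,6], [1,3,-5,6,7], [1,-3,-4,-6,-7], [1,-2,4,5,6], [1,2,3,-5,-7],
  [1,-2,-3,-4,7], [1,-2,-5,6,-7]]"

definition "pat148 = pattern 7 [
  [1,2,3,4,5], [2,-3,4,5,6], [1,-3,4,5,-6], [1,3,-5,6,7], [1,-3,-4,-6,-7], [1,-2,4,5,6],
  [1,2,3,-5,-7], [1,-2,-3,-4,7]]"

definition "pat149 = pattern 7 [
  [1,2,3,4,5], [2,-3,4,5,6], [1,-3,4,5,-6], [1,3,-5,6,7], [1,-3,-4,-6,-7], [1,-2,4,5,6],
  [1,2,3,-5,-7]]"

definition "pat150 = pattern 7 [
  [1,2,3,4,5], [2,-3,4,5,6], [1,-3,4,5,-6], [1,3,-5,6,7], [1,-3,-4,-6,-7], [1,-2,4,5,6]]"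

definition "pat151 = pattern 8 [
  [1,2,3,4,5], [2,-3,4,5,6], [1,-3,4,5,-6], [1,3,-5,6,7], [1,-3,-4,-6,-7], [1,4,-5,-6,8],
  [1,-4,6,-7,-8], [1,2,-4,5,7], [4,-5,-6,7,-8]]"

definition "pat152 = pattern 8 [
  [1,2,3,4,5], [2,-3,4,5,6], [1,-3,4,5,-6], [1,3,-5,6,7], [1,-3,-4,-6,-7], [1,4,-5,-6,8],
  [1,-4,6,-7,-8], [1,2,-4,5,7]]"

definition "pat153 = pattern 8 [
  [1,2,3,4,5], [2,-3,4,5,6], [1,-3,4,5,-6], [1,3,-5,6,7], [1,-3,-4,-6,-7], [1,4,-5,-6,8],
  [1,-4,6,-7,-8]]"

definition "pat154 = pattern 8 [
  [1,2,3,4,5], [2,-3,4,5,6], [1,-3,4,5,-6], [1,3,-5,6,7], [1,-3,-4,-6,-7], [1,4,-5,-6,8]]"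

definition "pat155 = pattern 7 [
  [1,2,3,4,5], [2,-3,4,5,6], [1,-3,4,5,-6], [1,3,-5,6,7], [1,-3,-4,-6,-7]]"

definition "pat156 = pattern 8 [
  [1,2,3,4,5], [2,-3,4,5,6], [1,-3,4,5,-6], [1,3,-5,6,7], [1,-3,-4,-6,8], [1,-2,-3,6,7]]"

definition "pat157 = pattern 8 [
  [1,2,3,4,5], [2,-3,4,5,6], [1,-3,4,5,-6], [1,3,-5,6,7], [1,-3,-4,-6,8], [1,2,-4,-6,-8],
  [1,-2,-3,-4,-8]]"

definition "pat158 = pattern 8 [
  [1,2,3,4,5], [2,-3,4,5,6], [1,-3,4,5,-6], [1,3,-5,6,7], [1,-3,-4,-6,8], [1,-2,3,6,-7],
  [1,2,-4,-6,-8]]"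

definition "pat159 = pattern 8 [
  [2,-3,4,5,6], [1,-3,4,5,-6], [1,3,-5,6,7], [1,-3,-4,-6,8], [1,-2,3,6,-7], [1,-4,5,-6,-8]]"

definition "pat160 = pattern 8 [
  [1,2,3,4,5], [2,-3,4,5,6], [1,-3,4,5,-6], [1,3,-5,6,7], [1,-3,-4,-6,8], [1,-2,3,6,-7]]"

definition "pat161 = pattern 8 [
  [1,2,3,4,5], [2,-3,4,5,6], [1,-3,4,5,-6], [1,3,-5,6,7], [1,-3,-4,-6,8]]"

definition "pat162 = pattern 7 [
  [1,2,3,4,5], [2,-3,4,5,6], [1,-3,4,5,-6], [1,3,-5,6,7]]"

definition "pat163 = pattern 7 [
  [1,2,3,4,5], [2,-3,4,5,6], [1,-3,4,5,-6], [1,-3,-5,-6,7], [1,-3,-4,-6,-7], [1,-2,3,4,7]]"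

definition "pat164 = pattern 7 [
  [1,2,3,4,5], [2,-3,4,5,6], [1,-3,4,5,-6], [1,-3,-5,-6,7], [1,-3,-4,-6,-7], [1,2,3,-4,-7],
  [1,2,3,-5,7], [1,-2,-5,6,7], [1,-2,4,5,6], [1,-2,-4,6,-7], [2,-3,-5,6,7], [2,-3,-4,6,-7]]"

definition "pat165 = pattern 7 [
  [1,2,3,4,5], [2,-3,4,5,6], [1,-3,4,5,-6], [1,-3,-5,-6,7], [1,-3,-4,-6,-7], [1,2,3,-4,-7],
  [1,2,3,-5,7], [1,-2,-5,6,7], [1,-2,4,5,6], [1,-2,-4,6,-7], [2,-3,-5,6,7]]"

definition "pat166 = pattern 7 [
  [1,2,3,4,5], [2,-3,4,5,6], [1,-3,4,5,-6], [1,-3,-5,-6,7], [1,-3,-4,-6,-7], [1,2,3,-4,-7],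
  [1,2,3,-5,7], [1,-2,-5,6,7], [1,-2,4,5,6], [1,-2,-4,6,-7], [2,-4,5,-6,7]]"

definition "pat167 = pattern 7 [
  [1,2,3,4,5], [2,-3,4,5,6], [1,-3,4,5,-6], [1,-3,-5,-6,7], [1,-3,-4,-6,-7], [1,2,3,-4,-7],
  [1,2,3,-5,7], [1,-2,-5,6,7], [1,-2,4,5,6], [1,-2,-4,6,-7]]"

definition "pat168 = pattern 7 [
  [1,2,3,4,5], [2,-3,4,5,6], [1,-3,4,5,-6], [1,-3,-5,-6,7], [1,-3,-4,-6,-7], [1,2,3,-4,-7],
  [1,2,3,-5,7], [1,-2,-5,6,7], [1,-2,4,5,6]]"

definition "pat169 = pattern 7 [
  [1,2,3,4,5], [2,-3,4,5,6], [1,-3,4,5,-6], [1,-3,-5,-6,7], [1,-3,-4,-6,-7], [1,2,3,-4,-7],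
  [1,2,3,-5,7], [1,-2,-5,6,7]]"

definition "pat170 = pattern 7 [
  [1,2,3,4,5], [2,-3,4,5,6], [1,-3,4,5,-6], [1,-3,-5,-6,7], [1,-3,-4,-6,-7], [1,2,3,-4,-7],
  [1,2,3,-5,7], [1,-2,5,6,-7], [2,-3,-5,6,7]]"

definition "pat171 = pattern 7 [
  [1,2,3,4,5], [2,-3,4,5,6], [1,-3,4,5,-6], [1,-3,-5,-6,7], [1,-3,-4,-6,-7], [1,2,3,-4,-7],
  [1,2,3,-5,7], [1,-2,5,6,-7]]"

definition "pat172 = pattern 7 [
  [1,2,3,4,5], [2,-3,4,5,6], [1,-3,4,5,-6], [1,-3,-5,-6,7], [1,-3,-4,-6,-7], [1,2,3,-4,-7],
  [1,2,3,-5,7]]"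

definition "pat173 = pattern 7 [
  [1,2,3,4,5], [2,-3,4,5,6], [1,-3,4,5,-6], [1,-3,-5,-6,7], [1,-3,-4,-6,-7], [1,2,3,-4,-7]]"

definition "pat174 = pattern 7 [
  [1,2,3,4,5], [2,-3,4,5,6], [1,-3,4,5,-6], [1,-3,-5,-6,7], [1,-3,-4,-6,-7]]"

definition "pat175 = pattern 7 [
  [1,2,3,4,5], [2,-3,4,5,6], [1,-3,4,5,-6], [1,-3,-5,-6,7]]"

definition "pat176 = pattern 6 [
  [1,2,3,4,5], [2,-3,4,5,6], [1,-3,4,5,-6]]"

definition "pat177 = pattern 8 [
  [1,2,3,4,5], [2,-3,4,5,6], [1,3,-4,5,-6], [1,-2,3,4,7], [1,2,4,-5,8], [2,-4,5,6,7]]"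

definition "pat178 = pattern 8 [
  [1,2,3,4,5], [2,-3,4,5,6], [1,3,-4,5,-6], [1,-2,3,4,7], [1,2,4,-5,8], [2,-4,-5,-6,7]]"

definition "pat179 = pattern 8 [
  [1,2,3,4,5], [2,-3,4,5,6], [1,3,-4,5,-6], [1,-2,3,4,7], [1,2,4,-5,8]]"

definition "pat180 = pattern 7 [
  [1,2,3,4,5], [2,-3,4,5,6], [1,3,-4,5,-6], [1,-2,3,4,7]]"

definition "pat181 = pattern 6 [
  [1,2,3,4,5], [2,-3,4,5,6], [1,3,-4,5,-6]]"

definition "pat182 = pattern 9 [
  [1,2,3,4,5], [3,-4,-5,6,7], [2,-3,-4,6,8], [2,-3,-5,6,-8], [2,-4,-5,-6,9], [1,-2,-3,-5,-8]]"

definition "pat183 = pattern 9 [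
  [1,2,3,4,5], [2,-3,4,5,6], [3,-4,-5,6,7], [2,-3,-4,6,8], [2,-3,-5,6,-8], [2,-4,-5,-6,9]]"

definition "pat184 = pattern 8 [
  [1,2,3,4,5], [2,-3,4,5,6], [3,-4,-5,6,7], [2,-3,-4,6,8], [2,-3,-5,6,-8]]"

definition "pat185 = pattern 9 [
  [1,2,3,4,5], [2,-3,4,5,6], [3,-4,-5,6,7], [2,-3,-4,6,8], [2,3,-5,-6,9], [2,-3,-6,7,8]]"

definition "pat186 = pattern 9 [
  [1,2,3,4,5], [2,-3,4,5,6], [3,-4,-5,6,7], [2,-3,-4,6,8], [2,3,-5,-6,9]]"

definition "pat187 = pattern 8 [
  [1,2,3,4,5], [2,-3,4,5,6], [3,-4,-5,6,7], [2,-3,-4,6,8]]"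

definition "pat188 = pattern 8 [
  [1,2,3,4,5], [2,-3,4,5,6], [3,-4,-5,6,7], [2,3,-4,-6,8]]"

definition "pat189 = pattern 7 [
  [1,2,3,4,5], [2,-3,4,5,6], [3,-4,-5,6,7]]"

definition "pat190 = pattern 7 [
  [1,2,3,4,5], [2,-3,4,5,6], [3,-4,5,-6,7], [2,3,-4,-6,-7]]"

definition "pat191 = pattern 7 [
  [1,2,3,4,5], [2,-3,4,5,6], [3,-4,5,-6,7]]"

definition "pat192 = pattern 6 [
  [1,2,3,4,5], [2,-3,4,5,6]]"

definition "pat193 = pattern 5 [
  [1,2,3,4,5]]"

context splitting
begin

section \<open>Exclusion of \<open>pat50\<close>\<close>

lemma settled_pat0 [simp]: "settled pat0"
  by (rule settled_step[of _ "clause 7 [2,-3,4,5]" "[]"]) (code_simp, simp)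

text \<open>Evaluation by \<open>code_simp\<close> checks \<open>step_ok\<close>. The entries follow
  the order of the candidates that survive the clash test; \<open>simp\<close> discharges them by
  the lemmas proved before.\<close>

lemma settled_pat1 [simp]: "settled pat1"
  by (rule settled_step[of _ "clause 8 [2,-4,-5,-7]"
    "[(pat0, perm [1,2,3,4,5,6,7])]"])
    (code_simp, simp)

lemma settled_pat2 [simp]: "settled pat2"
  by (rule settled_step[of _ "clause 8 [3,-4,5,7]"
    "[(pat1, perm [1,2,3,4,5,6,7,8])]"])
    (code_simp, simp)

text \<open>The empty list means that every candidate clashes, so no splitting contains these faces.
  All terminal patterns are of this kind except \<open>pat72\<close>, \<open>pat113\<close>,
  \<open>pat132\<close> and \<open>pat164\<close>.\<close>

lemma settled_pat3 [simp]: "settled pat3"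
  by (rule settled_step[of _ "clause 8 [3,4,-5,8]" "[]"]) (code_simp, simp)

lemma settled_pat4 [simp]: "settled pat4"
  by (rule settled_step[of _ "clause 8 [1,-4,5,7]"
    "[(pat3, perm [1,2,3,4,5,6,7,8])]"])
    (code_simp, simp)

lemma settled_pat5 [simp]: "settled pat5"
  by (rule settled_step[of _ "clause 8 [2,-3,4,6]"
    "[(pat4, perm [1,2,3,4,5,6,7,8])]"])
    (code_simp, simp)

lemma settled_pat6 [simp]: "settled pat6"
  by (rule settled_step[of _ "clause 8 [2,4,5,6]"
    "[(pat5, perm [3,2,1,5,4,-6,8,7])]"])
    (code_simp, simp)

lemma settled_pat7 [simp]: "settled pat7"
  by (rule settled_step[of _ "clause 8 [1,-3,5,6]" "[]"]) (code_simp, simp)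

lemma settled_pat8 [simp]: "settled pat8"
  by (rule settled_step[of _ "clause 8 [2,-3,4,6]"
    "[(pat7, perm [1,2,3,4,5,6,7,8])]"])
    (code_simp, simp)

lemma settled_pat9 [simp]: "settled pat9"
  by (rule settled_step[of _ "clause 8 [1,3,5,7]"
    "[(pat6, perm [1,2,3,4,5,6,7,8]), (pat8, perm [1,2,3,4,5,6,7,8]),
     (pat2, perm [1,2,3,4,5,6,7,8])]"])
    (code_simp, simp)

lemma settled_pat10 [simp]: "settled pat10"
  by (rule settled_step[of _ "clause 8 [2,4,5,6]" "[(pat0, perm [3,2,1,5,4,-6,8])]"]) (code_simp, simp)

lemma settled_pat11 [simp]: "settled pat11"
  by (rule settled_step[of _ "clause 8 [2,-4,-5,-8]"
    "[(pat10, perm [1,2,3,4,5,6,7,8])]"])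
    (code_simp, simp)

lemma settled_pat12 [simp]: "settled pat12"
  by (rule settled_step[of _ "clause 7 [1,2,4,5]" "[]"]) (code_simp, simp)

lemma settled_pat13 [simp]: "settled pat13"
  by (rule settled_step[of _ "clause 8 [1,2,4,5]" "[(pat12, perm [1,2,3,4,5,6,8])]"]) (code_simp, simp)

lemma settled_pat14 [simp]: "settled pat14"
  by (rule settled_step[of _ "clause 8 [4,-5,6,7]"
    "[(pat12, perm [-4,6,1,5,-3,-2,7])]"])
    (code_simp, simp)

lemma settled_pat15 [simp]: "settled pat15"
  by (rule settled_step[of _ "clause 8 [1,-4,5,7]"
    "[(pat14, perm [1,2,3,4,5,6,7,8])]"])
    (code_simp, simp)

lemma settled_pat16 [simp]: "settled pat16"
  by (rule settled_step[of _ "clause 8 [2,-3,4,6]" "[]"]) (code_simp, simp)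

lemma settled_pat17 [simp]: "settled pat17"
  by (rule settled_step[of _ "clause 8 [1,2,-5,-8]"
    "[(pat16, perm [1,2,3,4,5,6,7,8]), (pat15, perm [1,2,3,4,5,6,7,8])]"])
    (code_simp, simp)

lemma settled_pat18 [simp]: "settled pat18"
  by (rule settled_step[of _ "clause 8 [1,-2,4,-8]"
    "[(pat13, perm [1,2,3,4,5,6,7,8]), (pat17, perm [1,2,3,4,5,6,7,8]),
     (pat11, perm [1,2,3,4,5,6,7,8])]"])
    (code_simp, simp)

lemma settled_pat19 [simp]: "settled pat19"
  by (rule settled_step[of _ "clause 8 [3,-4,5,7]" "[]"]) (code_simp, simp)

lemma settled_pat20 [simp]: "settled pat20"
  by (rule settled_step[of _ "clause 8 [1,3,-5,8]"
    "[(pat19, perm [1,2,3,4,5,6,7,8])]"])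
    (code_simp, simp)

lemma settled_pat21 [simp]: "settled pat21"
  by (rule settled_step[of _ "clause 8 [1,-3,-4,6]"
    "[(pat20, perm [1,2,3,4,5,6,7,8])]"])
    (code_simp, simp)

lemma settled_pat22 [simp]: "settled pat22"
  by (rule settled_step[of _ "clause 8 [1,2,3,4]"
    "[(pat18, perm [1,2,3,4,5,6,7,8])]"])
    (code_simp, simp)

lemma settled_pat23 [simp]: "settled pat23"
  by (rule settled_step[of _ "clause 8 [2,-3,4,6]"
    "[(pat22, perm [1,2,3,4,5,6,7,8]), (pat21, perm [1,2,3,4,5,6,7,8])]"])
    (code_simp, simp)

lemma settled_pat24 [simp]: "settled pat24"
  by (rule settled_step[of _ "clause 8 [1,2,3,4]"
    "[(pat21, perm [1,2,3,4,5,6,7,8]), (pat18, perm [1,2,3,4,5,6,7,8]),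
     (pat23, perm [1,2,3,4,5,6,7,8])]"])
    (code_simp, simp)

lemma settled_pat25 [simp]: "settled pat25"
  by (rule settled_step[of _ "clause 8 [1,-4,6,-7]"
    "[(pat18, perm [1,5,-4,6,-3,2,-8,-7])]"])
    (code_simp, simp)

lemma settled_pat26 [simp]: "settled pat26"
  by (rule settled_step[of _ "clause 8 [1,-3,-4,6]"
    "[(pat25, perm [1,2,3,4,5,6,7,8])]"])
    (code_simp, simp)

lemma settled_pat27 [simp]: "settled pat27"
  by (rule settled_step[of _ "clause 8 [2,4,-6,7]" "[]"]) (code_simp, simp)

lemma settled_pat28 [simp]: "settled pat28"
  by (rule settled_step[of _ "clause 8 [2,-3,4,6]"
    "[(pat22, perm [1,2,3,4,5,6,7,8]), (pat26, perm [1,2,3,4,5,6,7,8]),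
     (pat27, perm [1,2,3,4,5,6,7,8])]"])
    (code_simp, simp)

lemma settled_pat29 [simp]: "settled pat29"
  by (rule settled_step[of _ "clause 8 [1,2,3,4]"
    "[(pat18, perm [1,2,3,4,5,6,7,8]), (pat26, perm [1,2,3,4,5,6,7,8]),
     (pat28, perm [1,2,3,4,5,6,7,8])]"])
    (code_simp, simp)

lemma settled_pat30 [simp]: "settled pat30"
  by (rule settled_step[of _ "clause 8 [1,3,4,8]"
    "[(pat29, perm [1,2,3,4,5,6,7,8]), (pat9, perm [1,2,3,4,5,6,7,8]),
     (pat24, perm [1,2,3,4,5,6,7,8]), (pat18, perm [1,2,3,4,5,6,7,8])]"])
    (code_simp, simp)

lemma settled_pat31 [simp]: "settled pat31"
  by (rule settled_step[of _ "clause 7 [1,3,4,5]"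
    "[(pat30, perm [1,6,-4,-3,5,2,7,-8]), (pat30, perm [1,2,3,4,5,6,7,8])]"])
    (code_simp, simp)

lemma settled_pat32 [simp]: "settled pat32"
  by (rule settled_step[of _ "clause 8 [1,4,-7,8]" "[]"]) (code_simp, simp)

lemma settled_pat33 [simp]: "settled pat33"
  by (rule settled_step[of _ "clause 8 [1,-4,-5,8]"
    "[(pat32, perm [1,2,3,4,5,6,7,8])]"])
    (code_simp, simp)

lemma settled_pat34 [simp]: "settled pat34"
  by (rule settled_step[of _ "clause 8 [2,-3,4,6]" "[]"]) (code_simp, simp)

lemma settled_pat35 [simp]: "settled pat35"
  by (rule settled_step[of _ "clause 8 [3,4,5,-8]"
    "[(pat31, perm [-6,-8,-4,5,3,-1,-2]), (pat34, perm [1,2,3,4,5,6,7,8])]"])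
    (code_simp, simp)

lemma settled_pat36 [simp]: "settled pat36"
  by (rule settled_step[of _ "clause 8 [1,4,-6,7]" "[]"]) (code_simp, simp)

lemma settled_pat37 [simp]: "settled pat37"
  by (rule settled_step[of _ "clause 8 [3,4,5,-8]"
    "[(pat31, perm [-6,-8,-4,5,3,-1,-2]), (pat36, perm [1,2,3,4,5,6,7,8])]"])
    (code_simp, simp)

lemma settled_pat38 [simp]: "settled pat38"
  by (rule settled_step[of _ "clause 8 [1,3,4,7]"
    "[(pat37, perm [1,2,3,4,5,6,7,8]), (pat33, perm [1,2,3,4,5,6,7,8]),
     (pat35, perm [1,2,3,4,5,6,7,8])]"])
    (code_simp, simp)

lemma settled_pat39 [simp]: "settled pat39"
  by (rule settled_step[of _ "clause 8 [2,-3,5,6]"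
    "[(pat31, perm [-3,4,5,6,2,-1,7])]"])
    (code_simp, simp)

lemma settled_pat40 [simp]: "settled pat40"
  by (rule settled_step[of _ "clause 8 [1,-2,5,-6]"
    "[(pat38, perm [1,6,-4,-3,5,2,8,7]), (pat39, perm [1,2,3,4,5,6,7,8])]"])
    (code_simp, simp)

lemma settled_pat41 [simp]: "settled pat41"
  by (rule settled_step[of _ "clause 8 [1,-3,-6,-7]" "[]"]) (code_simp, simp)

lemma settled_pat42 [simp]: "settled pat42"
  by (rule settled_step[of _ "clause 8 [1,-3,-4,8]"
    "[(pat41, perm [1,2,3,4,5,6,7,8])]"])
    (code_simp, simp)

lemma settled_pat43 [simp]: "settled pat43"
  by (rule settled_step[of _ "clause 8 [1,-5,7,-8]" "[]"]) (code_simp, simp)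

lemma settled_pat44 [simp]: "settled pat44"
  by (rule settled_step[of _ "clause 8 [1,3,-5,7]"
    "[(pat42, perm [1,2,3,4,5,6,7,8]), (pat43, perm [1,2,3,4,5,6,7,8])]"])
    (code_simp, simp)

lemma settled_pat45 [simp]: "settled pat45"
  by (rule settled_step[of _ "clause 8 [2,-3,5,6]"
    "[(pat38, perm [1,6,-4,-3,5,2,8,7]), (pat44, perm [1,2,3,4,5,6,7,8])]"])
    (code_simp, simp)

lemma settled_pat46 [simp]: "settled pat46"
  by (rule settled_step[of _ "clause 8 [1,3,-5,7]"
    "[(pat42, perm [1,2,3,4,5,6,7,8])]"])
    (code_simp, simp)

lemma settled_pat47 [simp]: "settled pat47"
  by (rule settled_step[of _ "clause 8 [2,-3,5,6]"
    "[(pat40, perm [1,6,-4,-3,5,2,8,7]), (pat45, perm [1,6,-4,-3,5,2,8,7]),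
     (pat38, perm [1,6,-4,-3,5,2,8,7]), (pat46, perm [1,2,3,4,5,6,7,8])]"])
    (code_simp, simp)

lemma settled_pat48 [simp]: "settled pat48"
  by (rule settled_step[of _ "clause 8 [2,4,5,6]"
    "[(pat38, perm [1,2,3,4,5,6,7,8]), (pat47, perm [1,2,3,4,5,6,7,8]),
     (pat40, perm [1,2,3,4,5,6,7,8]), (pat45, perm [1,2,3,4,5,6,7,8])]"])
    (code_simp, simp)

lemma settled_pat49 [simp]: "settled pat49"
  by (rule settled_step[of _ "clause 7 [1,3,4,5]"
    "[(pat48, perm [1,2,3,4,5,6,7,-8]), (pat31, perm [1,2,3,4,5,6,8])]"])
    (code_simp, simp)

text \<open>All branches below end with an empty list, so this pattern never occurs. Its first and
  third clauses differ at two shared positions, while each of them differs from the second at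
  one.\<close>

lemma settled_pat50 [simp]: "settled pat50"
  by (rule settled_step[of _ "clause 6 [1,3,4,5]"
    "[(pat49, perm [1,6,-4,-3,5,2,-7]), (pat31, perm [1,2,3,4,5,6,7]),
     (pat49, perm [1,2,3,4,5,6,7])]"])
    (code_simp, simp)

section \<open>Exclusion of \<open>pat62\<close>\<close>

lemma settled_pat51 [simp]: "settled pat51"
  by (rule settled_step[of _ "clause 8 [1,2,4,5]" "[]"]) (code_simp, simp)

lemma settled_pat52 [simp]: "settled pat52"
  by (rule settled_step[of _ "clause 8 [2,-3,4,6]"
    "[(pat50, perm [1,6,-2,-3,4,5]), (pat51, perm [1,2,3,4,5,6,7,8]),
     (pat50, perm [-1,2,3,6,4,5]), (pat50, perm [5,2,3,1,4,-6])]"])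
    (code_simp, simp)

lemma settled_pat53 [simp]: "settled pat53"
  by (rule settled_step[of _ "clause 8 [2,-3,4,6]"
    "[(pat50, perm [-1,2,3,6,4,5]), (pat50, perm [1,6,-4,-3,2,5]),
     (pat52, perm [1,2,3,5,4,6,8,7]), (pat50, perm [5,2,3,1,4,-6])]"])
    (code_simp, simp)

lemma settled_pat54 [simp]: "settled pat54"
  by (rule settled_step[of _ "clause 8 [2,-3,5,6]"
    "[(pat50, perm [1,6,-2,-3,5,4]), (pat53, perm [1,2,3,4,5,6,7,8]),
     (pat50, perm [-1,2,3,6,5,4]), (pat50, perm [1,6,-5,-3,2,4]),
     (pat52, perm [1,2,3,4,5,6,7,8]), (pat50, perm [4,2,3,1,5,-6])]"])
    (code_simp, simp)

lemma settled_pat55 [simp]: "settled pat55"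
  by (rule settled_step[of _ "clause 8 [1,-4,-5,8]"
    "[(pat50, perm [3,7,1,-4,5,-8])]"])
    (code_simp, simp)

lemma settled_pat56 [simp]: "settled pat56"
  by (rule settled_step[of _ "clause 8 [2,3,-6,-7]"
    "[(pat55, perm [1,2,3,4,5,6,7,8])]"])
    (code_simp, simp)

lemma settled_pat57 [simp]: "settled pat57"
  by (rule settled_step[of _ "clause 8 [1,-3,-5,8]" "[]"]) (code_simp, simp)

lemma settled_pat58 [simp]: "settled pat58"
  by (rule settled_step[of _ "clause 8 [1,3,-4,7]"
    "[(pat50, perm [2,7,-1,-4,3,5]), (pat57, perm [1,2,3,4,5,6,7,8])]"])
    (code_simp, simp)

lemma settled_pat59 [simp]: "settled pat59"
  by (rule settled_step[of _ "clause 8 [2,-3,4,6]"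
    "[(pat50, perm [1,6,-2,-3,4,5]), (pat56, perm [1,2,3,4,5,6,7,8]),
     (pat50, perm [-1,2,-4,6,-3,5]), (pat58, perm [1,2,3,4,5,6,7,8]),
     (pat50, perm [5,2,3,1,4,-6])]"])
    (code_simp, simp)

lemma settled_pat60 [simp]: "settled pat60"
  by (rule settled_step[of _ "clause 7 [1,3,4,5]"
    "[(pat59, perm [1,2,3,4,5,6,7,-8]), (pat54, perm [1,2,3,5,4,6,8,7])]"])
    (code_simp, simp)

lemma settled_pat61 [simp]: "settled pat61"
  by (rule settled_step[of _ "clause 7 [1,3,4,5]"
    "[(pat60, perm [1,2,3,4,5,6,8]), (pat60, perm [1,2,3,5,4,6,8])]"])
    (code_simp, simp)

text \<open>Here, too, the first and third clauses differ at two shared positions, and the pattern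
  never occurs. These two exclusions close many of the later branches.\<close>

lemma settled_pat62 [simp]: "settled pat62"
  by (rule settled_step[of _ "clause 6 [1,3,4,5]"
    "[(pat61, perm [1,2,3,4,5,6,-7]), (pat60, perm [1,2,3,4,5,6,7]), (pat60, perm [1,2,3,5,4,6,7])]"])
    (code_simp, simp)

section \<open>Five faces on six coordinates, and the family \<open>E_coll\<close>\<close>

lemma settled_pat63 [simp]: "settled pat63"
  by (rule settled_step[of _ "clause 8 [3,4,-5,-7]" "[]"]) (code_simp, simp)

text \<open>Although the final families live on eight coordinates, failing branches may involve a
  ninth.\<close>

lemma settled_pat64 [simp]: "settled pat64"
  by (rule settled_step[of _ "clause 9 [1,4,-5,9]" "[]"]) (code_simp, simp)

lemma settled_pat65 [simp]: "settled pat65"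
  by (rule settled_step[of _ "clause 8 [1,-4,5,7]"
    "[(pat50, perm [3,7,-1,-4,5,2]), (pat63, perm [1,2,3,4,5,6,7,8]),
     (pat50, perm [5,-1,-4,7,6,-2]), (pat50, perm [-6,5,-1,7,-4,2]),
     (pat64, perm [1,2,3,4,5,6,7,8,-9])]"])
    (code_simp, simp)

lemma settled_pat66 [simp]: "settled pat66"
  by (rule settled_step[of _ "clause 8 [4,-5,7,-8]"
    "[(pat50, perm [-5,-7,4,-8,1,6]), (pat65, perm [1,2,3,4,5,6,7,8])]"])
    (code_simp, simp)

lemma settled_pat67 [simp]: "settled pat67"
  by (rule settled_step[of _ "clause 8 [5,6,-7,8]"
    "[(pat66, perm [1,2,3,4,5,6,7,8])]"])
    (code_simp, simp)

lemma settled_pat68 [simp]: "settled pat68"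
  by (rule settled_step[of _ "clause 8 [1,-4,6,8]"
    "[(pat67, perm [1,2,3,4,5,6,7,8])]"])
    (code_simp, simp)

lemma settled_pat69 [simp]: "settled pat69"
  by (rule settled_step[of _ "clause 8 [4,5,-6,-8]"
    "[(pat68, perm [1,2,3,4,5,6,7,8])]"])
    (code_simp, simp)

lemma settled_pat70 [simp]: "settled pat70"
  by (rule settled_step[of _ "clause 7 [1,4,5,-6]"
    "[(pat50, perm [-6,4,-1,2,5,3]), (pat50, perm [-2,5,-1,4,-6,-3]),
     (pat50, perm [5,-1,-6,7,4,-2]), (pat50, perm [-1,5,-6,-7,4,-2]),
     (pat69, perm [1,2,3,4,5,6,7,-8]), (pat50, perm [-6,4,-5,2,1,3]),
     (pat50, perm [4,-6,-5,-2,1,3]), (pat50, perm [1,-6,4,-5,7,2]),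
     (pat50, perm [-5,1,4,-7,-6,2]), (pat69, perm [5,-2,3,-6,1,-4,7,-8])]"])
    (code_simp, simp)

lemma settled_pat71 [simp]: "settled pat71"
  by (rule settled_step[of _ "clause 7 [2,-5,-6,7]"
    "[(pat50, perm [-6,5,-1,7,2,-4]), (pat50, perm [1,-5,6,7,2,-4]), (pat70, perm [1,2,3,4,5,6,7])]"])
    (code_simp, simp)

lemma settled_pat72 [simp]: "settled pat72"
  by (rule settled_complete_E) code_simp+

lemma settled_pat73 [simp]: "settled pat73"
  by (rule settled_step[of _ "clause 8 [1,6,7,-8]"
    "[(pat72, perm [7,1,4,6,8,2,5,3])]"])
    (code_simp, simp)

lemma settled_pat74 [simp]: "settled pat74"
  by (rule settled_step[of _ "clause 8 [1,4,-5,-8]"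
    "[(pat73, perm [1,2,3,4,5,6,7,8])]"])
    (code_simp, simp)

lemma settled_pat75 [simp]: "settled pat75"
  by (rule settled_step[of _ "clause 8 [4,-5,-6,-8]"
    "[(pat74, perm [1,2,3,4,5,6,7,8])]"])
    (code_simp, simp)

lemma settled_pat76 [simp]: "settled pat76"
  by (rule settled_step[of _ "clause 8 [1,-4,6,8]"
    "[(pat75, perm [1,2,3,4,5,6,7,8]), (pat71, perm [1,7,-8,-2,6,4,-5])]"])
    (code_simp, simp)

lemma settled_pat77 [simp]: "settled pat77"
  by (rule settled_step[of _ "clause 8 [2,-4,-7,-8]"
    "[(pat76, perm [1,2,3,4,5,6,7,8])]"])
    (code_simp, simp)

lemma settled_pat78 [simp]: "settled pat78"
  by (rule settled_step[of _ "clause 8 [2,-6,-7,8]"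
    "[(pat77, perm [1,2,3,4,5,6,7,8])]"])
    (code_simp, simp)

lemma settled_pat79 [simp]: "settled pat79"
  by (rule settled_step[of _ "clause 8 [1,2,6,7]"
    "[(pat62, perm [1,6,7,-2,4,5]), (pat78, perm [1,2,3,4,5,6,7,8]),
     (pat50, perm [-4,1,-7,6,2,-5])]"])
    (code_simp, simp)

lemma settled_pat80 [simp]: "settled pat80"
  by (rule settled_step[of _ "clause 8 [1,2,5,7]"
    "[(pat79, perm [1,2,3,4,5,6,7,8])]"])
    (code_simp, simp)

lemma settled_pat81 [simp]: "settled pat81"
  by (rule settled_step[of _ "clause 7 [1,-2,-4,-6]"
    "[(pat50, perm [-1,-2,5,-6,-4,3]), (pat71, perm [1,2,3,4,5,6,7]),
     (pat50, perm [4,-6,-5,-2,1,3]), (pat50, perm [-4,1,6,5,-2,3]),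
     (pat50, perm [6,-4,1,-2,-5,-3]), (pat62, perm [6,1,-2,-4,7,5]),
     (pat62, perm [1,6,-4,-2,-7,5]), (pat80, perm [1,2,3,4,5,6,7,8])]"])
    (code_simp, simp)

lemma settled_pat82 [simp]: "settled pat82"
  by (rule settled_step[of _ "clause 7 [4,-5,-6,7]"
    "[(pat50, perm [-1,-6,5,7,4,-2]), (pat62, perm [1,2,7,-4,5,6]),
     (pat81, perm [-6,4,-3,5,1,2,-7])]"])
    (code_simp, simp)

lemma settled_pat83 [simp]: "settled pat83"
  by (rule settled_step[of _ "clause 7 [2,-4,-6,-7]"
    "[(pat50, perm [5,1,2,-4,7,6]), (pat62, perm [5,1,7,2,-4,6]), (pat62, perm [-5,-6,-7,2,-4,-1])]"])
    (code_simp, simp)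

lemma settled_pat84 [simp]: "settled pat84"
  by (rule settled_step[of _ "clause 8 [2,-5,6,7]" "[(pat62, perm [-4,1,5,2,7,6])]"]) (code_simp, simp)

lemma settled_pat85 [simp]: "settled pat85"
  by (rule settled_step[of _ "clause 8 [1,4,6,8]"
    "[(pat81, perm [-2,5,3,1,-6,4,-8])]"])
    (code_simp, simp)

lemma settled_pat86 [simp]: "settled pat86"
  by (rule settled_step[of _ "clause 8 [1,2,-5,-8]"
    "[(pat50, perm [4,1,8,2,-5,7]), (pat85, perm [1,2,3,4,5,6,7,8])]"])
    (code_simp, simp)

lemma settled_pat87 [simp]: "settled pat87"
  by (rule settled_step[of _ "clause 8 [2,-5,7,-8]"
    "[(pat86, perm [1,2,3,4,5,6,7,8])]"])
    (code_simp, simp)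

lemma settled_pat88 [simp]: "settled pat88"
  by (rule settled_step[of _ "clause 8 [1,2,5,7]"
    "[(pat84, perm [1,2,3,4,5,6,7,8]), (pat87, perm [1,2,3,4,5,6,7,8])]"])
    (code_simp, simp)

lemma settled_pat89 [simp]: "settled pat89"
  by (rule settled_step[of _ "clause 8 [1,-2,6,8]"
    "[(pat81, perm [-2,5,3,1,-6,4,-8])]"])
    (code_simp, simp)

lemma settled_pat90 [simp]: "settled pat90"
  by (rule settled_step[of _ "clause 8 [4,5,6,-8]"
    "[(pat89, perm [1,2,3,4,5,6,7,8])]"])
    (code_simp, simp)

lemma settled_pat91 [simp]: "settled pat91"
  by (rule settled_step[of _ "clause 8 [1,-2,6,7]"
    "[(pat81, perm [-4,1,-3,-6,-2,5,7]), (pat90, perm [1,2,3,4,5,6,7,8])]"])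
    (code_simp, simp)

lemma settled_pat92 [simp]: "settled pat92"
  by (rule settled_step[of _ "clause 8 [1,-4,6,7]"
    "[(pat81, perm [-6,4,-3,5,1,2,-7]), (pat62, perm [-5,6,-7,1,-4,-2]),
     (pat91, perm [1,2,3,4,5,6,7,8])]"])
    (code_simp, simp)

lemma settled_pat93 [simp]: "settled pat93"
  by (rule settled_step[of _ "clause 8 [1,2,-4,7]"
    "[(pat92, perm [1,2,3,4,5,6,7,8])]"])
    (code_simp, simp)

lemma settled_pat94 [simp]: "settled pat94"
  by (rule settled_step[of _ "clause 8 [2,-4,-7,-8]"
    "[(pat93, perm [1,2,3,4,5,6,7,8])]"])
    (code_simp, simp)

lemma settled_pat95 [simp]: "settled pat95"
  by (rule settled_step[of _ "clause 8 [2,-4,-6,8]"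
    "[(pat81, perm [5,6,-3,2,4,-1,-8]), (pat88, perm [1,2,3,4,5,6,7,8]),
     (pat94, perm [1,2,3,4,5,6,7,8])]"])
    (code_simp, simp)

lemma settled_pat96 [simp]: "settled pat96"
  by (rule settled_step[of _ "clause 7 [2,4,5,6]"
    "[(pat50, perm [6,5,-2,1,4,3]), (pat50, perm [-1,4,-2,5,6,-3]), (pat83, perm [1,2,3,4,5,6,7]),
     (pat81, perm [1,2,3,4,5,6,7]), (pat95, perm [1,2,3,4,5,6,7,-8]),
     (pat50, perm [-4,6,5,2,-1,-3]), (pat82, perm [1,2,3,4,5,6,7]),
     (pat50, perm [1,2,-5,6,4,-3]), (pat50, perm [-6,4,-1,2,5,3])]"])
    (code_simp, simp)

text \<open>Apart from dead ends, all branches below lead to \<open>pat72\<close>, that is, to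
  \<open>E_coll\<close>.\<close>

lemma settled_pat97 [simp]: "settled pat97"
  by (rule settled_step[of _ "clause 6 [1,2,4,5]"
    "[(pat50, perm [-6,4,-1,2,5,3]), (pat50, perm [6,5,-2,1,4,3]), (pat50, perm [6,5,-4,1,2,3]),
     (pat50, perm [2,1,-4,-6,5,-3]), (pat96, perm [1,2,3,4,5,6,7]),
     (pat50, perm [1,2,-5,6,4,-3]), (pat50, perm [-6,4,-5,2,1,3]), (pat96, perm [2,1,3,5,4,-6,7])]"])
    (code_simp, simp)

section \<open>Four faces on six coordinates, and the family \<open>F_coll\<close>\<close>

lemma settled_pat98 [simp]: "settled pat98"
  by (rule settled_step[of _ "clause 8 [2,-3,4,6]"
    "[(pat62, perm [-1,4,2,3,6,-7]), (pat50, perm [1,6,-4,-3,2,5])]"])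
    (code_simp, simp)

lemma settled_pat99 [simp]: "settled pat99"
  by (rule settled_step[of _ "clause 7 [2,-3,4,6]"
    "[(pat50, perm [1,6,-2,-3,4,5]), (pat50, perm [6,-2,4,-3,-1,-5]),
     (pat98, perm [1,2,3,4,5,6,7,-8]), (pat62, perm [-1,4,2,3,6,-7]),
     (pat50, perm [1,6,-4,-3,2,5])]"])
    (code_simp, simp)

lemma settled_pat100 [simp]: "settled pat100"
  by (rule settled_step[of _ "clause 8 [3,4,6,-8]" "[]"]) (code_simp, simp)

lemma settled_pat101 [simp]: "settled pat101"
  by (rule settled_step[of _ "clause 7 [1,-3,4,-6]"
    "[(pat50, perm [-6,-1,4,-3,-2,-5]), (pat50, perm [2,-6,-4,-3,1,5]),
     (pat50, perm [-2,-4,-6,-3,1,7]), (pat100, perm [1,2,3,4,5,6,7,8])]"])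
    (code_simp, simp)

lemma settled_pat102 [simp]: "settled pat102"
  by (rule settled_step[of _ "clause 7 [2,3,-4,-7]"
    "[(pat101, perm [4,-6,-3,1,5,-2,7]), (pat50, perm [4,2,3,-7,-1,-6]),
     (pat50, perm [-5,-7,4,2,3,-6]), (pat62, perm [5,6,2,-3,4,7])]"])
    (code_simp, simp)

lemma settled_pat103 [simp]: "settled pat103"
  by (rule settled_step[of _ "clause 7 [1,-2,5,-6]"
    "[(pat50, perm [-1,-2,5,-6,-4,3]), (pat102, perm [1,2,3,4,5,6,7]),
     (pat50, perm [4,-6,-5,-2,1,3])]"])
    (code_simp, simp)

lemma settled_pat104 [simp]: "settled pat104"
  by (rule settled_step[of _ "clause 8 [4,-5,7,8]"
    "[(pat97, perm [-7,4,8,-5,1,-6])]"])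
    (code_simp, simp)

lemma settled_pat105 [simp]: "settled pat105"
  by (rule settled_step[of _ "clause 8 [5,6,-7,-8]"
    "[(pat104, perm [1,2,3,4,5,6,7,8])]"])
    (code_simp, simp)

lemma settled_pat106 [simp]: "settled pat106"
  by (rule settled_step[of _ "clause 8 [1,-4,6,8]"
    "[(pat105, perm [1,2,3,4,5,6,7,8])]"])
    (code_simp, simp)

lemma settled_pat107 [simp]: "settled pat107"
  by (rule settled_step[of _ "clause 8 [4,-6,7,-8]"
    "[(pat106, perm [1,2,3,4,5,6,7,8])]"])
    (code_simp, simp)

lemma settled_pat108 [simp]: "settled pat108"
  by (rule settled_step[of _ "clause 7 [1,-4,-6,-7]"
    "[(pat50, perm [-6,4,1,-5,-7,-2]), (pat50, perm [2,-4,6,1,-7,-3]),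
     (pat50, perm [6,1,-7,-4,-2,-3]), (pat50, perm [5,-7,6,-4,1,-3]),
     (pat50, perm [-4,6,-7,-5,1,2]), (pat107, perm [1,2,3,4,5,6,7,8])]"])
    (code_simp, simp)

lemma settled_pat109 [simp]: "settled pat109"
  by (rule settled_step[of _ "clause 7 [2,-4,5,7]"
    "[(pat108, perm [1,2,3,4,5,6,7]), (pat50, perm [6,-4,-7,5,2,1])]"])
    (code_simp, simp)

lemma settled_pat110 [simp]: "settled pat110"
  by (rule settled_step[of _ "clause 7 [1,4,5,-6]"
    "[(pat109, perm [6,1,3,-2,7,-4,-5]), (pat50, perm [4,-6,-5,-2,1,3]),
     (pat62, perm [-7,-3,-4,1,-6,5])]"])
    (code_simp, simp)

lemma settled_pat111 [simp]: "settled pat111"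
  by (rule settled_step[of _ "clause 7 [1,2,-5,7]"
    "[(pat109, perm [1,2,3,4,5,6,7]), (pat110, perm [1,2,3,4,5,6,7])]"])
    (code_simp, simp)

lemma settled_pat112 [simp]: "settled pat112"
  by (rule settled_step[of _ "clause 7 [2,-5,-6,7]"
    "[(pat111, perm [4,-6,-3,1,5,-2,7]), (pat62, perm [5,-3,2,4,6,7])]"])
    (code_simp, simp)

lemma settled_pat113 [simp]: "settled pat113"
  by (rule settled_complete_F) code_simp+

lemma settled_pat114 [simp]: "settled pat114"
  by (rule settled_step[of _ "clause 8 [2,-5,6,8]"
    "[(pat113, perm [1,2,4,6,3,8,5,7])]"])
    (code_simp, simp)

lemma settled_pat115 [simp]: "settled pat115"
  by (rule settled_step[of _ "clause 8 [1,2,4,5]"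
    "[(pat114, perm [1,2,3,4,5,6,7,8])]"])
    (code_simp, simp)

lemma settled_pat116 [simp]: "settled pat116"
  by (rule settled_step[of _ "clause 8 [1,-4,6,-8]"
    "[(pat115, perm [1,2,3,4,5,6,7,8])]"])
    (code_simp, simp)

lemma settled_pat117 [simp]: "settled pat117"
  by (rule settled_step[of _ "clause 8 [4,-6,7,8]"
    "[(pat116, perm [1,2,3,4,5,6,7,8])]"])
    (code_simp, simp)

lemma settled_pat118 [simp]: "settled pat118"
  by (rule settled_step[of _ "clause 8 [1,-4,7,-8]"
    "[(pat117, perm [1,2,3,4,5,6,7,8])]"])
    (code_simp, simp)

lemma settled_pat119 [simp]: "settled pat119"
  by (rule settled_step[of _ "clause 8 [1,2,7,-8]"
    "[(pat118, perm [1,2,3,4,5,6,7,8])]"])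
    (code_simp, simp)

lemma settled_pat120 [simp]: "settled pat120"
  by (rule settled_step[of _ "clause 8 [1,-2,-4,7]"
    "[(pat111, perm [2,-4,3,-6,-7,1,5]), (pat50, perm [2,-4,7,1,-6,-3]),
     (pat119, perm [1,2,3,4,5,6,7,8]), (pat50, perm [6,1,-7,-4,-2,-3])]"])
    (code_simp, simp)

lemma settled_pat121 [simp]: "settled pat121"
  by (rule settled_step[of _ "clause 7 [1,-2,5,-6]"
    "[(pat50, perm [4,-6,-1,-2,5,3]), (pat50, perm [-1,-2,5,-6,-4,3]),
     (pat50, perm [7,5,-1,-6,-2,3]), (pat111, perm [1,2,3,4,5,6,7]),
     (pat120, perm [1,2,3,4,5,6,7,-8]), (pat50, perm [4,-6,-5,-2,1,3]),
     (pat112, perm [1,2,3,4,5,6,7])]"])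
    (code_simp, simp)

lemma settled_pat122 [simp]: "settled pat122"
  by (rule settled_step[of _ "clause 7 [1,-2,3,7]"
    "[(pat50, perm [1,2,7,3,-4,-6]), (pat62, perm [-5,7,2,1,3,6]), (pat121, perm [1,2,3,4,5,6,7])]"])
    (code_simp, simp)

lemma settled_pat123 [simp]: "settled pat123"
  by (rule settled_step[of _ "clause 7 [1,3,6,7]"
    "[(pat122, perm [1,2,3,4,5,6,7]), (pat50, perm [5,7,-1,6,3,-2]),
     (pat101, perm [1,2,3,4,5,6,7]), (pat103, perm [1,2,3,4,5,6,7]),
     (pat62, perm [5,-2,-6,1,3,7])]"])
    (code_simp, simp)

lemma settled_pat124 [simp]: "settled pat124"
  by (rule settled_step[of _ "clause 7 [1,4,5,-6]"
    "[(pat123, perm [5,1,-6,3,-2,7,4]), (pat50, perm [4,-6,-5,-2,1,3]),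
     (pat99, perm [-3,7,-6,-5,2,1,-4])]"])
    (code_simp, simp)

lemma settled_pat125 [simp]: "settled pat125"
  by (rule settled_step[of _ "clause 7 [1,-2,6,7]"
    "[(pat62, perm [-4,-3,1,-6,-7,2]), (pat124, perm [1,2,3,4,5,6,7]),
     (pat50, perm [1,-7,-5,6,-2,3])]"])
    (code_simp, simp)

lemma settled_pat126 [simp]: "settled pat126"
  by (rule settled_step[of _ "clause 7 [1,-3,4,-6]"
    "[(pat50, perm [-6,-1,4,-3,-2,-5]), (pat97, perm [1,-4,-3,-2,-6,-5]),
     (pat125, perm [1,2,3,4,5,6,7]), (pat50, perm [1,6,-2,-3,4,5])]"])
    (code_simp, simp)

lemma settled_pat127 [simp]: "settled pat127"
  by (rule settled_step[of _ "clause 7 [2,-3,-6,-7]"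
    "[(pat123, perm [1,2,3,4,5,6,7]), (pat50, perm [-5,-7,3,-6,2,-1]),
     (pat99, perm [1,2,3,4,5,6,7]), (pat126, perm [1,2,3,4,5,6,7])]"])
    (code_simp, simp)

text \<open>The continuations not yet excluded are \<open>pat97\<close>, where the fifth face stays
  on the same six coordinates, and \<open>pat127\<close>, where it uses a seventh. All patterns
  treated later are either contradictory or reach a conclusion through this one.\<close>

lemma settled_pat128 [simp]: "settled pat128"
  by (rule settled_step[of _ "clause 6 [1,-2,3,-6]"
    "[(pat50, perm [-1,-6,4,3,-2,-5]), (pat50, perm [-6,2,-4,3,1,5]),
     (pat97, perm [1,-4,-3,-2,-6,-5]), (pat50, perm [6,1,-2,3,4,5]),
     (pat50, perm [-2,6,1,3,-4,-5]), (pat127, perm [1,2,3,4,5,6,7])]"])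
    (code_simp, simp)

section \<open>A fourth face with a seventh coordinate: \<open>pat162\<close>\<close>

lemma settled_pat129 [simp]: "settled pat129"
  by (rule settled_step[of _ "clause 8 [1,2,4,5]" "[]"]) (code_simp, simp)

lemma settled_pat130 [simp]: "settled pat130"
  by (rule settled_step[of _ "clause 8 [1,2,-6,8]"
    "[(pat129, perm [1,2,3,4,5,6,7,8])]"])
    (code_simp, simp)

lemma settled_pat131 [simp]: "settled pat131"
  by (rule settled_step[of _ "clause 7 [1,-2,4,6]"
    "[(pat50, perm [-2,6,4,3,-1,-5]), (pat50, perm [6,-2,4,-3,-1,-5]),
     (pat62, perm [-1,6,-2,4,5,-3]), (pat50, perm [-2,-1,4,6,-5,3]),
     (pat130, perm [1,2,3,4,5,6,7,-8]), (pat50, perm [6,-2,1,-3,-4,-5]),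
     (pat50, perm [3,-2,-6,4,1,-7]), (pat62, perm [1,-6,4,-2,-5,3])]"])
    (code_simp, simp)

text \<open>No four coordinates are unbalanced here, so no further face is forced, and the count of
  the eight remaining faces is what excludes the pattern. The same happens for
  \<open>pat164\<close>.\<close>

lemma settled_pat132 [simp]: "settled pat132"
  by (rule settled_balanced[of 7]) code_simp+

lemma settled_pat133 [simp]: "settled pat133"
  by (rule settled_step[of _ "clause 7 [2,-3,5,6]"
    "[(pat132, perm [1,2,3,4,5,6,7])]"])
    (code_simp, simp)

lemma settled_pat134 [simp]: "settled pat134"
  by (rule settled_step[of _ "clause 7 [2,4,5,6]" "[]"]) (code_simp, simp)

lemma settled_pat135 [simp]: "settled pat135"
  by (rule settled_step[of _ "clause 7 [2,-4,-6,-7]"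
    "[(pat134, perm [1,2,3,5,4,6,-7]), (pat133, perm [1,2,3,4,5,6,7]),
     (pat134, perm [1,2,3,4,5,6,7])]"])
    (code_simp, simp)

lemma settled_pat136 [simp]: "settled pat136"
  by (rule settled_step[of _ "clause 7 [1,-2,-3,7]"
    "[(pat135, perm [1,2,3,4,5,6,7])]"])
    (code_simp, simp)

lemma settled_pat137 [simp]: "settled pat137"
  by (rule settled_step[of _ "clause 7 [1,2,-4,-6]"
    "[(pat136, perm [1,2,3,4,5,6,7]), (pat62, perm [1,-6,5,-2,-4,3]),
     (pat50, perm [1,6,-4,-3,2,5])]"])
    (code_simp, simp)

lemma settled_pat138 [simp]: "settled pat138"
  by (rule settled_step[of _ "clause 7 [1,3,-5,7]"
    "[(pat137, perm [1,2,3,4,5,6,7]), (pat62, perm [-2,3,5,1,7,6]), (pat50, perm [-4,7,5,1,3,6]),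
     (pat50, perm [-5,-7,4,1,3,6])]"])
    (code_simp, simp)

lemma settled_pat139 [simp]: "settled pat139"
  by (rule settled_step[of _ "clause 7 [1,2,-6,-7]"
    "[(pat50, perm [3,2,-1,-6,-7,-4]), (pat131, perm [1,2,3,5,4,6,-7]),
     (pat138, perm [1,2,3,4,5,6,7])]"])
    (code_simp, simp)

lemma settled_pat140 [simp]: "settled pat140"
  by (rule settled_step[of _ "clause 7 [1,-4,6,-7]"
    "[(pat128, perm [4,5,1,-3,-6,-7]), (pat131, perm [1,2,3,4,5,6,7]),
     (pat50, perm [-5,-7,4,1,6,3]), (pat139, perm [1,2,3,4,5,6,7]),
     (pat128, perm [5,4,1,-3,-6,7]), (pat50, perm [-4,7,5,1,6,3])]"])
    (code_simp, simp)

lemma settled_pat141 [simp]: "settled pat141"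
  by (rule settled_step[of _ "clause 7 [2,-3,4,5]" "[]"]) (code_simp, simp)

lemma settled_pat142 [simp]: "settled pat142"
  by (rule settled_step[of _ "clause 7 [2,-3,4,5]" "[]"]) (code_simp, simp)

lemma settled_pat143 [simp]: "settled pat143"
  by (rule settled_step[of _ "clause 7 [2,3,5,-7]"
    "[(pat140, perm [1,2,-6,7,-5,-3,4]), (pat142, perm [1,2,3,4,5,6,7]),
     (pat141, perm [1,2,3,4,5,6,7])]"])
    (code_simp, simp)

lemma settled_pat144 [simp]: "settled pat144"
  by (rule settled_step[of _ "clause 7 [1,2,-4,-7]"
    "[(pat50, perm [-7,4,-5,1,2,3]), (pat50, perm [5,-4,7,1,2,3]),
     (pat140, perm [7,-4,1,2,-6,-5,3])]"])
    (code_simp, simp)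

lemma settled_pat145 [simp]: "settled pat145"
  by (rule settled_step[of _ "clause 7 [1,-2,5,6]"
    "[(pat143, perm [1,2,3,4,5,6,7]), (pat144, perm [1,2,3,4,5,6,7]),
     (pat128, perm [4,3,2,1,5,-6])]"])
    (code_simp, simp)

lemma settled_pat146 [simp]: "settled pat146"
  by (rule settled_step[of _ "clause 7 [1,-2,-3,7]"
    "[(pat145, perm [1,2,3,4,5,6,7]), (pat50, perm [-4,7,2,1,-3,-5])]"])
    (code_simp, simp)

lemma settled_pat147 [simp]: "settled pat147"
  by (rule settled_step[of _ "clause 7 [2,3,-5,-7]"
    "[(pat50, perm [4,-7,-3,-5,2,1]), (pat50, perm [6,2,-3,-7,-5,1]),
     (pat146, perm [7,-4,1,-2,-3,-5,6])]"])
    (code_simp, simp)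

lemma settled_pat148 [simp]: "settled pat148"
  by (rule settled_step[of _ "clause 7 [1,-2,5,6]"
    "[(pat140, perm [7,-4,1,-3,-2,-5,-6]), (pat147, perm [1,2,3,4,5,6,7]),
     (pat128, perm [4,3,2,1,5,-6])]"])
    (code_simp, simp)

lemma settled_pat149 [simp]: "settled pat149"
  by (rule settled_step[of _ "clause 7 [1,2,3,-7]"
    "[(pat148, perm [1,2,3,4,5,6,7])]"])
    (code_simp, simp)

lemma settled_pat150 [simp]: "settled pat150"
  by (rule settled_step[of _ "clause 7 [1,2,3,5]"
    "[(pat50, perm [-6,2,-1,3,5,4]), (pat146, perm [1,2,3,4,5,6,7]),
     (pat128, perm [4,3,2,1,5,-6]), (pat50, perm [-6,2,-5,3,1,4]), (pat149, perm [1,2,3,4,5,6,7])]"])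
    (code_simp, simp)

lemma settled_pat151 [simp]: "settled pat151"
  by (rule settled_step[of _ "clause 8 [1,-4,-7,-8]"
    "[(pat128, perm [-6,1,8,-5,4,-7])]"])
    (code_simp, simp)

lemma settled_pat152 [simp]: "settled pat152"
  by (rule settled_step[of _ "clause 8 [4,-6,7,8]"
    "[(pat151, perm [1,2,3,4,5,6,7,8])]"])
    (code_simp, simp)

lemma settled_pat153 [simp]: "settled pat153"
  by (rule settled_step[of _ "clause 8 [1,2,4,5]"
    "[(pat150, perm [1,2,3,4,5,6,7]), (pat152, perm [1,2,3,4,5,6,7,8])]"])
    (code_simp, simp)

lemma settled_pat154 [simp]: "settled pat154"
  by (rule settled_step[of _ "clause 8 [1,4,-6,8]"
    "[(pat62, perm [3,8,-1,4,-6,-5]), (pat153, perm [1,2,3,4,5,6,7,8])]"])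
    (code_simp, simp)

lemma settled_pat155 [simp]: "settled pat155"
  by (rule settled_step[of _ "clause 7 [1,4,5,-6]"
    "[(pat128, perm [-3,4,1,5,-6,7]), (pat50, perm [5,-4,7,1,-6,-3]),
     (pat50, perm [2,1,-5,-6,4,-3]), (pat62, perm [1,-6,4,-5,-2,3]),
     (pat50, perm [4,-5,-6,1,7,3]), (pat50, perm [-7,4,-5,1,-6,-3]),
     (pat154, perm [1,2,3,4,5,6,7,8]), (pat150, perm [1,2,3,4,5,6,7])]"])
    (code_simp, simp)

lemma settled_pat156 [simp]: "settled pat156"
  by (rule settled_step[of _ "clause 8 [1,-2,-3,6]"
    "[(pat50, perm [6,-2,4,-3,-1,-5]), (pat50, perm [6,-2,5,-3,-1,-4]),
     (pat50, perm [1,6,-4,-3,2,5]), (pat50, perm [1,6,-5,-3,2,4]), (pat50, perm [6,1,-2,3,5,4])]"])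
    (code_simp, simp)

lemma settled_pat157 [simp]: "settled pat157"
  by (rule settled_step[of _ "clause 8 [1,-3,-6,8]"
    "[(pat128, perm [-3,-6,8,-4,1,2]), (pat62, perm [-5,8,6,1,-3,-4])]"])
    (code_simp, simp)

lemma settled_pat158 [simp]: "settled pat158"
  by (rule settled_step[of _ "clause 8 [1,2,-4,-8]"
    "[(pat157, perm [1,2,3,4,5,6,7,8])]"])
    (code_simp, simp)

lemma settled_pat159 [simp]: "settled pat159"
  by (rule settled_step[of _ "clause 8 [1,-3,-4,8]"
    "[(pat128, perm [-3,5,4,-6,1,-8]), (pat50, perm [-3,-8,-5,-4,1,-6])]"])
    (code_simp, simp)

lemma settled_pat160 [simp]: "settled pat160"
  by (rule settled_step[of _ "clause 8 [1,-4,-6,8]"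
    "[(pat155, perm [-3,8,-4,-6,1,-5,-2]), (pat158, perm [1,2,3,4,5,6,7,8]),
     (pat159, perm [1,2,3,4,5,6,7,8])]"])
    (code_simp, simp)

lemma settled_pat161 [simp]: "settled pat161"
  by (rule settled_step[of _ "clause 8 [1,3,6,7]"
    "[(pat156, perm [1,2,3,4,5,6,7,8]), (pat50, perm [-4,7,-3,1,6,-5]),
     (pat160, perm [1,2,3,4,5,6,7,8]), (pat140, perm [1,2,3,5,4,6,-7])]"])
    (code_simp, simp)

lemma settled_pat162 [simp]: "settled pat162"
  by (rule settled_step[of _ "clause 7 [1,-3,4,-6]"
    "[(pat140, perm [1,2,3,5,4,6,-7]), (pat128, perm [1,2,3,5,4,6]),
     (pat50, perm [2,-6,-4,-3,1,5]), (pat128, perm [2,1,3,5,4,-6]),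
     (pat62, perm [7,-5,1,3,6,-4]), (pat155, perm [1,2,3,4,5,6,7]),
     (pat161, perm [1,2,3,4,5,6,7,8]), (pat50, perm [1,6,-2,-3,4,5])]"])
    (code_simp, simp)

section \<open>The three-face pattern \<open>pat176\<close>\<close>

lemma settled_pat163 [simp]: "settled pat163"
  by (rule settled_step[of _ "clause 7 [3,4,6,7]"
    "[(pat162, perm [-2,6,-3,7,4,-1,-5]), (pat50, perm [4,7,6,-5,-3,1]),
     (pat162, perm [1,-5,7,-6,-3,4,-2]), (pat162, perm [1,5,4,-6,-3,7,-2])]"])
    (code_simp, simp)

lemma settled_pat164 [simp]: "settled pat164"
  by (rule settled_balanced[of 7]) code_simp+

lemma settled_pat165 [simp]: "settled pat165"
  by (rule settled_step[of _ "clause 7 [2,-3,6,7]"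
    "[(pat164, perm [1,2,3,4,5,6,7])]"])
    (code_simp, simp)

lemma settled_pat166 [simp]: "settled pat166"
  by (rule settled_step[of _ "clause 7 [3,4,6,7]"
    "[(pat165, perm [1,4,5,-3,-6,-7,-2]), (pat165, perm [1,2,3,5,4,6,-7])]"])
    (code_simp, simp)

lemma settled_pat167 [simp]: "settled pat167"
  by (rule settled_step[of _ "clause 7 [2,5,-6,-7]"
    "[(pat165, perm [1,2,3,4,5,6,7]), (pat166, perm [1,2,3,5,4,6,-7]),
     (pat166, perm [1,2,3,4,5,6,7])]"])
    (code_simp, simp)

lemma settled_pat168 [simp]: "settled pat168"
  by (rule settled_step[of _ "clause 7 [1,-2,4,6]"
    "[(pat167, perm [1,2,3,4,5,6,7]), (pat128, perm [5,3,2,1,4,-6])]"])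
    (code_simp, simp)

lemma settled_pat169 [simp]: "settled pat169"
  by (rule settled_step[of _ "clause 7 [1,4,5,-6]"
    "[(pat162, perm [-3,5,4,-6,1,7,-2]), (pat162, perm [-3,4,5,-6,1,-7,-2]),
     (pat168, perm [1,2,3,4,5,6,7])]"])
    (code_simp, simp)

lemma settled_pat170 [simp]: "settled pat170"
  by (rule settled_step[of _ "clause 7 [2,-3,4,6]"
    "[(pat169, perm [2,1,3,4,5,-6,7])]"])
    (code_simp, simp)

lemma settled_pat171 [simp]: "settled pat171"
  by (rule settled_step[of _ "clause 7 [3,5,6,-7]"
    "[(pat162, perm [1,-4,-7,-3,-6,5,-2]), (pat170, perm [1,2,3,4,5,6,7]),
     (pat162, perm [1,4,5,-3,-6,-7,-2])]"])
    (code_simp, simp)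

lemma settled_pat172 [simp]: "settled pat172"
  by (rule settled_step[of _ "clause 7 [1,2,-5,7]"
    "[(pat171, perm [1,2,3,4,5,6,7]), (pat169, perm [1,2,3,4,5,6,7]),
     (pat162, perm [3,5,4,2,1,7,6]), (pat162, perm [3,4,5,2,1,-7,6])]"])
    (code_simp, simp)

lemma settled_pat173 [simp]: "settled pat173"
  by (rule settled_step[of _ "clause 7 [1,2,3,-7]"
    "[(pat50, perm [-6,2,-1,3,-7,-4]), (pat163, perm [1,2,3,5,4,6,-7]),
     (pat62, perm [-6,-4,-3,1,-7,2]), (pat172, perm [1,2,3,4,5,6,7])]"])
    (code_simp, simp)

lemma settled_pat174 [simp]: "settled pat174"
  by (rule settled_step[of _ "clause 7 [1,-3,-4,-7]"
    "[(pat163, perm [1,2,3,4,5,6,7]), (pat50, perm [-4,-7,-3,5,-1,6]),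
     (pat173, perm [1,2,3,4,5,6,7]), (pat50, perm [-4,-7,1,5,3,6]),
     (pat162, perm [-6,-7,-4,1,-3,-5,-2]), (pat162, perm [-6,7,-5,1,-3,-4,-2])]"])
    (code_simp, simp)

lemma settled_pat175 [simp]: "settled pat175"
  by (rule settled_step[of _ "clause 7 [1,-3,4,-6]"
    "[(pat50, perm [2,-6,-1,-3,4,5]), (pat50, perm [-6,-1,4,-3,-2,-5]),
     (pat162, perm [1,2,3,5,4,6,-7]), (pat62, perm [-7,4,-1,-3,-6,5]),
     (pat162, perm [1,2,3,5,4,6,-8]), (pat128, perm [1,2,3,5,4,6]),
     (pat174, perm [1,2,3,5,4,6,-7]), (pat50, perm [1,6,-2,-3,4,5])]"])
    (code_simp, simp)

text \<open>In contrast to \<open>pat50\<close> and \<open>pat62\<close>, any two of the three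
  clauses differ at exactly one shared position.\<close>

lemma settled_pat176 [simp]: "settled pat176"
  by (rule settled_step[of _ "clause 6 [1,-3,5,-6]"
    "[(pat50, perm [2,-6,-1,-3,5,4]), (pat50, perm [-6,-1,5,-3,-2,-4]),
     (pat162, perm [1,2,3,4,5,6,-7]), (pat128, perm [1,2,3,4,5,6]),
     (pat50, perm [2,-6,-5,-3,1,4]), (pat128, perm [2,1,3,4,5,-6]),
     (pat175, perm [1,2,3,4,5,6,7]), (pat50, perm [1,6,-2,-3,5,4])]"])
    (code_simp, simp)

section \<open>The remaining three-face pattern on six coordinates: \<open>pat181\<close>\<close>

lemma settled_pat177 [simp]: "settled pat177"
  by (rule settled_step[of _ "clause 8 [2,-3,-4,-7]"
    "[(pat50, perm [-7,3,2,-4,-5,-6]), (pat62, perm [-3,5,4,2,6,7]),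
     (pat50, perm [-3,7,-5,-4,2,6]), (pat50, perm [-3,7,-6,-4,2,5])]"])
    (code_simp, simp)

lemma settled_pat178 [simp]: "settled pat178"
  by (rule settled_step[of _ "clause 8 [2,-4,-5,7]"
    "[(pat62, perm [5,3,2,1,4,7]), (pat62, perm [5,1,2,3,4,7]), (pat50, perm [-5,-7,1,2,-4,-3]),
     (pat50, perm [-5,-7,3,2,-4,-1])]"])
    (code_simp, simp)

lemma settled_pat179 [simp]: "settled pat179"
  by (rule settled_step[of _ "clause 8 [2,4,5,6]"
    "[(pat50, perm [-2,6,5,4,-1,-3]), (pat178, perm [1,2,3,4,5,6,7,8]),
     (pat176, perm [6,1,-4,2,5,3]), (pat177, perm [1,2,3,4,5,6,7,8]),
     (pat50, perm [-6,2,-1,4,5,3])]"])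
    (code_simp, simp)

lemma settled_pat180 [simp]: "settled pat180"
  by (rule settled_step[of _ "clause 7 [1,2,4,5]"
    "[(pat50, perm [-6,2,-1,4,5,3]), (pat176, perm [3,5,2,1,4,-7]), (pat176, perm [6,1,-4,2,5,3]),
     (pat176, perm [6,1,-5,2,4,3]), (pat50, perm [-6,2,-5,4,1,3]),
     (pat176, perm [3,7,-2,1,4,-5]), (pat62, perm [7,3,-2,1,4,5]),
     (pat179, perm [1,2,3,4,5,6,7,8])]"])
    (code_simp, simp)

lemma settled_pat181 [simp]: "settled pat181"
  by (rule settled_step[of _ "clause 6 [1,2,3,4]"
    "[(pat176, perm [-1,2,3,4,6,5]), (pat50, perm [-6,2,-1,4,3,5]),
     (pat180, perm [2,1,4,3,5,-6,7]), (pat50, perm [6,1,-2,3,4,5]),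
     (pat176, perm [1,-2,4,3,-6,-5]), (pat180, perm [1,2,3,4,5,6,7]),
     (pat50, perm [-6,2,-3,4,1,5]), (pat50, perm [6,1,-4,3,2,5])]"])
    (code_simp, simp)

section \<open>Three faces that involve a seventh coordinate: \<open>pat189\<close> and
  \<open>pat191\<close>\<close>

lemma settled_pat182 [simp]: "settled pat182"
  by (rule settled_step[of _ "clause 9 [1,-2,-3,-8]"
    "[(pat176, perm [5,4,1,2,3,-8])]"])
    (code_simp, simp)

lemma settled_pat183 [simp]: "settled pat183"
  by (rule settled_step[of _ "clause 9 [2,-3,-5,-8]"
    "[(pat182, perm [1,2,3,4,5,6,7,8,9]), (pat50, perm [-5,-8,-3,4,-2,-6]),
     (pat50, perm [-5,-8,2,4,3,-6]), (pat176, perm [6,5,4,2,-3,-8]),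
     (pat176, perm [6,4,5,2,-3,8])]"])
    (code_simp, simp)

lemma settled_pat184 [simp]: "settled pat184"
  by (rule settled_step[of _ "clause 8 [2,4,5,6]"
    "[(pat176, perm [6,1,-2,4,5,3]), (pat62, perm [-1,6,-2,4,5,-3]),
     (pat62, perm [7,3,6,-4,-5,-2]), (pat176, perm [3,7,6,-4,-5,2]),
     (pat50, perm [8,5,-2,4,6,-3]), (pat50, perm [-8,4,-2,5,6,-3]),
     (pat183, perm [9,6,-2,4,5,-3,-1,8,7]), (pat176, perm [-3,5,4,2,6,-8]),
     (pat176, perm [-3,4,5,2,6,8])]"])
    (code_simp, simp)

lemma settled_pat185 [simp]: "settled pat185"
  by (rule settled_step[of _ "clause 9 [3,-5,-6,9]"
    "[(pat176, perm [9,-4,5,3,-6,-2])]"])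
    (code_simp, simp)

lemma settled_pat186 [simp]: "settled pat186"
  by (rule settled_step[of _ "clause 9 [2,-3,6,8]"
    "[(pat62, perm [-5,8,-6,2,-3,-4]), (pat185, perm [1,2,3,4,5,6,7,8,9]),
     (pat184, perm [1,2,3,5,4,6,7,-8])]"])
    (code_simp, simp)

lemma settled_pat187 [simp]: "settled pat187"
  by (rule settled_step[of _ "clause 8 [2,-3,5,6]"
    "[(pat50, perm [1,6,-2,-3,5,4]), (pat181, perm [6,-1,5,-2,-3,-4]),
     (pat62, perm [7,-4,6,3,-5,-2]), (pat176, perm [-4,7,6,3,-5,2]),
     (pat176, perm [8,5,-2,-3,6,4]), (pat62, perm [-8,5,-2,-3,6,4]),
     (pat186, perm [1,2,3,4,5,6,7,8,-9]), (pat176, perm [4,6,-3,2,5,-1]),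
     (pat184, perm [1,2,3,5,4,6,7,-8]), (pat176, perm [4,2,6,-3,5,7])]"])
    (code_simp, simp)

lemma settled_pat188 [simp]: "settled pat188"
  by (rule settled_step[of _ "clause 8 [2,-3,5,6]"
    "[(pat176, perm [4,5,2,-3,6,8]), (pat176, perm [4,6,-3,2,5,-1]),
     (pat50, perm [1,6,-5,-3,2,4]), (pat181, perm [6,-1,2,-5,-3,-4]),
     (pat181, perm [7,2,-5,-3,6,4]), (pat50, perm [-7,2,-5,6,-3,4]),
     (pat62, perm [8,-4,2,3,-6,-5]), (pat176, perm [-4,8,2,3,-6,5]),
     (pat187, perm [1,2,3,5,4,6,7,9]), (pat176, perm [4,2,6,-3,5,7])]"])
    (code_simp, simp)

lemma settled_pat189 [simp]: "settled pat189"
  by (rule settled_step[of _ "clause 7 [2,-3,4,6]"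
    "[(pat50, perm [1,6,-2,-3,4,5]), (pat181, perm [6,-1,4,-2,-3,-5]),
     (pat62, perm [7,-5,6,3,-4,-2]), (pat176, perm [-5,7,6,3,-4,2]),
     (pat188, perm [1,2,3,4,5,6,7,-8]), (pat176, perm [5,6,-3,2,4,-1]),
     (pat50, perm [1,6,-4,-3,2,5]), (pat181, perm [6,-1,2,-4,-3,-5]),
     (pat181, perm [7,2,-4,-3,6,5]), (pat50, perm [-7,2,-4,6,-3,5]),
     (pat187, perm [1,2,3,4,5,6,7,8]), (pat176, perm [5,2,6,-3,4,7])]"])
    (code_simp, simp)

lemma settled_pat190 [simp]: "settled pat190"
  by (rule settled_step[of _ "clause 7 [2,-3,5,6]"
    "[(pat176, perm [4,5,2,-3,6,-7]), (pat176, perm [4,6,-3,2,5,-1]),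
     (pat176, perm [4,2,5,-3,6,7]), (pat176, perm [4,1,3,2,5,-6]), (pat62, perm [1,4,3,2,5,6]),
     (pat50, perm [7,5,-6,2,-3,4]), (pat50, perm [-7,2,-6,5,-3,4]),
     (pat189, perm [1,4,3,2,5,6,-8])]"])
    (code_simp, simp)

lemma settled_pat191 [simp]: "settled pat191"
  by (rule settled_step[of _ "clause 7 [3,-4,-6,7]"
    "[(pat189, perm [1,7,-3,-4,-6,5,2]), (pat62, perm [2,7,-3,-4,-6,5]),
     (pat189, perm [-1,7,4,3,-6,5,2]), (pat176, perm [7,-2,4,3,-6,-5]),
     (pat189, perm [1,7,6,3,-4,5,2]), (pat189, perm [-1,7,6,3,-4,5,2]),
     (pat62, perm [2,7,6,3,-4,5]), (pat176, perm [7,-2,6,3,-4,-5]),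
     (pat189, perm [8,7,6,3,-4,5,2]), (pat190, perm [1,5,3,4,2,6,-7])]"])
    (code_simp, simp)

section \<open>The root of the case analysis: two faces and one face\<close>

lemma settled_pat192 [simp]: "settled pat192"
  \<comment> \<open>Ten choices of a third face remain. They are of six kinds: \<open>pat50\<close>,
    \<open>pat62\<close>, \<open>pat176\<close> and \<open>pat181\<close> on the same six
    coordinates, \<open>pat189\<close> and \<open>pat191\<close> with a seventh.\<close>
  by (rule settled_step[of _ "clause 6 [3,-4,-5,-6]"
    "[(pat176, perm [2,6,-3,4,5,-1]), (pat181, perm [-6,1,-5,4,3,2]),
     (pat50, perm [-1,-6,4,3,-5,-2]), (pat191, perm [7,-6,4,-5,3,-2,1]),
     (pat181, perm [-6,1,-4,5,3,2]), (pat50, perm [-1,-6,5,3,-4,-2]),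
     (pat191, perm [7,-6,5,-4,3,-2,1]), (pat62, perm [1,2,3,4,5,6]),
     (pat176, perm [2,1,3,4,5,-6]), (pat189, perm [1,2,3,4,5,6,7])]"])
    (code_simp, simp)

text \<open>A second face on the same five coordinates would clash, so it brings in a new
  coordinate; whichever of the four signs changes, the result is \<open>pat192\<close> up to
  renaming.\<close>

lemma settled_pat193 [simp]: "settled pat193"
  by (rule settled_step[of _ "clause 5 [2,3,4,5]"
    "[(pat192, perm [6,3,-2,4,5,1]), (pat192, perm [6,2,-3,4,5,1]), (pat192, perm [6,2,-4,3,5,1]),
     (pat192, perm [6,2,-5,3,4,1])]"])
    (code_simp, simp)

end

theorem theorem2:
  fixes n :: nat and A :: "(nat \<Rightarrow> bool option) set"
  assumes "0 < n" and "antipodal_splitting n 5 A"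
  shows "equivalent {1..8} E_coll {1..n} (beta n ` A) \<or>
         equivalent {1..8} F_coll {1..n} (beta n ` A)"
proof -
  interpret splitting n A using assms(2) by unfold_locales
  have "A \<noteq> {}" using card_A by auto
  then obtain a where a: "a \<in> A" by blast
  obtain f :: "nat \<Rightarrow> nat" where f: "bij_betw f {0..<5} (dom a)"
    using ex_bij_betw_nat_finite[OF finite_dom[OF a]] card_dom[OF a] by auto
  define c where "c = replicate 5 Pos"
  \<comment> \<open>The values of the chosen face serve as reference values, so that it becomes the
    clause with \<open>Pos\<close> everywhere.\<close>
  define g where "g i = (a (f i) = Some True)" for i
  have inj: "inj_on f {..<5}" and dom: "dom a = f ` {..<5}"
    using f by (auto simp: bij_betw_def atLeast0LessThan)
  have "a (f i) = Some (g i)" if "i < 5" for i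
    using that dom by (cases "a (f i)") (auto simp: g_def)
  then have "a = inst f g c"
    using inj dom by (intro inst_eqI) (simp_all add: c_def)
  with a have "inst f g c \<in> A" by simp
  moreover have pat: "pat193 = [c]" unfolding c_def by code_simp
  moreover have "length c = 5" "degree c = 5" by (simp_all add: c_def degree_def)
  ultimately have "occurs 5 f g pat193"
    using inj unfolding occurs_def pat by simp
  then have conclusion using settled_pat193 unfolding settled_def by blast
  then show ?thesis by (simp add: conclusion_def)
qed

end
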